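(* Let $q\geq 4$ and let $a,b$ be positive integers. The sequence $\{R_n\}_{n\ge 0}$ of numbers of colored tilings of the $(2\times n)$-boards of the mosaic $\{4,q\}$ satisfies the fourth order linear homogeneous recurrence $$R_n=\alpha_q R_{n-1}+\beta_q R_{n-2}+\gamma_q R_{n-3}-b^{2(q-2)}R_{n-4}\qquad (n\geq 4),$$ where the coefficients $\alpha_q,\beta_q,\gamma_q$ (depending on $q$, $a$, $b$) are determined for all $q\ge 4$ by $$\alpha_{q+2}=a\alpha_{q+1}+b\alpha_q,\qquad \beta_{q+3}=(a^2+b)\beta_{q+2}+b(a^2+b)\beta_{q+1}-b^3\beta_q,\qquad \gamma_{q+2}=-ab\gamma_{q+1}+b^3\gamma_q$$ with initial values $\alpha_4=a^2+b$, $\alpha_5=a(a^2+3b)$, $\beta_4=2b(a^2+b)$, $\beta_5=b(a^2+b)(a^2+2b)$, $\beta_6=b(a^6+6a^4b+10a^2b^2+2b^3)$, $\gamma_4=b^2(a^2-b)$, $\gamma_5=-ab^3(a^2+b)$. Moreover $R_0=1$, $R_1=u_{q-2}$, $R_2=u_{q-2}^2+abu_{q-4}u_{q-3}+bu_{q-3}^2+b^2u_{q-4}^2$, and $$R_3=(u_{q-2}^2+2abu_{q-4}u_{q-3}+2bu_{q-3}^2+2b^2u_{q-4}^2)u_{q-2}+b^2\big(u_{q-3}u_{q-4}+(a^2+b)u_{q-4}u_{q-5}+au_{q-4}^2\big)u_{q-3}+ab^3u_{q-4}^2u_{q-5}.$$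
   Context: Let $q\ge 4$ be an integer and consider the regular square mosaic $\{4,q\}$ (Schläfli symbol), i.e. the tiling of the Euclidean plane ($q=4$) or of the hyperbolic plane ($q\ge5$) by congruent regular squares with $q$ squares around each vertex. For $n\ge1$ the $(2\times n)$-board is defined as follows. Choose a square $S_1$ of the mosaic with vertices $A_0,A_1,B_1,B_0$ in cyclic order. Inductively, for $i\ge1$ let $S_{i+1}$ be the other square of the mosaic containing the edge $A_iB_i$, with vertices $A_i,A_{i+1},B_{i+1},B_i$ in cyclic order. The first level of the board consists of $S_1,\dots,S_n$; the second level consists of all squares of the mosaic having at least one vertex in $\{A_1,\dots,A_n\}$ and no vertex in $\{B_1,\dots,B_n,A_{n+1}\}$ (here $A_{n+1}$ is the vertex of $S_{n+1}$); it has $n(q-3)$ squares. The board is the union of both levels. A domino is a pair of squares of the board sharing an edge. Given positive integers $a,b$, a colored tiling of the board is a partition of its squares into single squares and dominoes, each single square receiving one of $a$ colors and each domino one of $b$ colors. $R_n$ denotes the number of colored tilings of the $(2\times n)$-board for $n\ge1$, and $R_0=1$. The sequence $u_n$ is defined by $u_{-1}=0$, $u_0=1$, $u_n=au_{n-1}+bu_{n-2}$ for $n\ge1$ (so $u_1=a$). *)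

theory Defs
  imports "HOL-Analysis.Analysis"
begin

text \<open>
  The Euclidean plane is \<^typ>\<open>complex\<close>; the hyperbolic plane (curvature \<open>-1\<close>) is the open unit
  disc in the Beltrami--Klein model. Geodesics of the latter are Euclidean chords, so that convex
  hulls, faces, edges and extreme points have the same meaning in both geometries and the library
  notions for \<^typ>\<open>complex\<close> apply to both.
\<close>

datatype geometry = Euclidean | Hyperbolic

fun plane :: "geometry \<Rightarrow> complex set" where
  "plane Euclidean = UNIV"
| "plane Hyperbolic = ball 0 1"

fun gdist :: "geometry \<Rightarrow> complex \<Rightarrow> complex \<Rightarrow> real" where
  "gdist Euclidean x y = dist x y"
| "gdist Hyperbolic x y =
     arcosh ((1 - x \<bullet> y) / sqrt ((1 - (norm x)\<^sup>2) * (1 - (norm y)\<^sup>2)))"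

text \<open>The Riemannian metric at the point \<open>p\<close>, evaluated on the tangent vectors \<open>v\<close> and \<open>w\<close>.\<close>

fun gmetric :: "geometry \<Rightarrow> complex \<Rightarrow> complex \<Rightarrow> complex \<Rightarrow> real" where
  "gmetric Euclidean p v w = v \<bullet> w"
| "gmetric Hyperbolic p v w =
     (v \<bullet> w) / (1 - (norm p)\<^sup>2) + (p \<bullet> v) * (p \<bullet> w) / (1 - (norm p)\<^sup>2)\<^sup>2"

text \<open>The angle at \<open>p\<close> between the segments from \<open>p\<close> to \<open>x\<close> and from \<open>p\<close> to \<open>y\<close>.\<close>

definition gangle :: "geometry \<Rightarrow> complex \<Rightarrow> complex \<Rightarrow> complex \<Rightarrow> real" where
  "gangle G x p y =
     arccos (gmetric G p (x - p) (y - p) /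
             sqrt (gmetric G p (x - p) (x - p) * gmetric G p (y - p) (y - p)))"

definition congruent_sets :: "geometry \<Rightarrow> complex set \<Rightarrow> complex set \<Rightarrow> bool" where
  "congruent_sets G X Y \<longleftrightarrow>
     (\<exists>f. bij_betw f (plane G) (plane G) \<and>
          (\<forall>x\<in>plane G. \<forall>y\<in>plane G. gdist G (f x) (f y) = gdist G x y) \<and>
          f ` X = Y)"

text \<open>
  \<open>X\<close> is a convex quadrilateral whose vertices, in cyclic order, are \<open>v0, v1, v2, v3\<close>. The
  conditions on the edges rule out the degenerate cases.
\<close>

definition quadrilateral ::
    "complex set \<Rightarrow> complex \<Rightarrow> complex \<Rightarrow> complex \<Rightarrow> complex \<Rightarrow> bool" where
  "quadrilateral X v0 v1 v2 v3 \<longleftrightarrow>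
     distinct [v0, v1, v2, v3] \<and> X = convex hull {v0, v1, v2, v3} \<and>
     closed_segment v0 v1 edge_of X \<and> closed_segment v1 v2 edge_of X \<and>
     closed_segment v2 v3 edge_of X \<and> closed_segment v3 v0 edge_of X"

definition regular_square :: "geometry \<Rightarrow> complex set \<Rightarrow> bool" where
  "regular_square G X \<longleftrightarrow>
     (\<exists>v0 v1 v2 v3. {v0, v1, v2, v3} \<subseteq> plane G \<and> quadrilateral X v0 v1 v2 v3 \<and>
        gdist G v0 v1 = gdist G v1 v2 \<and> gdist G v1 v2 = gdist G v2 v3 \<and>
        gdist G v2 v3 = gdist G v3 v0 \<and>
        gangle G v3 v0 v1 = gangle G v0 v1 v2 \<and> gangle G v0 v1 v2 = gangle G v1 v2 v3 \<and>
        gangle G v1 v2 v3 = gangle G v2 v3 v0)"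

text \<open>
  A locally finite edge-to-edge tiling of the plane. In the intersection condition the empty set
  counts as a face.
\<close>

definition tiling_of_plane :: "geometry \<Rightarrow> complex set set \<Rightarrow> bool" where
  "tiling_of_plane G \<T> \<longleftrightarrow>
     \<Union>\<T> = plane G \<and>
     (\<forall>X\<in>\<T>. \<forall>Y\<in>\<T>. X \<noteq> Y \<longrightarrow>
        interior X \<inter> interior Y = {} \<and> (X \<inter> Y) face_of X \<and> (X \<inter> Y) face_of Y) \<and>
     (\<forall>x\<in>plane G. \<exists>e>0. finite {X\<in>\<T>. X \<inter> ball x e \<noteq> {}})"

text \<open>
  The mosaic with Schlaefli symbol \<open>{4,q}\<close>, which is determined up to an isometry of the plane.
\<close>

definition square_mosaic :: "nat \<Rightarrow> complex set set \<Rightarrow> bool" where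
  "square_mosaic q \<T> \<longleftrightarrow>
     (let G = (if q = 4 then Euclidean else Hyperbolic) in
        tiling_of_plane G \<T> \<and>
        (\<forall>X\<in>\<T>. regular_square G X) \<and>
        (\<forall>X\<in>\<T>. \<forall>Y\<in>\<T>. congruent_sets G X Y) \<and>
        (\<forall>v. (\<exists>X\<in>\<T>. v extreme_point_of X) \<longrightarrow> card {X\<in>\<T>. v extreme_point_of X} = q))"

text \<open>The squares of the strip are \<open>S 1, S 2, \<dots>\<close>; the value \<open>S 0\<close> plays no role.\<close>

definition square_strip ::
    "complex set set \<Rightarrow> (nat \<Rightarrow> complex) \<Rightarrow> (nat \<Rightarrow> complex) \<Rightarrow> (nat \<Rightarrow> complex set) \<Rightarrow> bool" where
  "square_strip \<T> A B S \<longleftrightarrow>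
     (\<forall>i\<ge>1. S i \<in> \<T> \<and> quadrilateral (S i) (A (i - 1)) (A i) (B i) (B (i - 1)) \<and>
            S (i + 1) \<noteq> S i)"

definition second_level ::
    "complex set set \<Rightarrow> (nat \<Rightarrow> complex) \<Rightarrow> (nat \<Rightarrow> complex) \<Rightarrow> nat \<Rightarrow> complex set set" where
  "second_level \<T> A B n =
     {X\<in>\<T>. (\<exists>i\<in>{1..n}. A i extreme_point_of X) \<and>
           (\<forall>i\<in>{1..n}. \<not> B i extreme_point_of X) \<and> \<not> A (n + 1) extreme_point_of X}"

definition board ::
    "complex set set \<Rightarrow> (nat \<Rightarrow> complex) \<Rightarrow> (nat \<Rightarrow> complex) \<Rightarrow> (nat \<Rightarrow> complex set) \<Rightarrow> nat \<Rightarrow>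
     complex set set" where
  "board \<T> A B S n = S ` {1..n} \<union> second_level \<T> A B n"

definition singles :: "complex set set \<Rightarrow> complex set set set" where
  "singles \<B> = {{X} |X. X \<in> \<B>}"

definition dominoes :: "complex set set \<Rightarrow> complex set set set" where
  "dominoes \<B> = {{X, Y} |X Y. X \<in> \<B> \<and> Y \<in> \<B> \<and> X \<noteq> Y \<and> (\<exists>e. e edge_of X \<and> e edge_of Y)}"

text \<open>
  A colored tiling is a pair of a partition and a coloring of its parts, the latter being
  undefined outside the partition.
\<close>

definition colored_tilings ::
    "int \<Rightarrow> int \<Rightarrow> complex set set \<Rightarrow> (complex set set set \<times> (complex set set \<Rightarrow> int)) set" where
  "colored_tilings a b \<B> =
     (SIGMA P : {P. partition_on \<B> P \<and> P \<subseteq> singles \<B> \<union> dominoes \<B>}.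
        \<Pi>\<^sub>E p\<in>P. if p \<in> singles \<B> then {1..a} else {1..b})"

end

theory Submission
  imports Defs "HOL-Combinatorics.Orbits"
begin

text \<open>
  The combinatorics of the board is read off from the walls of the mosaic: the line joining the
  midpoints of two opposite edges of a square is the perpendicular bisector of both, hence it
  continues as such a line in the next square. So a wall meets only tiles of which it is a wall,
  every other tile lies strictly on one side of it, and two walls determine at most one tile. The
  walls of the columns of the strip are perpendicular to the wall of the strip, hence pairwise
  disjoint, and they separate everything that is not obviously adjacent. Together with the cyclic
  order of the \<open>q\<close> tiles around \<open>A i\<close> this shows that the board is a path
  \<open>S 1, \<dots>, S n\<close> and a path \<open>T 0, \<dots>, T (n * (q - 3) - 1)\<close>, with \<open>S i\<close> joined to
  \<open>T ((i - 1) * (q - 3))\<close>. Removing squares from the end of such a graph gives a linear system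
  for the number of tilings of the board and of the board without its last lower square; the
  claimed recurrence comes from its characteristic polynomial.
\<close>

section \<open>Weighted tilings\<close>

text \<open>The hypotheses on the mosaic are local, and the obstacle is global: nothing in them says
  directly that distant columns of the board do not touch or that the strip does not return to
  itself. Signs of affine functionals decide this. In both models a bisector is the difference of
  two lifted vertices, and in a regular square the two diagonals have the same sum of lifts. So the
  bisectors of opposite edges agree as functionals, not merely as lines, and a wall runs from tile
  to tile as one fixed functional with a positive and a negative side. On the counting side the
  length of the board alone gives no closed recurrence, since a domino that joins two consecutive
  blocks of \<open>q - 3\<close> lower squares leaves a board that lacks its last square. Two
  unknowns, each tied to two earlier lengths, lead to order four. The coefficient
  \<open>b^(2 * (q - 2))\<close> is a determinant, which collapses to a power of \<open>b\<close> by
  the Cassini identity for \<open>u\<close>.\<close>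

definition board_tilings :: "complex set set \<Rightarrow> complex set set set set" where
  "board_tilings \<B> = {P. partition_on \<B> P \<and> P \<subseteq> singles \<B> \<union> dominoes \<B>}"

text \<open>The weight of a part depends on its cardinality and not on the board, so it is unchanged
  when squares of the board are removed.\<close>

definition weighted_tilings :: "int \<Rightarrow> int \<Rightarrow> complex set set \<Rightarrow> int" where
  "weighted_tilings a b \<B> = (\<Sum>P\<in>board_tilings \<B>. \<Prod>p\<in>P. if card p = 1 then a else b)"

definition adjacent :: "complex set \<Rightarrow> complex set \<Rightarrow> bool" where
  "adjacent X Y \<longleftrightarrow> X \<noteq> Y \<and> (\<exists>e. e edge_of X \<and> e edge_of Y)"

lemma adjacent_sym: "adjacent X Y \<longleftrightarrow> adjacent Y X"
  by (auto simp: adjacent_def)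

lemma finite_board_tilings:
  assumes "finite \<B>" shows "finite (board_tilings \<B>)"
proof -
  have "board_tilings \<B> \<subseteq> Pow (Pow \<B>)"
    by (auto simp: board_tilings_def partition_on_def)
  then show ?thesis
    using assms by (meson finite_Pow_iff finite_subset)
qed

lemma board_tilings_finite:
  assumes "finite \<B>" "P \<in> board_tilings \<B>" shows "finite P"
  using assms finite_elements[of \<B> P] by (simp add: board_tilings_def)

lemma in_singles_iff_card:
  assumes "p \<in> singles \<B> \<union> dominoes \<B>"
  shows "p \<in> singles \<B> \<longleftrightarrow> card p = 1"
  using assms by (auto simp: singles_def dominoes_def card_1_singleton_iff doubleton_eq_iff)

text \<open>For a fixed partition the colorings form a product of palettes. Nonnegativity of
  \<open>a\<close> and \<open>b\<close> is what gives the palettes \<open>a\<close> and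
  \<open>b\<close> elements.\<close>

lemma card_colored_tilings:
  assumes "finite \<B>" "0 \<le> a" "0 \<le> b"
  shows "int (card (colored_tilings a b \<B>)) = weighted_tilings a b \<B>"
proof -
  have fin: "finite P" if "P \<in> board_tilings \<B>" for P
    using board_tilings_finite[OF assms(1) that] .
  have "card (colored_tilings a b \<B>) =
    (\<Sum>P\<in>board_tilings \<B>. card (\<Pi>\<^sub>E p\<in>P. if p \<in> singles \<B> then {1..a} else {1..b}))"
    unfolding colored_tilings_def board_tilings_def[symmetric]
    by (rule card_SigmaI) (auto simp: finite_board_tilings assms intro!: finite_PiE fin)
  also have "int \<dots> = weighted_tilings a b \<B>"
    unfolding weighted_tilings_def of_nat_sum
  proof (rule sum.cong[OF refl])
    fix P assume P: "P \<in> board_tilings \<B>"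
    have "int (card (\<Pi>\<^sub>E p\<in>P. if p \<in> singles \<B> then {1..a} else {1..b}))
      = (\<Prod>p\<in>P. int (card (if p \<in> singles \<B> then {1..a} else {1..b})))"
      using fin[OF P] by (simp add: card_PiE)
    also have "\<dots> = (\<Prod>p\<in>P. if card p = 1 then a else b)"
    proof (rule prod.cong[OF refl])
      fix p assume "p \<in> P"
      then have "p \<in> singles \<B> \<union> dominoes \<B>"
        using P by (auto simp: board_tilings_def)
      from in_singles_iff_card[OF this]
      show "int (card (if p \<in> singles \<B> then {1..a} else {1..b})) = (if card p = 1 then a else b)"
        using assms by auto
    qed
    finally show "int (card (\<Pi>\<^sub>E p\<in>P. if p \<in> singles \<B> then {1..a} else {1..b}))
      = (\<Prod>p\<in>P. if card p = 1 then a else b)" .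
  qed
  finally show ?thesis .
qed

lemma weighted_tilings_empty: "weighted_tilings a b {} = 1"
proof -
  have "board_tilings {} = {{}}"
    by (auto simp: board_tilings_def partition_on_empty)
  then show ?thesis by (simp add: weighted_tilings_def)
qed

lemma board_tilings_remove:
  assumes "P \<in> board_tilings \<B>" "p \<in> P"
  shows "P - {p} \<in> board_tilings (\<B> - p)"
proof -
  have part: "partition_on \<B> P" and sub: "P \<subseteq> singles \<B> \<union> dominoes \<B>"
    using assms by (auto simp: board_tilings_def)
  have disj: "disjnt p (\<Union>(P - {p}))"
    using part assms(2) unfolding partition_on_def disjoint_def disjnt_def by blast
  have "insert p (P - {p}) = P" using assms by auto
  then have part': "partition_on (\<B> - p) (P - {p})"
    using partition_on_insert[OF disj] part by metis
  moreover have "P - {p} \<subseteq> singles (\<B> - p) \<union> dominoes (\<B> - p)"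
  proof
    fix r assume r: "r \<in> P - {p}"
    then have "r \<subseteq> \<B> - p" using part' by (auto simp: partition_on_def)
    moreover have "r \<in> singles \<B> \<union> dominoes \<B>" using r sub by auto
    ultimately show "r \<in> singles (\<B> - p) \<union> dominoes (\<B> - p)"
      unfolding singles_def dominoes_def by blast
  qed
  ultimately show ?thesis by (simp add: board_tilings_def)
qed

lemma board_tilings_insert:
  assumes "P \<in> board_tilings (\<B> - p)" "p \<in> singles \<B> \<union> dominoes \<B>"
  shows "insert p P \<in> board_tilings \<B>" "p \<notin> P"
proof -
  have part: "partition_on (\<B> - p) P" and sub: "P \<subseteq> singles (\<B> - p) \<union> dominoes (\<B> - p)"
    using assms by (auto simp: board_tilings_def)
  have p: "p \<noteq> {}" "p \<subseteq> \<B>"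
    using assms(2) by (auto simp: singles_def dominoes_def)
  have disj: "disjnt p (\<Union>P)"
    using part by (auto simp: partition_on_def disjnt_def)
  have "singles (\<B> - p) \<union> dominoes (\<B> - p) \<subseteq> singles \<B> \<union> dominoes \<B>"
    unfolding singles_def dominoes_def by blast
  then show "insert p P \<in> board_tilings \<B>"
    using partition_on_insert[OF disj, of \<B>] part p sub assms(2) by (auto simp: board_tilings_def)
  show "p \<notin> P" using disj p by (auto simp: disjnt_def)
qed

text \<open>The tilings are sorted by the part \<open>p\<close> that contains \<open>X\<close>.
  Removing \<open>p\<close> is a bijection onto the tilings of \<open>\<B> - p\<close>, and
  \<open>p\<close> is either \<open>{X}\<close> or a domino made of \<open>X\<close> and a
  neighbor.\<close>

lemma weighted_tilings_rec:
  assumes fin: "finite \<B>" and X: "X \<in> \<B>"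
  shows "weighted_tilings a b \<B> = a * weighted_tilings a b (\<B> - {X})
    + b * (\<Sum>Y\<in>{Y\<in>\<B>. adjacent X Y}. weighted_tilings a b (\<B> - {X, Y}))"
proof -
  define N where "N = {Y\<in>\<B>. adjacent X Y}"
  define C where "C = {p \<in> singles \<B> \<union> dominoes \<B>. X \<in> p}"
  define W where "W P = (\<Prod>p\<in>P. if card p = 1 then a else b)" for P :: "complex set set set"
  have C_eq: "C = insert {X} ((\<lambda>Y. {X, Y}) ` N)"
    using X unfolding C_def N_def singles_def dominoes_def adjacent_def by blast
  have finN: "finite N" using fin by (simp add: N_def)
  have X_N: "X \<notin> N" by (simp add: N_def adjacent_def)
  have finC: "finite C" using finN by (simp add: C_eq)
  have W_insert: "(\<Sum>P\<in>insert p ` board_tilings (\<B> - p). W P)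
      = (if card p = 1 then a else b) * weighted_tilings a b (\<B> - p)" if p: "p \<in> C" for p
  proof -
    have notin: "p \<notin> P" "finite P" if "P \<in> board_tilings (\<B> - p)" for P
      using board_tilings_insert[OF that] p board_tilings_finite[OF _ that] fin by (auto simp: C_def)
    have "inj_on (insert p) (board_tilings (\<B> - p))"
      using notin by (intro inj_onI) (metis Diff_insert_absorb)
    then have "(\<Sum>P\<in>insert p ` board_tilings (\<B> - p). W P)
       = (\<Sum>P\<in>board_tilings (\<B> - p). W (insert p P))"
      by (simp add: sum.reindex)
    also have "\<dots> = (\<Sum>P\<in>board_tilings (\<B> - p). (if card p = 1 then a else b) * W P)"
      using notin by (intro sum.cong) (auto simp: W_def)
    finally show ?thesis
      by (simp add: sum_distrib_left weighted_tilings_def W_def)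
  qed
  have tl: "board_tilings \<B> = (\<Union>p\<in>C. insert p ` board_tilings (\<B> - p))"
  proof (intro subset_antisym subsetI)
    fix P assume P: "P \<in> board_tilings \<B>"
    then obtain p where p: "p \<in> P" "X \<in> p"
      using X by (auto simp: board_tilings_def partition_on_def)
    with P have "p \<in> C" by (auto simp: C_def board_tilings_def)
    moreover have "P = insert p (P - {p})" using p by auto
    ultimately show "P \<in> (\<Union>p\<in>C. insert p ` board_tilings (\<B> - p))"
      using board_tilings_remove[OF P p(1)] by blast
  next
    fix P assume "P \<in> (\<Union>p\<in>C. insert p ` board_tilings (\<B> - p))"
    then show "P \<in> board_tilings \<B>"
      using board_tilings_insert(1) by (auto simp: C_def)
  qed
  have disj: "insert p ` board_tilings (\<B> - p) \<inter> insert r ` board_tilings (\<B> - r) = {}"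
    if pr: "p \<in> C" "r \<in> C" "p \<noteq> r" for p r
  proof (rule ccontr)
    assume "\<not> ?thesis"
    then obtain P where P: "P \<in> insert p ` board_tilings (\<B> - p)"
        "P \<in> insert r ` board_tilings (\<B> - r)" by auto
    then have "p \<in> P" "r \<in> P" by auto
    moreover have "P \<in> board_tilings \<B>"
      using P(1) board_tilings_insert(1) pr(1) by (auto simp: C_def)
    ultimately have "p \<in> P" "r \<in> P" "P \<in> board_tilings \<B>" by auto
    then have "p \<inter> r = {}"
      using pr(3) by (auto simp: board_tilings_def partition_on_def disjoint_def)
    then show False using pr by (auto simp: C_def)
  qed
  have "weighted_tilings a b \<B> = (\<Sum>P\<in>(\<Union>p\<in>C. insert p ` board_tilings (\<B> - p)). W P)"
    by (simp add: weighted_tilings_def tl W_def)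
  also have "\<dots> = (\<Sum>p\<in>C. \<Sum>P\<in>insert p ` board_tilings (\<B> - p). W P)"
    using finC fin disj by (intro sum.UNION_disjoint) (auto intro!: finite_imageI finite_board_tilings)
  also have "\<dots> = (\<Sum>p\<in>C. (if card p = 1 then a else b) * weighted_tilings a b (\<B> - p))"
    using W_insert by (intro sum.cong) auto
  also have "\<dots> = a * weighted_tilings a b (\<B> - {X}) +
     (\<Sum>p\<in>(\<lambda>Y. {X, Y}) ` N. (if card p = 1 then a else b) * weighted_tilings a b (\<B> - p))"
    unfolding C_eq using finN X_N by (subst sum.insert) auto
  also have "(\<Sum>p\<in>(\<lambda>Y. {X, Y}) ` N. (if card p = 1 then a else b) * weighted_tilings a b (\<B> - p))
     = (\<Sum>Y\<in>N. b * weighted_tilings a b (\<B> - {X, Y}))"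
  proof (subst sum.reindex)
    show "inj_on (\<lambda>Y. {X, Y}) N"
      by (rule inj_onI) (metis doubleton_eq_iff)
    have "card {X, Y} = 2" if "Y \<in> N" for Y
      using X_N that by (intro card_2_iff[THEN iffD2]) auto
    then show "sum ((\<lambda>p. (if card p = 1 then a else b) * weighted_tilings a b (\<B> - p)) \<circ> (\<lambda>Y. {X, Y})) N
      = (\<Sum>Y\<in>N. b * weighted_tilings a b (\<B> - {X, Y}))"
      by (intro sum.cong) simp_all
  qed
  finally show ?thesis by (simp add: N_def sum_distrib_left)
qed

section \<open>Tilings of two paths joined by rungs at regular distances\<close>

locale ladder =
  fixes S T :: "nat \<Rightarrow> complex set" and s :: nat
  assumes s_pos: "s \<ge> 1"
    and S_inj: "\<lbrakk>i \<ge> 1; j \<ge> 1; S i = S j\<rbrakk> \<Longrightarrow> i = j"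
    and T_inj: "T m = T m' \<Longrightarrow> m = m'"
    and S_neq_T: "i \<ge> 1 \<Longrightarrow> S i \<noteq> T m"
    and adjacent_SS: "\<lbrakk>i \<ge> 1; j \<ge> 1\<rbrakk> \<Longrightarrow> adjacent (S i) (S j) \<longleftrightarrow> i = j + 1 \<or> j = i + 1"
    and adjacent_TT: "adjacent (T m) (T m') \<longleftrightarrow> m = m' + 1 \<or> m' = m + 1"
    and adjacent_ST: "i \<ge> 1 \<Longrightarrow> adjacent (S i) (T m) \<longleftrightarrow> m = (i - 1) * s"
begin

text \<open>The two lengths are independent because removing squares one at a time leaves pieces of
  the ladder that are not boards. With \<open>s = q - 3\<close> the board is the piece
  \<open>m = i * s\<close>.\<close>

definition tilings :: "int \<Rightarrow> int \<Rightarrow> nat \<Rightarrow> nat \<Rightarrow> int" where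
  "tilings a b i m = weighted_tilings a b (S ` {1..i} \<union> T ` {..<m})"

text \<open>The value \<open>0\<close> at \<open>m = 0\<close> makes the recurrences below hold without case distinction.\<close>

definition tilings_pred :: "int \<Rightarrow> int \<Rightarrow> nat \<Rightarrow> nat \<Rightarrow> int" where
  "tilings_pred a b i m = (if m = 0 then 0 else tilings a b i (m - 1))"

lemma tilings_0_0: "tilings a b 0 0 = 1"
  by (simp add: tilings_def weighted_tilings_empty)

lemma tilings_pred_Suc: "tilings_pred a b i (Suc m) = tilings a b i m"
  by (simp add: tilings_pred_def)

lemma S_eq_iff: "\<lbrakk>Suc 0 \<le> i; Suc 0 \<le> j\<rbrakk> \<Longrightarrow> S i = S j \<longleftrightarrow> i = j"
  using S_inj by auto

lemma T_eq_iff: "T m = T m' \<longleftrightarrow> m = m'"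
  using T_inj by auto

lemma S_T_neq: "Suc 0 \<le> i \<Longrightarrow> S i \<noteq> T m" "Suc 0 \<le> i \<Longrightarrow> T m \<noteq> S i"
  using S_neq_T[of i m] by auto

lemmas distinctness = S_eq_iff T_eq_iff S_T_neq

lemma T_neighbors:
  "{Y \<in> S ` {1..i} \<union> T ` {..<Suc m}. adjacent (T m) Y}
     = T ` {k. m = Suc k} \<union> S ` {j \<in> {1..i}. m = (j - 1) * s}"
  using adjacent_ST adjacent_sym[of "T m"] by (auto simp: adjacent_TT)

lemma remove_T:
  "S ` {1..i} \<union> T ` {..<Suc m} - {T m} = S ` {1..i} \<union> T ` {..<m}"
  by (auto simp: distinctness lessThan_Suc)

lemma remove_TT:
  "S ` {1..i} \<union> T ` {..<Suc (Suc m)} - {T (Suc m), T m} = S ` {1..i} \<union> T ` {..<m}"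
  by (auto simp: distinctness lessThan_Suc)

lemma remove_TS:
  "S ` {1..Suc i} \<union> T ` {..<Suc m} - {T m, S (Suc i)} = S ` {1..i} \<union> T ` {..<m}"
  by (auto simp: distinctness lessThan_Suc atLeastAtMostSuc_conv)

lemma T_in_board: "T m \<in> S ` {1..i} \<union> T ` {..<Suc m}"
  by auto

text \<open>No rung of the piece ends at the last lower square \<open>T m\<close>, so a domino can
  join it only to \<open>T (m - 1)\<close>.\<close>

lemma tilings_Suc_free:
  assumes "\<And>j. j \<in> {1..i} \<Longrightarrow> m \<noteq> (j - 1) * s"
  shows "tilings a b i (Suc m) = a * tilings a b i m + b * tilings_pred a b i m"
proof -
  note rec = weighted_tilings_rec[OF _ T_in_board[of m i], of a b]
  have none: "{j \<in> {1..i}. m = (j - 1) * s} = {}"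
    using assms by auto
  show ?thesis
  proof (cases m)
    case 0
    have nb: "{Y \<in> S ` {1..i} \<union> T ` {..<Suc m}. adjacent (T m) Y} = {}"
      unfolding T_neighbors none using 0 by simp
    show ?thesis
      unfolding tilings_def using rec by (simp only: nb remove_T) (simp add: 0 tilings_pred_def)
  next
    case (Suc k)
    then have "{k'. m = Suc k'} = {k}" by auto
    then have nb: "{Y \<in> S ` {1..i} \<union> T ` {..<Suc m}. adjacent (T m) Y} = {T k}"
      unfolding T_neighbors none by simp
    show ?thesis
      unfolding tilings_def using rec
      by (simp only: nb remove_T) (simp add: Suc tilings_pred_def tilings_def remove_TT[unfolded One_nat_def])
  qed
qed

text \<open>The last lower square carries the rung of the last upper square. A domino on this rung
  shortens both paths at once, which is the third term.\<close>

lemma tilings_Suc_rung: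
  "tilings a b (Suc i) (Suc (i * s)) =
     a * tilings a b (Suc i) (i * s) + b * tilings_pred a b (Suc i) (i * s) + b * tilings a b i (i * s)"
proof -
  define m where "m = i * s"
  note rec = weighted_tilings_rec[OF _ T_in_board[of m "Suc i"], of a b]
  have one: "{j \<in> {1..Suc i}. m = (j - 1) * s} = {Suc i}"
    using s_pos by (auto simp: m_def)
  have "tilings a b (Suc i) (Suc m) = a * tilings a b (Suc i) m + b * tilings_pred a b (Suc i) m + b * tilings a b i m"
  proof (cases m)
    case 0
    have nb: "{Y \<in> S ` {1..Suc i} \<union> T ` {..<Suc m}. adjacent (T m) Y} = {S (Suc i)}"
      unfolding T_neighbors one using 0 by simp
    show ?thesis
      unfolding tilings_def using rec
      by (simp only: nb remove_T) (simp add: tilings_pred_def remove_TS[unfolded One_nat_def] 0)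
  next
    case (Suc k)
    then have "{k'. m = Suc k'} = {k}" by auto
    then have nb: "{Y \<in> S ` {1..Suc i} \<union> T ` {..<Suc m}. adjacent (T m) Y} = {T k, S (Suc i)}"
      unfolding T_neighbors one by auto
    have "T k \<noteq> S (Suc i)" using S_T_neq by simp
    then have "tilings a b (Suc i) (Suc m) = a * tilings a b (Suc i) m +
        b * (weighted_tilings a b (S ` {1..Suc i} \<union> T ` {..<Suc m} - {T m, T k}) + tilings a b i m)"
      unfolding tilings_def using rec by (simp only: nb remove_T) (simp add: remove_TS[unfolded One_nat_def])
    then show ?thesis
      unfolding Suc remove_TT by (simp add: tilings_pred_def tilings_def algebra_simps)
  qed
  then show ?thesis by (simp add: m_def)
qed

text \<open>The rung of \<open>S (Suc i)\<close> would end at \<open>T (i * s)\<close>, which the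
  bound on \<open>m\<close> excludes. So the last upper square can be joined only to its
  predecessor.\<close>

lemma tilings_Suc_S:
  assumes "m \<le> i * s"
  shows "tilings a b (Suc i) m = a * tilings a b i m + b * (if i = 0 then 0 else tilings a b (i - 1) m)"
proof -
  have mem: "S (Suc i) \<in> S ` {1..Suc i} \<union> T ` {..<m}" by auto
  note rec = weighted_tilings_rec[OF _ mem, of a b]
  have nb: "{Y \<in> S ` {1..Suc i} \<union> T ` {..<m}. adjacent (S (Suc i)) Y} = S ` ({1..i} \<inter> {i})"
    using assms by (auto simp: adjacent_SS adjacent_ST)
  have rem: "S ` {1..Suc i} \<union> T ` {..<m} - {S (Suc i)} = S ` {1..i} \<union> T ` {..<m}"
    by (auto simp: distinctness atLeastAtMostSuc_conv)
  show ?thesis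
  proof (cases i)
    case 0
    then have nb0: "S ` ({1..i} \<inter> {i}) = {}" by simp
    show ?thesis
      unfolding tilings_def using rec by (simp only: nb nb0 rem) (simp add: 0)
  next
    case (Suc k)
    then have nb1: "S ` ({1..i} \<inter> {i}) = {S i}" by simp
    have rem2: "S ` {1..Suc i} \<union> T ` {..<m} - {S (Suc i), S i} = S ` {1..i - 1} \<union> T ` {..<m}"
      unfolding Suc by (auto simp: distinctness atLeastAtMostSuc_conv)
    show ?thesis
      unfolding tilings_def using rec by (simp only: nb nb1 rem) (simp add: rem2[unfolded Suc One_nat_def, simplified] Suc)
  qed
qed

end

section \<open>Path numbers and the linear system for the board counts\<close>

locale path_numbers =
  fixes a b :: int and u :: "int \<Rightarrow> int"
  assumes u_minus_one: "u (-1) = 0" and u_zero: "u 0 = 1"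
    and u_rec: "k \<ge> 1 \<Longrightarrow> u k = a * u (k - 1) + b * u (k - 2)"

locale weighted_ladder = ladder + path_numbers
begin

text \<open>\<open>u k\<close> is the total weight of a path of \<open>k\<close> squares. A rungless
  stretch of \<open>k\<close> squares is either not joined to \<open>T (m - 1)\<close>, or a domino
  across the joint leaves \<open>k - 1\<close> of its squares.\<close>

lemma tilings_path:
  assumes "\<And>j k'. \<lbrakk>j \<in> {1..i}; k' < k\<rbrakk> \<Longrightarrow> m + k' \<noteq> (j - 1) * s"
  shows "tilings a b i (m + k) = u (int k) * tilings a b i m + b * u (int k - 1) * tilings_pred a b i m"
  using assms
proof (induction k rule: less_induct)
  case (less k)
  consider "k = 0" | "k = 1" | k' where "k = Suc (Suc k')"
    by (metis One_nat_def old.nat.exhaust)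
  then show ?case
  proof cases
    case 1
    then show ?thesis by (simp add: u_minus_one u_zero)
  next
    case 2
    have "tilings a b i (Suc m) = a * tilings a b i m + b * tilings_pred a b i m"
      using less.prems[of _ 0] 2 by (intro tilings_Suc_free) auto
    then show ?thesis using 2 u_rec[of 1] by (simp add: u_minus_one u_zero)
  next
    case 3
    have 4: "tilings a b i (Suc (m + Suc k')) = a * tilings a b i (m + Suc k') + b * tilings a b i (m + k')"
      using less.prems[of _ "Suc k'"] 3 tilings_Suc_free[of i "m + Suc k'"] tilings_pred_Suc[of a b i "m + k'"] by auto
    have 5: "tilings a b i (m + Suc k') = u (int (Suc k')) * tilings a b i m + b * u (int (Suc k') - 1) * tilings_pred a b i m"
      using less.prems 3 by (intro less.IH) auto
    have 6: "tilings a b i (m + k') = u (int k') * tilings a b i m + b * u (int k' - 1) * tilings_pred a b i m"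
      using less.prems 3 by (intro less.IH) auto
    have 7: "u (int k) = a * u (int (Suc k')) + b * u (int k')"
      using u_rec[of "int k"] 3 by simp
    have 8: "u (int k - 1) = a * u (int (Suc k') - 1) + b * u (int k' - 1)"
      using u_rec[of "int k - 1"] 3 by simp
    show ?thesis using 4 5 6 unfolding 7 8 by (simp add: 3 algebra_simps)
  qed
qed

text \<open>For \<open>s = q - 3\<close> these are the terms of \<open>u\<close> with indices
  \<open>q - 3\<close>, \<open>q - 4\<close> and \<open>q - 5\<close>: a whole block of lower
  squares and a block short of one or two squares. For \<open>s = 1\<close> the index of
  \<open>W\<close> is \<open>-1\<close>.\<close>

abbreviation "U \<equiv> u (int s)"
abbreviation "V \<equiv> u (int s - 1)"
abbreviation "W \<equiv> u (int s - 2)"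

text \<open>Through \<open>tilings_pred\<close> the second unknown has the value \<open>0\<close> at
  \<open>n = 0\<close>, as the recurrences require.\<close>

definition "cut_count n = tilings_pred a b n (n * s)"
definition "board_count n = tilings a b n (n * s)"

lemma U_rec: "U = a * V + b * W"
  using u_rec[of "int s"] s_pos by simp

lemma before_column: "j \<in> {1..n} \<Longrightarrow> n * s + k \<noteq> (j - 1) * s"
proof -
  assume "j \<in> {1..n}"
  then have "j - 1 < n" by auto
  then have "(j - 1) * s < n * s" using s_pos by simp
  then show ?thesis by linarith
qed

text \<open>Without \<open>S (Suc n)\<close> no rung ends in the block that starts at
  \<open>T (n * s)\<close>, so the whole block is a free stretch.\<close>

lemma tilings_missing_S: "tilings a b n (Suc n * s) = U * board_count n + b * V * cut_count n"
  using tilings_path[of n s "n * s"] before_column[of _ n] by (simp add: board_count_def cut_count_def add.commute)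

lemma tilings_pred_missing_S: "tilings_pred a b n (Suc n * s) = V * board_count n + b * W * cut_count n"
proof -
  have "n * s + (s - 1) = Suc n * s - 1" using s_pos by simp
  moreover have "int (s - 1) = int s - 1" using s_pos by simp
  ultimately have "tilings a b n (Suc n * s - 1) = V * board_count n + b * W * cut_count n"
    using tilings_path[of n "s - 1" "n * s"] before_column[of _ n] by (simp add: board_count_def cut_count_def)
  then show ?thesis using s_pos by (simp add: tilings_pred_def)
qed

text \<open>The first square of the last block is joined to nothing outside the block, which gives
  the \<open>Y\<close> term, or it is joined to its left neighbor (\<open>H\<close>) or to the
  square above (\<open>board_count n\<close>), which costs the block one square. For
  \<open>cut_count\<close> the block is shorter by one from the start.\<close>

lemma counts_Suc:
  fixes n :: nat
  defines "Y \<equiv> tilings a b (Suc n) (n * s)" and "H \<equiv> tilings_pred a b (Suc n) (n * s)"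
  shows "board_count (Suc n) = U * Y + b * V * (H + board_count n)" "cut_count (Suc n) = V * Y + b * W * (H + board_count n)"
proof -
  have X: "tilings a b (Suc n) (Suc (n * s)) = a * Y + b * H + b * board_count n"
    unfolding tilings_Suc_rung Y_def H_def board_count_def by simp
  have free: "Suc (n * s) + k' \<noteq> (j - 1) * s" if "j \<in> {1..Suc n}" "k' < s - 1" for j k'
  proof -
    have "j - 1 \<le> n" using that by auto
    then have "(j - 1) * s \<le> n * s" by simp
    then show ?thesis by linarith
  qed
  have "Suc (n * s) + (s - 1) = Suc n * s" using s_pos by simp
  moreover have "int (s - 1) = int s - 1" using s_pos by simp
  ultimately have "board_count (Suc n) = V * (a * Y + b * H + b * board_count n) + b * W * Y"
    using tilings_path[of "Suc n" "s - 1" "Suc (n * s)", OF free] X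
    by (simp add: board_count_def[of "Suc n"] tilings_pred_Suc Y_def add.commute)
  then show "board_count (Suc n) = U * Y + b * V * (H + board_count n)"
    by (simp add: U_rec algebra_simps)
  show "cut_count (Suc n) = V * Y + b * W * (H + board_count n)"
  proof (cases "s = 1")
    \<comment> \<open>Here \<open>s - 2\<close> would be truncated. The block is a single square,
      and \<open>V = 1\<close>, \<open>W = 0\<close> give the same formula.\<close>
    case True
    then have "Suc n * s = Suc (n * s)" by simp
    then show ?thesis unfolding cut_count_def using True by (simp add: tilings_pred_Suc Y_def u_minus_one u_zero)
  next
    case False
    then have s2: "s \<ge> 2" using s_pos by simp
    have "Suc (n * s) + (s - 2) = Suc n * s - 1" using s2 by simp
    moreover have "int (s - 2) = int s - 2" using s2 by simp
    moreover have "Suc (n * s) + k' \<noteq> (j - 1) * s" if "j \<in> {1..Suc n}" "k' < s - 2" for j k'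
      using free[of j k'] that by auto
    ultimately have "tilings a b (Suc n) (Suc n * s - 1) = W * (a * Y + b * H + b * board_count n) + b * u (int s - 3) * Y"
      using tilings_path[of "Suc n" "s - 2" "Suc (n * s)"] X by (simp add: tilings_pred_Suc Y_def)
    moreover have "V = a * W + b * u (int s - 3)"
      using u_rec[of "int s - 1"] s2 by simp
    ultimately show ?thesis
      using s2 by (simp add: cut_count_def tilings_pred_def algebra_simps)
  qed
qed

lemma counts_0: "board_count 0 = 1" "cut_count 0 = 0"
  by (simp_all add: board_count_def cut_count_def tilings_0_0 tilings_pred_def)

lemma counts_1: "board_count 1 = u (int s + 1)" "cut_count 1 = U"
proof -
  have "tilings a b (Suc 0) 0 = a" "tilings_pred a b (Suc 0) 0 = 0"
    using tilings_Suc_S[of 0 0] tilings_0_0 by (simp_all add: tilings_pred_def)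
  then show "board_count 1 = u (int s + 1)" "cut_count 1 = U"
    using counts_Suc[of 0] u_rec[of "int s + 1"] U_rec by (simp_all add: counts_0 algebra_simps)
qed

text \<open>In \<open>counts_Suc\<close> the last upper square is now removed from \<open>Y\<close>
  and \<open>H\<close>. Alone it leaves the counts of length \<open>n + 1\<close>; together with its
  left neighbor it leaves length \<open>n\<close> with a rungless block appended.\<close>

lemma counts_rec:
  shows "board_count (n + 2) = (a * U + b * V) * board_count (n + 1) + a * b * V * cut_count (n + 1)
      + (b * U^2 + b^2 * V^2) * board_count n + b^2 * V * (U + b * W) * cut_count n" (is ?th1)
    and "cut_count (n + 2) = U * board_count (n + 1) + a * b * W * cut_count (n + 1)
      + b * V * (U + b * W) * board_count n + (b^2 * V^2 + b^3 * W^2) * cut_count n" (is ?th2)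
proof -
  have Y: "tilings a b (Suc (Suc n)) (Suc n * s) = a * board_count (n + 1) + b * (U * board_count n + b * V * cut_count n)"
    using tilings_Suc_S[of "Suc n * s" "Suc n"] tilings_missing_S[of n] by (simp add: board_count_def[of "Suc n"])
  have pos: "Suc n * s > 0" using s_pos by simp
  then have "tilings_pred a b (Suc (Suc n)) (Suc n * s) = tilings a b (Suc (Suc n)) (Suc n * s - 1)"
    using s_pos by (simp add: tilings_pred_def)
  also have "\<dots> = a * tilings a b (Suc n) (Suc n * s - 1) + b * tilings a b n (Suc n * s - 1)"
    using tilings_Suc_S[of "Suc n * s - 1" "Suc n"] by simp
  also have "\<dots> = a * cut_count (n + 1) + b * (V * board_count n + b * W * cut_count n)"
    using tilings_pred_missing_S[of n] s_pos by (simp add: tilings_pred_def cut_count_def[of "Suc n"])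
  finally have H: "tilings_pred a b (Suc (Suc n)) (Suc n * s) = a * cut_count (n + 1) + b * (V * board_count n + b * W * cut_count n)" .
  show ?th1
    using counts_Suc(1)[of "Suc n"] unfolding Y H by (simp add: algebra_simps power2_eq_square)
  have "cut_count (n + 2) = (a * V + b * W) * board_count (n + 1) + a * b * W * cut_count (n + 1)
      + b * V * (U + b * W) * board_count n + (b^2 * V^2 + b^3 * W^2) * cut_count n"
    using counts_Suc(2)[of "Suc n"] unfolding Y H
    by (simp add: algebra_simps power2_eq_square power3_eq_cube)
  then show ?th2 by (simp add: U_rec)
qed

end

section \<open>The recurrence\<close>

text \<open>
  Elimination of \<open>y\<close>: the coefficients are those of the determinant of
  \<open>I - z M - z\<^sup>2 N\<close>, where \<open>M\<close> and \<open>N\<close> are the coefficient matrices of the system.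
\<close>

lemma second_order_system_elimination:
  fixes x y :: "nat \<Rightarrow> int"
  assumes x: "\<And>n. x (n + 2) = m11 * x (n + 1) + m12 * y (n + 1) + n11 * x n + n12 * y n"
    and y: "\<And>n. y (n + 2) = m21 * x (n + 1) + m22 * y (n + 1) + n21 * x n + n22 * y n"
  shows "x (n + 4) = (m11 + m22) * x (n + 3)
      + (n11 + n22 - m11 * m22 + m12 * m21) * x (n + 2)
      + (m12 * n21 + n12 * m21 - m11 * n22 - n11 * m22) * x (n + 1)
      - (n11 * n22 - n12 * n21) * x n"
proof -
  have x0: "x (n + 2) = m11 * x (n + 1) + m12 * y (n + 1) + n11 * x n + n12 * y n"
    and x1: "x (n + 3) = m11 * x (n + 2) + m12 * y (n + 2) + n11 * x (n + 1) + n12 * y (n + 1)"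
    and x2: "x (n + 4) = m11 * x (n + 3) + m12 * y (n + 3) + n11 * x (n + 2) + n12 * y (n + 2)"
    and y0: "y (n + 2) = m21 * x (n + 1) + m22 * y (n + 1) + n21 * x n + n22 * y n"
    and y1: "y (n + 3) = m21 * x (n + 2) + m22 * y (n + 2) + n21 * x (n + 1) + n22 * y (n + 1)"
    using x[of n] x[of "n + 1"] x[of "n + 2"] y[of n] y[of "n + 1"]
    by (simp_all add: eval_nat_numeral)
  define R where "R = x (n + 4) - ((m11 + m22) * x (n + 3)
      + (n11 + n22 - m11 * m22 + m12 * m21) * x (n + 2)
      + (m12 * n21 + n12 * m21 - m11 * n22 - n11 * m22) * x (n + 1)
      - (n11 * n22 - n12 * n21) * x n)"
  \<comment> \<open>The multipliers are the coefficients in the first row of the adjugate of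
    \<open>I - z M - z^2 N\<close>, with \<open>z\<close> as the backward shift.\<close>
  have "R = (x (n + 4) - (m11 * x (n + 3) + m12 * y (n + 3) + n11 * x (n + 2) + n12 * y (n + 2)))
     - m22 * (x (n + 3) - (m11 * x (n + 2) + m12 * y (n + 2) + n11 * x (n + 1) + n12 * y (n + 1)))
     - n22 * (x (n + 2) - (m11 * x (n + 1) + m12 * y (n + 1) + n11 * x n + n12 * y n))
     + m12 * (y (n + 3) - (m21 * x (n + 2) + m22 * y (n + 2) + n21 * x (n + 1) + n22 * y (n + 1)))
     + n12 * (y (n + 2) - (m21 * x (n + 1) + m22 * y (n + 1) + n21 * x n + n22 * y n))"
    unfolding R_def by (simp add: algebra_simps)
  also have "\<dots> = 0"
    using x0 x1 x2 y0 y1 by simp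
  finally show ?thesis by (simp add: R_def)
qed

context path_numbers
begin

lemma u_numerals: "u 1 = a" "u 2 = a^2 + b" "u 3 = a^3 + 2 * a * b"
  using u_rec[of 1] u_rec[of 2] u_rec[of 3] by (simp_all add: u_zero u_minus_one algebra_simps power2_eq_square power3_eq_cube)

text \<open>The Cassini identity: one step of the recurrence multiplies the determinant by
  \<open>- b\<close>.\<close>

lemma casoratian:
  "(u (int s))^2 - u (int s + 1) * u (int s - 1) = (- b) ^ s"
proof (induction s)
  case 0
  then show ?case by (simp add: u_zero u_minus_one)
next
  case (Suc s)
  have "u (int (Suc s) + 1) = a * u (int s + 1) + b * u (int s)"
    and "u (int s + 1) = a * u (int s) + b * u (int s - 1)"
    using u_rec[of "int s + 2"] u_rec[of "int s + 1"] by (simp_all add: add.commute)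
  then have "(u (int (Suc s)))^2 - u (int (Suc s) + 1) * u (int (Suc s) - 1)
      = - b * ((u (int s))^2 - u (int s + 1) * u (int s - 1))"
    by (simp add: algebra_simps power2_eq_square)
  then show ?case by (simp add: Suc.IH)
qed

text \<open>The right-hand side is the trace of the first coefficient matrix of
  \<open>counts_rec\<close> for \<open>s = t + 1\<close>. Being a combination of shifts of
  \<open>u\<close>, it inherits the recurrence of \<open>u\<close>.\<close>

lemma alpha_closed_form:
  fixes \<alpha> :: "nat \<Rightarrow> int"
  assumes "\<alpha> 4 = a^2 + b" "\<alpha> 5 = a * (a^2 + 3 * b)"
    and "\<And>p. p \<ge> 4 \<Longrightarrow> \<alpha> (p + 2) = a * \<alpha> (p + 1) + b * \<alpha> p"
  shows "\<alpha> (t + 4) = a * u (int t + 1) + b * u (int t) + a * b * u (int t - 1)"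
proof (induction t rule: less_induct)
  case (less t)
  consider "t = 0" | "t = 1" | k where "t = Suc (Suc k)"
    by (metis One_nat_def old.nat.exhaust)
  then show ?case
  proof cases
    case 3
    have "\<alpha> (t + 4) = a * \<alpha> (Suc k + 4) + b * \<alpha> (k + 4)"
      using assms(3)[of "k + 4"] 3 by (simp add: eval_nat_numeral)
    then show ?thesis
      using less.IH[of k] less.IH[of "Suc k"] 3 u_rec[of "int k + 3"] u_rec[of "int k + 2"] u_rec[of "int k + 1"]
      by (simp add: algebra_simps)
  qed (simp_all add: assms u_numerals u_zero u_minus_one algebra_simps power2_eq_square power3_eq_cube)
qed

text \<open>Products of two shifts of \<open>u\<close> obey the recurrence whose characteristic
  roots are the pairwise products of those of \<open>u\<close>. The latter have sum \<open>a\<close>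
  and product \<open>- b\<close>, so the polynomial is
  \<open>(x + b) * (x^2 - (a^2 + 2 * b) * x + b^2)\<close>.\<close>

lemma beta_closed_form:
  fixes \<beta> :: "nat \<Rightarrow> int"
  assumes "\<beta> 4 = 2 * b * (a^2 + b)" "\<beta> 5 = b * (a^2 + b) * (a^2 + 2 * b)"
      "\<beta> 6 = b * (a^6 + 6 * a^4 * b + 10 * a^2 * b^2 + 2 * b^3)"
    and "\<And>p. p \<ge> 4 \<Longrightarrow>
         \<beta> (p + 3) = (a^2 + b) * \<beta> (p + 2) + b * (a^2 + b) * \<beta> (p + 1) - b^3 * \<beta> p"
  shows "\<beta> (t + 4) = b * (u (int t + 1))^2 + 2 * b^2 * (u (int t))^2 + b^3 * (u (int t - 1))^2
      + a^2 * b * ((u (int t))^2 - u (int t + 1) * u (int t - 1))"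
proof (induction t rule: less_induct)
  case (less t)
  consider "t = 0" | "t = 1" | "t = 2" | k where "t = Suc (Suc (Suc k))"
    by (metis One_nat_def Suc_1 old.nat.exhaust)
  then show ?case
  proof cases
    case 4
    define x y where "x = u (int k)" and "y = u (int k - 1)"
    have u: "u (int k + 1) = a * x + b * y" "u (int k + 2) = a * (a * x + b * y) + b * x"
      "u (int k + 3) = a * (a * (a * x + b * y) + b * x) + b * (a * x + b * y)"
      "u (int k + 4) = a * (a * (a * (a * x + b * y) + b * x) + b * (a * x + b * y))
         + b * (a * (a * x + b * y) + b * x)"
      using u_rec[of "int k + 4"] u_rec[of "int k + 3"] u_rec[of "int k + 2"] u_rec[of "int k + 1"]
      by (simp_all add: x_def y_def add.commute)
    have "\<beta> (t + 4) = (a^2 + b) * \<beta> (Suc (Suc k) + 4) + b * (a^2 + b) * \<beta> (Suc k + 4) - b^3 * \<beta> (k + 4)"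
      using assms(4)[of "k + 4"] 4 by (simp add: eval_nat_numeral)
    moreover have "\<beta> (Suc (Suc k) + 4) = b * (u (int k + 3))^2 + 2 * b^2 * (u (int k + 2))^2
      + b^3 * (u (int k + 1))^2 + a^2 * b * ((u (int k + 2))^2 - u (int k + 3) * u (int k + 1))"
      using less.IH[of "Suc (Suc k)"] 4 by (simp add: add.commute)
    moreover have "\<beta> (Suc k + 4) = b * (u (int k + 2))^2 + 2 * b^2 * (u (int k + 1))^2
      + b^3 * x^2 + a^2 * b * ((u (int k + 1))^2 - u (int k + 2) * x)"
      using less.IH[of "Suc k"] 4 by (simp add: add.commute x_def)
    moreover have "\<beta> (k + 4) = b * (u (int k + 1))^2 + 2 * b^2 * x^2
      + b^3 * y^2 + a^2 * b * (x^2 - u (int k + 1) * y)"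
      using less.IH[of k] 4 by (simp add: add.commute x_def y_def)
    moreover have "int t + 1 = int k + 4" "int t = int k + 3" "int t - 1 = int k + 2"
      using 4 by simp_all
    ultimately show ?thesis
      by (simp only: u) (simp add: algebra_simps power2_eq_square power3_eq_cube)
  qed (simp_all add: assms u_numerals u_zero u_minus_one, simp_all add: algebra_simps eval_nat_numeral)
qed

text \<open>The factor \<open>(- b) ^ t\<close> scales the coefficients \<open>a\<close> and
  \<open>b\<close> of the recurrence of \<open>u\<close> to \<open>- a * b\<close> and
  \<open>b^3\<close>.\<close>

lemma gamma_closed_form:
  fixes \<gamma> :: "nat \<Rightarrow> int"
  assumes "\<gamma> 4 = b^2 * (a^2 - b)" "\<gamma> 5 = - a * b^3 * (a^2 + b)"
    and "\<And>p. p \<ge> 4 \<Longrightarrow> \<gamma> (p + 2) = - a * b * \<gamma> (p + 1) + b^3 * \<gamma> p"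
  shows "\<gamma> (t + 4) = (- b) ^ t * (2 * a * b^2 * u (int t + 1) - b^2 * (a^2 + b) * u (int t))"
proof (induction t rule: less_induct)
  case (less t)
  consider "t = 0" | "t = 1" | k where "t = Suc (Suc k)"
    by (metis One_nat_def old.nat.exhaust)
  then show ?case
  proof cases
    case 3
    define x y z where "x = u (int k)" and "y = u (int k + 1)" and "z = (- b) ^ k"
    have u: "u (int k + 2) = a * y + b * x" "u (int k + 3) = a * (a * y + b * x) + b * y"
      using u_rec[of "int k + 3"] u_rec[of "int k + 2"]
      by (simp_all add: x_def y_def add.commute)
    have "\<gamma> (t + 4) = - a * b * \<gamma> (Suc k + 4) + b^3 * \<gamma> (k + 4)"
      using assms(3)[of "k + 4"] 3 by (simp add: eval_nat_numeral)
    moreover have "\<gamma> (Suc k + 4) = - b * z * (2 * a * b^2 * u (int k + 2) - b^2 * (a^2 + b) * y)"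
      using less.IH[of "Suc k"] 3 by (simp add: add.commute y_def z_def)
    moreover have "\<gamma> (k + 4) = z * (2 * a * b^2 * y - b^2 * (a^2 + b) * x)"
      using less.IH[of k] 3 by (simp add: add.commute y_def x_def z_def)
    moreover have "int t + 1 = int k + 3" "int t = int k + 2" "(- b) ^ t = b^2 * z"
      using 3 by (simp_all add: z_def power2_eq_square)
    ultimately show ?thesis
      by (simp only: u) (simp add: algebra_simps power2_eq_square power3_eq_cube)
  qed (simp_all add: assms u_numerals u_zero u_minus_one algebra_simps power2_eq_square power3_eq_cube)
qed

end

context weighted_ladder
begin

lemma board_count_values:
  "board_count 2 = (u (int s + 1))^2 + a * b * V * U + b * U^2 + b^2 * V^2"
  "board_count 3 = ((u (int s + 1))^2 + 2 * a * b * V * U + 2 * b * U^2 + 2 * b^2 * V^2) * u (int s + 1)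
     + b^2 * (U * V + (a^2 + b) * V * W + a * V^2) * U + a * b^3 * V^2 * W"
proof -
  have u: "u (int s + 1) = a * U + b * V"
    using u_rec[of "int s + 1"] by simp
  show 2: "board_count 2 = (u (int s + 1))^2 + a * b * V * U + b * U^2 + b^2 * V^2"
    using counts_rec(1)[of 0] counts_0 counts_1 unfolding u
    by (simp add: eval_nat_numeral algebra_simps)
  have P2: "cut_count 2 = U * (a * U + b * V) + a * b * W * U + b * V * (U + b * W)"
    using counts_rec(2)[of 0] counts_0 counts_1 unfolding u by (simp add: eval_nat_numeral)
  have "board_count 3 = (a * U + b * V) * board_count 2 + a * b * V * cut_count 2
      + (b * U^2 + b^2 * V^2) * board_count 1 + b^2 * V * (U + b * W) * cut_count 1"
    using counts_rec(1)[of 1] by (simp add: eval_nat_numeral)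
  then show "board_count 3 = ((u (int s + 1))^2 + 2 * a * b * V * U + 2 * b * U^2 + 2 * b^2 * V^2) * u (int s + 1)
     + b^2 * (U * V + (a^2 + b) * V * W + a * V^2) * U + a * b^3 * V^2 * W"
    unfolding 2 P2 counts_1 u U_rec by algebra
qed

lemma board_count_rec:
  fixes \<alpha> \<beta> \<gamma> :: "nat \<Rightarrow> int"
  assumes \<alpha>: "\<alpha> 4 = a^2 + b" "\<alpha> 5 = a * (a^2 + 3 * b)"
      "\<And>p. p \<ge> 4 \<Longrightarrow> \<alpha> (p + 2) = a * \<alpha> (p + 1) + b * \<alpha> p"
    and \<beta>: "\<beta> 4 = 2 * b * (a^2 + b)" "\<beta> 5 = b * (a^2 + b) * (a^2 + 2 * b)"
      "\<beta> 6 = b * (a^6 + 6 * a^4 * b + 10 * a^2 * b^2 + 2 * b^3)"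
      "\<And>p. p \<ge> 4 \<Longrightarrow>
         \<beta> (p + 3) = (a^2 + b) * \<beta> (p + 2) + b * (a^2 + b) * \<beta> (p + 1) - b^3 * \<beta> p"
    and \<gamma>: "\<gamma> 4 = b^2 * (a^2 - b)" "\<gamma> 5 = - a * b^3 * (a^2 + b)"
      "\<And>p. p \<ge> 4 \<Longrightarrow> \<gamma> (p + 2) = - a * b * \<gamma> (p + 1) + b^3 * \<gamma> p"
    and n: "n \<ge> 4"
  shows "board_count n = \<alpha> (s + 3) * board_count (n - 1) + \<beta> (s + 3) * board_count (n - 2) + \<gamma> (s + 3) * board_count (n - 3)
     - b ^ (2 * s + 2) * board_count (n - 4)"
proof -
  obtain t where t: "s = Suc t" using s_pos by (cases s) auto
  obtain k where k: "n = k + 4" using n by (metis add.commute le_Suc_ex)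
  have cas: "V^2 - U * W = (- b) ^ t"
    using casoratian[of t] t by (simp add: add.commute)
  have \<alpha>': "\<alpha> (s + 3) = a * U + b * V + a * b * W"
    using alpha_closed_form[OF \<alpha>, of t] t by (simp add: add.commute)
  have \<beta>': "\<beta> (s + 3) = (b * U^2 + b^2 * V^2) + (b^2 * V^2 + b^3 * W^2)
      - (a * U + b * V) * (a * b * W) + (a * b * V) * U"
    using beta_closed_form[OF \<beta>, of t] t U_rec
    by (simp add: add.commute algebra_simps power2_eq_square power3_eq_cube)
  have \<gamma>': "\<gamma> (s + 3) = (a * b * V) * (b * V * (U + b * W)) + (b^2 * V * (U + b * W)) * U
     - (a * U + b * V) * (b^2 * V^2 + b^3 * W^2) - (b * U^2 + b^2 * V^2) * (a * b * W)"
  proof -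
    \<comment> \<open>The power of \<open>- b\<close> is turned back into the Cassini determinant;
      what remains is a polynomial identity modulo \<open>U = a * V + b * W\<close>.\<close>
    have "\<gamma> (s + 3) = (V^2 - U * W) * (2 * a * b^2 * U - b^2 * (a^2 + b) * V)"
      using gamma_closed_form[OF \<gamma>, of t] t cas by (simp add: add.commute)
    then show ?thesis unfolding U_rec by algebra
  qed
  have "((- b) ^ t)^2 = (b^2) ^ t"
    by (metis power2_minus power_mult mult.commute)
  then have "b ^ (2 * s + 2) = b^4 * ((- b) ^ t)^2"
    by (simp add: t power_mult power4_eq_xxxx)
  \<comment> \<open>The determinant of the second coefficient matrix of \<open>counts_rec\<close> is
    \<open>b^4\<close> times the square of the Cassini determinant.\<close>
  also have "\<dots> = (b * U^2 + b^2 * V^2) * (b^2 * V^2 + b^3 * W^2)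
     - (b^2 * V * (U + b * W)) * (b * V * (U + b * W))"
    unfolding cas[symmetric] by algebra
  finally have \<delta>': "b ^ (2 * s + 2) = \<dots>" .
  show ?thesis
    unfolding \<alpha>' \<beta>' \<gamma>' \<delta>' k
    using second_order_system_elimination[OF counts_rec, of k] by (simp add: add.commute)
qed

end

section \<open>Perpendicular bisectors as affine functionals\<close>

text \<open>
  A pair \<open>F = (x, s)\<close> stands for the affine functional \<open>p \<mapsto> x \<bullet> p - s\<close>. The functionals of
  \<open>affine_lift G v\<close> and \<open>affine_lift G w\<close> agree exactly on the perpendicular bisector of \<open>v\<close>
  and \<open>w\<close>; in the hyperbolic case \<open>affine_lift G v\<close> is the point of the hyperboloid over \<open>v\<close>.
\<close>

fun affine_lift :: "geometry \<Rightarrow> complex \<Rightarrow> complex \<times> real" where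
  "affine_lift Euclidean v = (v, (norm v)\<^sup>2 / 2)"
| "affine_lift Hyperbolic v = (v /\<^sub>R sqrt (1 - (norm v)\<^sup>2), 1 / sqrt (1 - (norm v)\<^sup>2))"

definition affine_eval :: "complex \<times> real \<Rightarrow> complex \<Rightarrow> real" where
  "affine_eval F p = fst F \<bullet> p - snd F"

text \<open>The inner product of the normals, respectively the Minkowski form; it vanishes for
  perpendicular walls.\<close>

fun wall_form :: "geometry \<Rightarrow> complex \<times> real \<Rightarrow> complex \<times> real \<Rightarrow> real" where
  "wall_form Euclidean F H = fst F \<bullet> fst H"
| "wall_form Hyperbolic F H = fst F \<bullet> fst H - snd F * snd H"

definition bisector :: "geometry \<Rightarrow> complex \<Rightarrow> complex \<Rightarrow> complex \<times> real" where
  "bisector G v w = affine_lift G v - affine_lift G w"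

lemma bisector_swap: "bisector G w v = - bisector G v w"
  by (simp add: bisector_def)

lemma affine_eval_uminus: "affine_eval (- F) p = - affine_eval F p"
  by (simp add: affine_eval_def)

lemma affine_eval_convex:
  "affine_eval F ((1 - t) *\<^sub>R x + t *\<^sub>R y) = (1 - t) * affine_eval F x + t * affine_eval F y"
  by (simp add: affine_eval_def inner_add_right algebra_simps)

lemma affine_eval_between:
  assumes "convex S" "x \<in> S" "y \<in> S" "affine_eval F x > 0" "affine_eval F y < 0"
  obtains t where "0 < t" "t < 1" "(1 - t) *\<^sub>R x + t *\<^sub>R y \<in> S"
    "affine_eval F ((1 - t) *\<^sub>R x + t *\<^sub>R y) = 0"
proof -
  define t where "t = affine_eval F x / (affine_eval F x - affine_eval F y)"
  have "0 < t" "t < 1" using assms by (simp_all add: t_def)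
  moreover have "(1 - t) *\<^sub>R x + t *\<^sub>R y \<in> S"
    using assms calculation by (intro convexD) auto
  moreover have "affine_eval F ((1 - t) *\<^sub>R x + t *\<^sub>R y) = 0"
    unfolding affine_eval_convex using assms by (simp add: t_def field_simps)
  ultimately show ?thesis using that by blast
qed

text \<open>On the segments from \<open>x1\<close> to \<open>x2\<close> and from \<open>x4\<close>
  to \<open>x3\<close> there are zeros of \<open>F\<close>, at which \<open>H\<close> has opposite
  signs. On the segment between these zeros \<open>F\<close> vanishes identically and
  \<open>H\<close> changes sign.\<close>

lemma common_zero_if_all_quadrants:
  assumes S: "convex S" "x1 \<in> S" "x2 \<in> S" "x3 \<in> S" "x4 \<in> S"
    and 1: "affine_eval F x1 > 0" "affine_eval H x1 > 0"
    and 2: "affine_eval F x2 < 0" "affine_eval H x2 > 0"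
    and 3: "affine_eval F x3 < 0" "affine_eval H x3 < 0"
    and 4: "affine_eval F x4 > 0" "affine_eval H x4 < 0"
  shows "\<exists>p\<in>S. affine_eval F p = 0 \<and> affine_eval H p = 0"
proof -
  obtain t where t: "0 < t" "t < 1" "(1 - t) *\<^sub>R x1 + t *\<^sub>R x2 \<in> S"
    "affine_eval F ((1 - t) *\<^sub>R x1 + t *\<^sub>R x2) = 0"
    using affine_eval_between[OF S(1,2,3) 1(1) 2(1)] .
  obtain r where r: "0 < r" "r < 1" "(1 - r) *\<^sub>R x4 + r *\<^sub>R x3 \<in> S"
    "affine_eval F ((1 - r) *\<^sub>R x4 + r *\<^sub>R x3) = 0"
    using affine_eval_between[OF S(1,5,4) 4(1) 3(1)] .
  have pos: "affine_eval H ((1 - t) *\<^sub>R x1 + t *\<^sub>R x2) > 0"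
    unfolding affine_eval_convex using t 1 2 by (simp add: add_pos_pos)
  have neg: "affine_eval H ((1 - r) *\<^sub>R x4 + r *\<^sub>R x3) < 0"
    unfolding affine_eval_convex using r 3 4 by (simp add: add_neg_neg mult_pos_neg)
  obtain z where z: "(1 - z) *\<^sub>R ((1 - t) *\<^sub>R x1 + t *\<^sub>R x2) + z *\<^sub>R ((1 - r) *\<^sub>R x4 + r *\<^sub>R x3) \<in> S"
    "affine_eval H ((1 - z) *\<^sub>R ((1 - t) *\<^sub>R x1 + t *\<^sub>R x2) + z *\<^sub>R ((1 - r) *\<^sub>R x4 + r *\<^sub>R x3)) = 0"
    using affine_eval_between[OF S(1) t(3) r(3) pos neg] .
  show ?thesis
    using z t r by (auto intro!: bexI[OF _ z(1)] simp: affine_eval_convex[of F "z"])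
qed

definition cross :: "complex \<Rightarrow> complex \<Rightarrow> real" where
  "cross x y = Re x * Im y - Im x * Re y"

lemma lagrange_cross: "(c \<bullet> x) * (c' \<bullet> y) - (c \<bullet> y) * (c' \<bullet> x) = cross c c' * cross x y"
  by (simp add: inner_complex_def cross_def algebra_simps)

text \<open>Functionals with a common zero and parallel normals are proportional, so they change
  sign together.\<close>

lemma parallel_walls_contradiction:
  assumes "cross (fst F) (fst H) = 0" "affine_eval F p = 0" "affine_eval H p = 0"
    and "affine_eval F x > 0" "affine_eval F y < 0" "affine_eval H x > 0" "affine_eval H y > 0"
  shows False
proof -
  have *: "affine_eval F z = fst F \<bullet> (z - p)" "affine_eval H z = fst H \<bullet> (z - p)" for z
    using assms(2,3) by (simp_all add: affine_eval_def inner_diff_right)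
  have "affine_eval F x * affine_eval H y - affine_eval F y * affine_eval H x = 0"
    unfolding * lagrange_cross using assms(1) by simp
  moreover have "affine_eval F x * affine_eval H y > 0" "affine_eval F y * affine_eval H x < 0"
    using assms by (simp_all add: mult_neg_pos)
  ultimately show False by simp
qed

lemma two_common_zeros_parallel:
  assumes "affine_eval F p = 0" "affine_eval H p = 0" "affine_eval F p' = 0" "affine_eval H p' = 0" "p \<noteq> p'"
  shows "cross (fst F) (fst H) = 0"
proof -
  define d where "d = p' - p"
  have d: "fst F \<bullet> d = 0" "fst H \<bullet> d = 0" "d \<noteq> 0"
    using assms by (simp_all add: affine_eval_def d_def inner_diff_right)
  have "cross (fst F) (fst H) * Re d = 0" "cross (fst F) (fst H) * Im d = 0"
    using d(1,2) unfolding cross_def inner_complex_def by algebra+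
  then show ?thesis using d(3) by (auto simp: complex_eq_iff)
qed

lemma norm_less_1_if_plane: "v \<in> plane Hyperbolic \<Longrightarrow> (norm v)\<^sup>2 < 1"
  by (simp add: abs_square_less_1)

text \<open>Through a point there is only one perpendicular to a given line.\<close>

lemma common_perpendicular_parallel:
  assumes "p \<in> plane G" "wall_form G R R > 0" "wall_form G R F = 0" "wall_form G R H = 0"
    and "affine_eval F p = 0" "affine_eval H p = 0"
  shows "cross (fst F) (fst H) = 0"
proof -
  \<comment> \<open>In the Klein model all lines perpendicular to \<open>R\<close> pass through the
    pole of \<open>R\<close>, and \<open>d\<close> is the direction from \<open>p\<close> to that
    pole. In the Euclidean plane \<open>d\<close> is the normal of \<open>R\<close>.\<close>
  define d where "d = fst R - (if G = Hyperbolic then snd R *\<^sub>R p else 0)"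
  have d: "fst F \<bullet> d = 0" "fst H \<bullet> d = 0"
    using assms(3-6) by (cases G; simp add: d_def affine_eval_def inner_diff_right inner_commute)+
  have "d \<noteq> 0"
  proof (cases G)
    case Euclidean
    then show ?thesis using assms(2) by (auto simp: d_def)
  next
    case Hyperbolic
    show ?thesis
    proof
      \<comment> \<open>Then \<open>p\<close> would be the pole itself, whereas the pole of a line
        lies outside the disc.\<close>
      assume "d = 0"
      then have "fst R = snd R *\<^sub>R p" using Hyperbolic by (simp add: d_def)
      then have "(snd R)\<^sup>2 * ((norm p)\<^sup>2 - 1) > 0"
        using assms(2) Hyperbolic by (simp add: dot_square_norm algebra_simps power2_eq_square)
      moreover have "(norm p)\<^sup>2 - 1 < 0"
        using norm_less_1_if_plane assms(1) Hyperbolic by simp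
      ultimately show False
        by (simp add: zero_less_mult_iff)
    qed
  qed
  moreover have "cross (fst F) (fst H) * Re d = 0" "cross (fst F) (fst H) * Im d = 0"
    using d unfolding cross_def inner_complex_def by algebra+
  ultimately show ?thesis by (auto simp: complex_eq_iff)
qed

section \<open>The hyperbolic distance as a Minkowski product\<close>

definition cosh_dist :: "complex \<Rightarrow> complex \<Rightarrow> real" where
  "cosh_dist v w = (1 - v \<bullet> w) / (sqrt (1 - (norm v)\<^sup>2) * sqrt (1 - (norm w)\<^sup>2))"

lemma gdist_Hyperbolic: "gdist Hyperbolic v w = arcosh (cosh_dist v w)"
  by (simp add: cosh_dist_def real_sqrt_mult)

lemma cosh_dist_commute: "cosh_dist v w = cosh_dist w v"
  by (simp add: cosh_dist_def inner_commute mult.commute)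

lemma cosh_dist_refl: "v \<in> plane Hyperbolic \<Longrightarrow> cosh_dist v v = 1"
  using norm_less_1_if_plane[of v] by (simp add: cosh_dist_def power2_norm_eq_inner)

text \<open>The reversed Cauchy-Schwarz inequality. Its defect is
  \<open>(norm (v - w))^2 - (cross v w)^2\<close>, and \<open>cross v w\<close> is up to sign the
  cross product of \<open>v\<close> with \<open>v - w\<close>, where
  \<open>norm v < 1\<close>.\<close>

lemma cosh_dist_gt_1:
  assumes "v \<in> plane Hyperbolic" "w \<in> plane Hyperbolic" "v \<noteq> w"
  shows "cosh_dist v w > 1"
proof -
  have v: "(norm v)\<^sup>2 < 1" and w: "(norm w)\<^sup>2 < 1"
    using assms norm_less_1_if_plane by blast+
  have "norm v < 1" "norm w < 1" using assms by simp_all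
  then have "norm v * norm w < 1 * 1" by (intro mult_strict_mono') auto
  then have pos: "1 - v \<bullet> w > 0" using norm_cauchy_schwarz[of v w] by linarith
  have cross: "(cross v w)\<^sup>2 \<le> (norm v)\<^sup>2 * (norm (v - w))\<^sup>2"
  proof -
    have "(norm v)\<^sup>2 * (norm (v - w))\<^sup>2 - (cross v w)\<^sup>2 = (v \<bullet> (v - w))\<^sup>2"
      by (simp add: cross_def inner_complex_def cmod_power2) algebra
    then show ?thesis by (smt (verit) zero_le_power2)
  qed
  also have "\<dots> < 1 * (norm (v - w))\<^sup>2"
    using v assms(3) by (intro mult_strict_right_mono) auto
  finally have "(cross v w)\<^sup>2 < (norm (v - w))\<^sup>2" by simp
  moreover have "(1 - v \<bullet> w)\<^sup>2 - (1 - (norm v)\<^sup>2) * (1 - (norm w)\<^sup>2) = (norm (v - w))\<^sup>2 - (cross v w)\<^sup>2"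
    by (simp add: cross_def inner_complex_def cmod_power2) algebra
  ultimately have "(1 - (norm v)\<^sup>2) * (1 - (norm w)\<^sup>2) < (1 - v \<bullet> w)\<^sup>2" by simp
  then have "sqrt ((1 - (norm v)\<^sup>2) * (1 - (norm w)\<^sup>2)) < 1 - v \<bullet> w"
    using pos by (intro real_less_lsqrt) auto
  then show ?thesis
    using v w by (simp add: cosh_dist_def real_sqrt_mult)
qed

lemma cosh_dist_ge_1:
  assumes "v \<in> plane Hyperbolic" "w \<in> plane Hyperbolic"
  shows "cosh_dist v w \<ge> 1"
  using cosh_dist_gt_1[OF assms] cosh_dist_refl[OF assms(1)] by (cases "v = w") auto

lemma wall_form_lift:
  "wall_form Hyperbolic (affine_lift Hyperbolic v) (affine_lift Hyperbolic w) = - cosh_dist v w"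
  by (simp add: cosh_dist_def divide_simps)

lemma affine_eval_lift:
  assumes "v \<in> plane Hyperbolic"
  shows "affine_eval (affine_lift Hyperbolic w) v = - sqrt (1 - (norm v)\<^sup>2) * cosh_dist v w"
proof -
  define n m where "n = sqrt (1 - (norm v)\<^sup>2)" and "m = sqrt (1 - (norm w)\<^sup>2)"
  have "n \<noteq> 0"
    using norm_less_1_if_plane[OF assms] by (simp add: n_def)
  moreover have "affine_eval (affine_lift Hyperbolic w) v = (v \<bullet> w - 1) / m"
    by (simp add: affine_eval_def m_def[symmetric] inner_commute divide_inverse algebra_simps)
  ultimately show ?thesis
    unfolding cosh_dist_def n_def[symmetric] m_def[symmetric]
    by (simp add: minus_divide_left)
qed

text \<open>On the hyperboloid, evaluation at \<open>v\<close> is up to a positive factor the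
  Minkowski product with the lift of \<open>v\<close>, and among all lifts this product is largest
  at the lift of \<open>v\<close> itself.\<close>

lemma bisector_pos:
  assumes "v \<in> plane G" "w \<in> plane G" "v \<noteq> w"
  shows "affine_eval (bisector G v w) v > 0"
proof (cases G)
  case Euclidean
  have "affine_eval (bisector G v w) v = (norm (v - w))\<^sup>2 / 2"
    using Euclidean
    by (simp add: bisector_def affine_eval_def power2_norm_eq_inner inner_diff_left inner_diff_right inner_commute)
  moreover have "(norm (v - w))\<^sup>2 > 0" using assms by simp
  ultimately show ?thesis by linarith
next
  case Hyperbolic
  then have "affine_eval (bisector G v w) v
      = affine_eval (affine_lift Hyperbolic v) v - affine_eval (affine_lift Hyperbolic w) v"
    by (simp add: bisector_def affine_eval_def inner_diff_left)
  also have "\<dots> = sqrt (1 - (norm v)\<^sup>2) * (cosh_dist v w - 1)"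
    using assms Hyperbolic by (simp add: affine_eval_lift cosh_dist_refl algebra_simps del: affine_lift.simps)
  also have "\<dots> > 0"
    using assms Hyperbolic norm_less_1_if_plane[of v] cosh_dist_gt_1[of v w] by simp
  finally show ?thesis .
qed

lemma bisector_neg:
  assumes "v \<in> plane G" "w \<in> plane G" "v \<noteq> w"
  shows "affine_eval (bisector G v w) w < 0"
  using bisector_pos[of w G v] assms bisector_swap[of G v w] by (simp add: affine_eval_uminus)

lemma wall_form_expand:
  "wall_form G (a - b) (c - d) = wall_form G a c - wall_form G a d - wall_form G b c + wall_form G b d"
  by (cases G) (simp_all add: inner_diff_left inner_diff_right algebra_simps)

lemma wall_form_sym: "wall_form G a b = wall_form G b a"
  by (cases G) (simp_all add: inner_commute)

lemma wall_form_bisector_pos: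
  assumes "v \<in> plane G" "w \<in> plane G" "v \<noteq> w"
  shows "wall_form G (bisector G v w) (bisector G v w) > 0"
proof (cases G)
  case Euclidean
  then show ?thesis using assms by (simp add: bisector_def)
next
  case Hyperbolic
  then have "wall_form G (bisector G v w) (bisector G v w) = 2 * cosh_dist v w - 2"
    using assms unfolding bisector_def wall_form_expand
    by (simp add: wall_form_lift cosh_dist_refl cosh_dist_commute[of w v] del: wall_form.simps affine_lift.simps)
  then show ?thesis using cosh_dist_gt_1[of v w] assms Hyperbolic by simp
qed

lemma affine_lift_inj:
  assumes "v \<in> plane G" "w \<in> plane G" "affine_lift G v = affine_lift G w"
  shows "v = w"
proof (rule ccontr)
  assume "v \<noteq> w"
  from bisector_pos[OF assms(1,2) this] show False
    using assms(3) by (simp add: bisector_def affine_eval_def)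
qed

section \<open>Regular squares\<close>

text \<open>Orthogonal non-isotropic vectors form a basis, because their Gram determinant is
  \<open>- \<Delta>^2\<close>.\<close>

lemma lorentz_orthogonal_zero:
  fixes u v m w :: "real \<times> real \<times> real" and B
  defines "B \<equiv> \<lambda>x y. fst x * fst y + fst (snd x) * fst (snd y) - snd (snd x) * snd (snd y)"
  assumes "B u v = 0" "B u m = 0" "B v m = 0" "B u u \<noteq> 0" "B v v \<noteq> 0" "B m m \<noteq> 0"
    and "B w u = 0" "B w v = 0" "B w m = 0"
  shows "w = 0"
proof -
  obtain u1 u2 u3 v1 v2 v3 m1 m2 m3 w1 w2 w3 where
    eq: "u = (u1, u2, u3)" "v = (v1, v2, v3)" "m = (m1, m2, m3)" "w = (w1, w2, w3)"
    by (metis surj_pair)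
  define \<Delta> where "\<Delta> = u1 * (v2 * m3 - v3 * m2) - u2 * (v1 * m3 - v3 * m1) + u3 * (v1 * m2 - v2 * m1)"
  have "\<Delta>\<^sup>2 = - (B u u * B v v * B m m + 2 * B u v * B v m * B u m
     - B u u * (B v m)\<^sup>2 - B v v * (B u m)\<^sup>2 - B m m * (B u v)\<^sup>2)"
    unfolding eq B_def \<Delta>_def by (simp add: power2_eq_square algebra_simps)
  then have \<Delta>: "\<Delta> \<noteq> 0" using assms by auto
  have lin: "w1 * u1 + w2 * u2 - w3 * u3 = 0" "w1 * v1 + w2 * v2 - w3 * v3 = 0"
    "w1 * m1 + w2 * m2 - w3 * m3 = 0"
    using assms(8-10) by (simp_all add: eq B_def)
  have "\<Delta> * w1 = 0" "\<Delta> * w2 = 0" "\<Delta> * w3 = 0"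
    unfolding \<Delta>_def using lin by algebra+
  then show ?thesis using \<Delta> by (simp add: eq zero_prod_def)
qed

lemma plane_orthogonal_zero:
  fixes u v w :: complex
  assumes "u \<bullet> v = 0" "w \<bullet> u = 0" "w \<bullet> v = 0" "u \<noteq> 0" "v \<noteq> 0"
  shows "w = 0"
proof -
  have "(cross u v)\<^sup>2 = (u \<bullet> u) * (v \<bullet> v) - (u \<bullet> v)\<^sup>2"
    by (simp add: cross_def inner_complex_def power2_eq_square algebra_simps)
  then have "cross u v \<noteq> 0" using assms by auto
  moreover have "cross u v * Re w = 0" "cross u v * Im w = 0"
    using assms(2,3) unfolding cross_def inner_complex_def by algebra+
  ultimately show ?thesis by (simp add: complex_eq_iff)
qed

section \<open>Angles and the law of cosines\<close>

definition gcos :: "geometry \<Rightarrow> complex \<Rightarrow> complex \<Rightarrow> complex \<Rightarrow> real" where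
  "gcos G x p y = gmetric G p (x - p) (y - p) /
     sqrt (gmetric G p (x - p) (x - p) * gmetric G p (y - p) (y - p))"

lemma gmetric_nonneg:
  assumes "p \<in> plane G" shows "gmetric G p v v \<ge> 0"
  using assms norm_less_1_if_plane[of p] by (cases G) simp_all

lemma gmetric_cauchy_schwarz:
  assumes "p \<in> plane G"
  shows "(gmetric G p v w)\<^sup>2 \<le> gmetric G p v v * gmetric G p w w"
proof (cases G)
  case Euclidean
  then show ?thesis using Cauchy_Schwarz_ineq[of v w] by (simp add: power2_eq_square)
next
  case Hyperbolic
  define n where "n = 1 - (norm p)\<^sup>2"
  have n: "n > 0" using assms norm_less_1_if_plane[of p] Hyperbolic by (simp add: n_def)
  have g: "gmetric G p x y = x \<bullet> y / n + (p \<bullet> x) * (p \<bullet> y) / n\<^sup>2" for x y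
    using Hyperbolic by (simp add: n_def)
  \<comment> \<open>Chosen so that the part of the defect that exceeds the Euclidean Gram
    determinant becomes a square.\<close>
  define z where "z = (p \<bullet> w) *\<^sub>R v - (p \<bullet> v) *\<^sub>R w"
  have "gmetric G p v v * gmetric G p w w - (gmetric G p v w)\<^sup>2
     = ((v \<bullet> v) * (w \<bullet> w) - (v \<bullet> w)\<^sup>2) / n^2 + (z \<bullet> z) / n^3"
  proof -
    have zz: "z \<bullet> z = (p \<bullet> w)\<^sup>2 * (v \<bullet> v) + (p \<bullet> v)\<^sup>2 * (w \<bullet> w) - 2 * (p \<bullet> v) * (p \<bullet> w) * (v \<bullet> w)"
      by (simp add: z_def inner_diff_left inner_diff_right inner_commute algebra_simps power2_eq_square)
    show ?thesis
      unfolding g zz divide_inverse power_inverse[symmetric] by algebra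
  qed
  moreover have "(v \<bullet> v) * (w \<bullet> w) - (v \<bullet> w)\<^sup>2 \<ge> 0"
    using Cauchy_Schwarz_ineq[of v w] by simp
  ultimately show ?thesis using n by (smt (verit) divide_nonneg_pos inner_ge_zero zero_less_power)
qed

text \<open>This bound allows \<open>arccos\<close>, which is injective on the interval from -1 to 1
  only, to be cancelled in equations between angles.\<close>

lemma abs_gcos_le_1:
  assumes "p \<in> plane G" shows "\<bar>gcos G x p y\<bar> \<le> 1"
proof -
  define s where "s = sqrt (gmetric G p (x - p) (x - p) * gmetric G p (y - p) (y - p))"
  have "\<bar>gmetric G p (x - p) (y - p)\<bar> \<le> s"
    unfolding s_def using gmetric_cauchy_schwarz[OF assms] by (intro real_le_rsqrt) simp
  moreover have "s \<ge> 0" by (simp add: s_def gmetric_nonneg[OF assms])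
  ultimately show ?thesis
    unfolding gcos_def s_def[symmetric] by (auto simp: abs_divide divide_le_eq_1)
qed

lemma gcos_eq_if_gangle_eq:
  assumes "p \<in> plane G" "p' \<in> plane G" "gangle G x p y = gangle G x' p' y'"
  shows "gcos G x p y = gcos G x' p' y'"
  using assms abs_gcos_le_1 arccos_eq_iff unfolding gangle_def gcos_def[symmetric] by blast

text \<open>The difference of the products of \<open>cosh_dist\<close> is the
  \<open>sinh * sinh * cos\<close> of the usual law. The tangent vector \<open>x - p\<close> points
  along the geodesic, but its length is not the \<open>sinh\<close> of the distance; the quotient in
  front corrects this and cancels in \<open>gcos\<close>.\<close>

lemma hyperbolic_law_of_cosines:
  assumes "p \<in> plane Hyperbolic" "x \<in> plane Hyperbolic" "y \<in> plane Hyperbolic"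
  shows "gmetric Hyperbolic p (x - p) (y - p)
    = sqrt (1 - (norm x)\<^sup>2) * sqrt (1 - (norm y)\<^sup>2) / (1 - (norm p)\<^sup>2)
       * (cosh_dist x p * cosh_dist p y - cosh_dist x y)"
proof -
  define n where "n = 1 - (norm p)\<^sup>2"
  define r s t where "r = sqrt (1 - (norm x)\<^sup>2)" and "s = sqrt (1 - (norm y)\<^sup>2)" and "t = sqrt n"
  have pos: "n > 0" "r > 0" "s > 0" "t > 0"
    using assms norm_less_1_if_plane by (simp_all add: n_def r_def s_def t_def)
  have t2: "t * t = n" using pos by (simp add: t_def)
  have pp: "p \<bullet> p = 1 - n" by (simp add: n_def dot_square_norm)
  have "gmetric Hyperbolic p (x - p) (y - p)
     = (x - p) \<bullet> (y - p) / n + (p \<bullet> (x - p)) * (p \<bullet> (y - p)) / n\<^sup>2"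
    by (simp add: n_def)
  then have "n\<^sup>2 * gmetric Hyperbolic p (x - p) (y - p)
     = n * ((x - p) \<bullet> (y - p)) + (p \<bullet> (x - p)) * (p \<bullet> (y - p))"
    using pos by (simp add: field_simps power2_eq_square)
  also have "\<dots> = (1 - x \<bullet> p) * (1 - p \<bullet> y) - (1 - x \<bullet> y) * n"
    by (simp add: inner_diff_left inner_diff_right pp inner_commute algebra_simps)
  also have "\<dots> = n\<^sup>2 * (r * s / n * (cosh_dist x p * cosh_dist p y - cosh_dist x y))"
  proof -
    have 1: "cosh_dist x p * cosh_dist p y = (1 - x \<bullet> p) * (1 - p \<bullet> y) / (r * s * n)"
      unfolding cosh_dist_def n_def[symmetric] r_def[symmetric] s_def[symmetric] t_def[symmetric]
      by (simp add: t2[symmetric])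
    have 2: "cosh_dist x y = (1 - x \<bullet> y) / (r * s)"
      by (simp add: cosh_dist_def r_def s_def)
    show ?thesis unfolding 1 2 using pos by (simp add: field_simps power2_eq_square)
  qed
  finally have eq: "n\<^sup>2 * gmetric Hyperbolic p (x - p) (y - p)
     = n\<^sup>2 * (r * s / n * (cosh_dist x p * cosh_dist p y - cosh_dist x y))" .
  have "n\<^sup>2 \<noteq> 0" using pos by simp
  from mult_left_cancel[THEN iffD1, OF this eq] show ?thesis
    unfolding n_def r_def s_def .
qed

lemma gcos_cosh_dist:
  assumes "p \<in> plane Hyperbolic" "x \<in> plane Hyperbolic" "y \<in> plane Hyperbolic"
    and "cosh_dist x p = c" "cosh_dist p y = c" "c > 1"
  shows "gcos Hyperbolic x p y = (c\<^sup>2 - cosh_dist x y) / (c\<^sup>2 - 1)"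
proof -
  define n r s where "n = 1 - (norm p)\<^sup>2" and "r = sqrt (1 - (norm x)\<^sup>2)" and "s = sqrt (1 - (norm y)\<^sup>2)"
  define k where "k = r * s / n"
  have k: "k > 0"
    using assms norm_less_1_if_plane by (simp add: k_def n_def r_def s_def)
  have c: "c\<^sup>2 - 1 > 0" using one_less_power[of c 2] assms(6) by simp
  have "gmetric Hyperbolic p (x - p) (x - p) = r * r / n * (c\<^sup>2 - 1)"
    unfolding hyperbolic_law_of_cosines[OF assms(1,2,2)] r_def[symmetric] n_def[symmetric]
    using assms by (simp only: cosh_dist_refl cosh_dist_commute[of p x] power2_eq_square)
  moreover have "gmetric Hyperbolic p (y - p) (y - p) = s * s / n * (c\<^sup>2 - 1)"
    unfolding hyperbolic_law_of_cosines[OF assms(1,3,3)] s_def[symmetric] n_def[symmetric]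
    using assms by (simp only: cosh_dist_refl cosh_dist_commute[of y p] power2_eq_square)
  ultimately have "gmetric Hyperbolic p (x - p) (x - p) * gmetric Hyperbolic p (y - p) (y - p)
      = (k * (c\<^sup>2 - 1))\<^sup>2"
    by (simp add: k_def power_mult_distrib power_divide power2_eq_square del: gmetric.simps)
  then have "sqrt (gmetric Hyperbolic p (x - p) (x - p) * gmetric Hyperbolic p (y - p) (y - p))
      = k * (c\<^sup>2 - 1)"
    using k c by (simp del: gmetric.simps)
  moreover have "gmetric Hyperbolic p (x - p) (y - p) = k * (c\<^sup>2 - cosh_dist x y)"
    unfolding hyperbolic_law_of_cosines[OF assms(1-3)] k_def n_def r_def s_def
    using assms by (simp add: power2_eq_square)
  ultimately show ?thesis using k by (simp add: gcos_def del: gmetric.simps)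
qed

text \<open>By the law of cosines the equal angles at \<open>v0\<close> and \<open>v1\<close> force
  equal diagonals. The defect \<open>L v0 + L v2 - L v1 - L v3\<close> is then orthogonal to the
  differences along both diagonals and to the sum of all four lifts, and these three form an
  orthogonal basis of Minkowski space.\<close>

lemma wall_equation_Hyperbolic:
  assumes in_plane: "{v0, v1, v2, v3} \<subseteq> plane Hyperbolic" and dist: "distinct [v0, v1, v2, v3]"
    and sides: "gdist Hyperbolic v0 v1 = gdist Hyperbolic v1 v2"
      "gdist Hyperbolic v1 v2 = gdist Hyperbolic v2 v3" "gdist Hyperbolic v2 v3 = gdist Hyperbolic v3 v0"
    and angle: "gangle Hyperbolic v3 v0 v1 = gangle Hyperbolic v0 v1 v2"
  defines "L \<equiv> affine_lift Hyperbolic"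
  shows "L v0 + L v2 = L v1 + L v3" "wall_form Hyperbolic (L v0 - L v1) (L v1 - L v2) = 0"
proof -
  define B where "B = wall_form Hyperbolic"
  define c where "c = cosh_dist v0 v1"
  have pl: "v0 \<in> plane Hyperbolic" "v1 \<in> plane Hyperbolic" "v2 \<in> plane Hyperbolic" "v3 \<in> plane Hyperbolic"
    using in_plane by auto
  have eqI: "cosh_dist x y = cosh_dist x' y'"
    if "gdist Hyperbolic x y = gdist Hyperbolic x' y'" "{x, y, x', y'} \<subseteq> plane Hyperbolic" for x y x' y'
    using that cosh_dist_ge_1[of x y] cosh_dist_ge_1[of x' y']
    unfolding gdist_Hyperbolic by (metis cosh_arcosh_real insert_subset)
  have c: "cosh_dist v1 v2 = c" "cosh_dist v2 v3 = c" "cosh_dist v3 v0 = c" "cosh_dist v0 v1 = c"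
    using eqI[OF sides(1)] eqI[OF sides(2)] eqI[OF sides(3)] pl by (simp_all add: c_def)
  have c1: "c > 1" using cosh_dist_gt_1[of v0 v1] pl dist by (simp add: c_def)
  have "c\<^sup>2 > 1" by (rule one_less_power) (use c1 in auto)
  then have c2: "c\<^sup>2 - 1 \<noteq> 0" by linarith
  define d where "d = cosh_dist v0 v2"
  have d1: "d > 1" using cosh_dist_gt_1[of v0 v2] pl dist by (simp add: d_def)
  have d: "cosh_dist v3 v1 = d"
    using gcos_eq_if_gangle_eq[OF pl(1,2) angle]
      gcos_cosh_dist[OF pl(1,4,2) c(3,4) c1] gcos_cosh_dist[OF pl(2,1,3) c(4,1) c1] c2
    by (simp add: d_def)
  have B: "B (L v0) (L v0) = -1" "B (L v1) (L v1) = -1" "B (L v2) (L v2) = -1" "B (L v3) (L v3) = -1"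
    "B (L v0) (L v1) = - c" "B (L v1) (L v2) = - c" "B (L v2) (L v3) = - c" "B (L v3) (L v0) = - c"
    "B (L v1) (L v0) = - c" "B (L v2) (L v1) = - c" "B (L v3) (L v2) = - c" "B (L v0) (L v3) = - c"
    "B (L v0) (L v2) = - d" "B (L v2) (L v0) = - d" "B (L v1) (L v3) = - d" "B (L v3) (L v1) = - d"
    unfolding B_def L_def wall_form_lift
    using c d pl by (simp_all add: cosh_dist_refl cosh_dist_commute d_def)
  have add: "B (x + y) z = B x z + B y z" "B z (x + y) = B z x + B z y"
     "B (x - y) z = B x z - B y z" "B z (x - y) = B z x - B z y" for x y z
    by (simp_all add: B_def inner_add_left inner_add_right inner_diff_left inner_diff_right algebra_simps)
  define coord where "coord F = (Re (fst F), Im (fst F), snd F)" for F :: "complex \<times> real"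
  have coord: "fst (coord F) * fst (coord H) + fst (snd (coord F)) * fst (snd (coord H))
      - snd (snd (coord F)) * snd (snd (coord H)) = B F H" for F H
    by (simp add: coord_def B_def inner_complex_def)
  define w where "w = L v0 + L v2 - L v1 - L v3"
  have "coord w = 0"
    by (rule lorentz_orthogonal_zero[of "coord (L v0 - L v2)" "coord (L v1 - L v3)"
          "coord (L v0 + L v2 + L v1 + L v3)"], unfold coord w_def)
      (use d1 c1 in \<open>simp_all add: add B\<close>)
  then have w: "w = 0"
    by (simp add: coord_def prod_eq_iff complex_eq_iff zero_prod_def)
  then show "L v0 + L v2 = L v1 + L v3" by (simp add: w_def algebra_simps)
  \<comment> \<open>Reading the vanishing of \<open>w\<close> against one vertex ties the diagonal
    to the side, and this relation is the perpendicularity of the bisectors.\<close>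
  have "B w (L v0) = 0" using w by (simp add: B_def)
  then have "2 * c = 1 + d" by (simp add: w_def add B)
  then show "wall_form Hyperbolic (L v0 - L v1) (L v1 - L v2) = 0"
    unfolding B_def[symmetric] by (simp add: add B)
qed

lemma wall_equation_Euclidean:
  assumes dist: "distinct [v0, v1, v2, v3]"
    and sides: "gdist Euclidean v0 v1 = gdist Euclidean v1 v2"
      "gdist Euclidean v1 v2 = gdist Euclidean v2 v3" "gdist Euclidean v2 v3 = gdist Euclidean v3 v0"
    and angle: "gangle Euclidean v3 v0 v1 = gangle Euclidean v0 v1 v2"
  defines "L \<equiv> affine_lift Euclidean"
  shows "L v0 + L v2 = L v1 + L v3" "wall_form Euclidean (L v0 - L v1) (L v1 - L v2) = 0"
proof -
  define l where "l = (v0 - v1) \<bullet> (v0 - v1)"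
  have l: "(v1 - v0) \<bullet> (v1 - v0) = l" "(v1 - v2) \<bullet> (v1 - v2) = l" "(v2 - v1) \<bullet> (v2 - v1) = l"
    "(v2 - v3) \<bullet> (v2 - v3) = l" "(v3 - v0) \<bullet> (v3 - v0) = l" "(v0 - v1) \<bullet> (v0 - v1) = l"
    using sides by (simp_all add: l_def dist_norm dot_square_norm norm_minus_commute)
  have "l > 0" using dist by (simp add: l_def)
  have "(v3 - v0) \<bullet> (v1 - v0) / sqrt (l * l) = (v0 - v1) \<bullet> (v2 - v1) / sqrt (l * l)"
    using gcos_eq_if_gangle_eq[OF _ _ angle] l by (simp add: gcos_def)
  then have ang: "(v3 - v0) \<bullet> (v1 - v0) = (v0 - v1) \<bullet> (v2 - v1)"
    using \<open>l > 0\<close> by simp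
  define w where "w = v0 + v2 - v1 - v3"
  have "w = 0"
  proof (rule plane_orthogonal_zero[of "v0 - v2" "v1 - v3"])
    show "(v0 - v2) \<bullet> (v1 - v3) = 0" "w \<bullet> (v0 - v2) = 0" "w \<bullet> (v1 - v3) = 0"
      using l by (simp_all add: w_def inner_diff_left inner_diff_right inner_add_left inner_add_right inner_commute)
    show "v0 - v2 \<noteq> 0" "v1 - v3 \<noteq> 0" using dist by auto
  qed
  then have v3: "v3 = v0 + v2 - v1" by (simp add: w_def)
  have orth: "(v0 - v1) \<bullet> (v1 - v2) = 0"
    using ang unfolding v3 by (simp add: inner_diff_left inner_diff_right inner_add_left inner_commute)
  then show "wall_form Euclidean (L v0 - L v1) (L v1 - L v2) = 0"
    by (simp add: L_def)
  \<comment> \<open>The second components of the lifts; for a parallelogram their equation expresses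
    the right angle.\<close>
  have "(norm v0)\<^sup>2 + (norm v2)\<^sup>2 = (norm v1)\<^sup>2 + (norm v3)\<^sup>2"
    using orth unfolding v3 power2_norm_eq_inner
    by (simp add: inner_diff_left inner_diff_right inner_add_left inner_add_right inner_commute)
  then show "L v0 + L v2 = L v1 + L v3"
    by (simp add: L_def v3)
qed

section \<open>Tiles and their edges\<close>

abbreviation edge :: "complex set \<Rightarrow> complex \<Rightarrow> complex \<Rightarrow> bool" where
  "edge X v w \<equiv> closed_segment v w edge_of X"

abbreviation vertices :: "complex set \<Rightarrow> complex set" where
  "vertices X \<equiv> {v. v extreme_point_of X}"

lemma edge_sym: "edge X v w \<longleftrightarrow> edge X w v"
  by (simp add: closed_segment_commute)

lemma edge_distinct: "edge X v w \<Longrightarrow> v \<noteq> w"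
  by (auto simp: edge_of_def)

lemma edge_vertices:
  assumes "edge X v w" shows "v extreme_point_of X" "w extreme_point_of X"
  using assms extreme_point_of_face[of "closed_segment v w" X] by (auto simp: edge_of_def extreme_point_of_segment)

lemma quadrilateral_vertices:
  assumes "quadrilateral X v0 v1 v2 v3"
  shows "vertices X = {v0, v1, v2, v3}"
proof
  show "vertices X \<subseteq> {v0, v1, v2, v3}"
    using assms extreme_point_of_convex_hull by (auto simp: quadrilateral_def)
  show "{v0, v1, v2, v3} \<subseteq> vertices X"
    using assms edge_vertices by (auto simp: quadrilateral_def)
qed

lemma quadrilateral_rotate: "quadrilateral X v0 v1 v2 v3 \<Longrightarrow> quadrilateral X v1 v2 v3 v0"
proof -
  have "{v1, v2, v3, v0} = {v0, v1, v2, v3}" by auto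
  then show "quadrilateral X v0 v1 v2 v3 \<Longrightarrow> quadrilateral X v1 v2 v3 v0"
    by (auto simp: quadrilateral_def)
qed

lemma quadrilateral_reflect: "quadrilateral X v0 v1 v2 v3 \<Longrightarrow> quadrilateral X v3 v2 v1 v0"
proof -
  have "{v3, v2, v1, v0} = {v0, v1, v2, v3}" by auto
  then show "quadrilateral X v0 v1 v2 v3 \<Longrightarrow> quadrilateral X v3 v2 v1 v0"
    by (auto simp: quadrilateral_def closed_segment_commute)
qed

lemma quadrilateral_convex_compact:
  assumes "quadrilateral X v0 v1 v2 v3"
  shows "convex X" "compact X" "closed X"
  using assms by (auto simp: quadrilateral_def compact_convex_hull finite_imp_compact compact_imp_closed)

text \<open>An edge is a face of dimension 1, and a proper one because a segment has only two
  extreme points.\<close>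

lemma quadrilateral_aff_dim:
  assumes "quadrilateral X v0 v1 v2 v3"
  shows "aff_dim X = 2"
proof -
  have e: "closed_segment v0 v1 face_of X" "aff_dim (closed_segment v0 v1) = 1"
    using assms by (auto simp: quadrilateral_def edge_of_def)
  have "closed_segment v0 v1 \<noteq> X"
    using quadrilateral_vertices[OF assms] assms extreme_point_of_segment[of v2 v0 v1]
    by (auto simp: quadrilateral_def)
  then have "1 < aff_dim X"
    using face_of_aff_dim_lt[OF quadrilateral_convex_compact(1)[OF assms] e(1)] e(2) by simp
  then show ?thesis using aff_dim_le_DIM[of X] by simp
qed

lemma quadrilateral_interior:
  assumes "quadrilateral X v0 v1 v2 v3"
  shows "interior X \<noteq> {}"
proof -
  have "affine hull X = UNIV"
    using quadrilateral_aff_dim[OF assms] aff_dim_eq_full[of X] by simp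
  moreover have "X \<noteq> {}" using assms by (auto simp: quadrilateral_def)
  ultimately show ?thesis
    using rel_interior_interior rel_interior_eq_empty quadrilateral_convex_compact(1)[OF assms] by metis
qed

lemma segment_face:
  fixes F :: "complex set"
  assumes "F face_of X" "convex X" "compact X" "F \<noteq> {}" "aff_dim F \<le> 1"
  obtains v w where "F = closed_segment v w" "v extreme_point_of X" "w extreme_point_of X"
proof -
  have "compact F" "convex F"
    using assms face_of_imp_compact face_of_imp_convex by blast+
  then obtain v w where F: "F = closed_segment v w"
    using compact_convex_collinear_segment[of F] assms(4,5) collinear_aff_dim by metis
  then show ?thesis
    using that extreme_point_of_face[OF assms(1)] extreme_point_of_segment by blast
qed

text \<open>
  The hypothesis exhibits the same point as a weighted mean of \<open>v0, v2\<close> and of \<open>v1, v3\<close>, the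
  weights being \<open>1 / sqrt (1 - (norm v)\<^sup>2)\<close> in the hyperbolic case.
\<close>

lemma diagonals_meet:
  assumes pl: "{v0, v1, v2, v3} \<subseteq> plane G" and dist: "v0 \<noteq> v2" "v1 \<noteq> v3"
    and eq: "affine_lift G v0 + affine_lift G v2 = affine_lift G v1 + affine_lift G v3"
  obtains p where "p \<in> open_segment v0 v2" "p \<in> open_segment v1 v3"
proof -
  define k where "k v = (if G = Hyperbolic then 1 / sqrt (1 - (norm v)\<^sup>2) else 1)" for v :: complex
  have pos: "k v > 0" if "v \<in> plane G" for v
    using that norm_less_1_if_plane[of v] by (cases G) (auto simp: k_def)
  have fst: "fst (affine_lift G v) = k v *\<^sub>R v" for v
    by (cases G) (simp_all add: k_def inverse_eq_divide)
  have p: "k v0 > 0" "k v1 > 0" "k v2 > 0" "k v3 > 0" using pl pos by auto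
  have sum: "k v0 + k v2 = k v1 + k v3"
    using arg_cong[OF eq, of snd] by (cases G) (simp_all add: k_def)
  have vec: "k v0 *\<^sub>R v0 + k v2 *\<^sub>R v2 = k v1 *\<^sub>R v1 + k v3 *\<^sub>R v3"
    using arg_cong[OF eq, of fst] by (simp add: fst)
  have mem: "inverse (r + s) *\<^sub>R (r *\<^sub>R a + s *\<^sub>R b) \<in> open_segment a b"
    if "r > 0" "s > 0" "a \<noteq> b" for r s :: real and a b :: complex
  proof -
    have "1 - s / (r + s) = r / (r + s)" using that by (simp add: field_simps)
    then have "inverse (r + s) *\<^sub>R (r *\<^sub>R a + s *\<^sub>R b) = (1 - s / (r + s)) *\<^sub>R a + (s / (r + s)) *\<^sub>R b"
      by (simp add: scaleR_add_right divide_inverse mult.commute)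
    moreover have "0 < s / (r + s)" "s / (r + s) < 1" using that by simp_all
    ultimately show ?thesis using that(3) unfolding in_segment(2) by blast
  qed
  show ?thesis
    using that mem[OF p(1,3) dist(1)] mem[OF p(2,4) dist(2)] unfolding vec sum by blast
qed

lemma convex_hull_3_mem:
  fixes a b c :: complex
  assumes "convex X" "{a, b, c} \<subseteq> X" "0 \<le> r" "0 \<le> s" "0 \<le> t" "r + s + t = 1"
  shows "r *\<^sub>R a + s *\<^sub>R b + t *\<^sub>R c \<in> X"
proof -
  have "r *\<^sub>R a + s *\<^sub>R b + t *\<^sub>R c \<in> convex hull {a, b, c}"
    unfolding convex_hull_3 using assms by blast
  then show ?thesis using hull_minimal[of "{a, b, c}" X convex] assms by blast
qed

lemma wall_form_uminus: "wall_form G (- F) H = - wall_form G F H" "wall_form G F (- H) = - wall_form G F H"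
  by (cases G; simp)+

locale square_tiling =
  fixes G :: geometry and \<T> :: "complex set set"
  assumes tiling: "tiling_of_plane G \<T>"
    and regular: "X \<in> \<T> \<Longrightarrow> regular_square G X"
begin

definition square_walls :: "complex \<Rightarrow> complex \<Rightarrow> complex \<Rightarrow> complex \<Rightarrow> bool" where
  "square_walls v0 v1 v2 v3 \<longleftrightarrow>
     bisector G v0 v1 = bisector G v3 v2 \<and> bisector G v1 v2 = bisector G v0 v3 \<and>
     wall_form G (bisector G v0 v1) (bisector G v1 v2) = 0"

lemma tile_subset_plane: "X \<in> \<T> \<Longrightarrow> X \<subseteq> plane G"
  using tiling by (auto simp: tiling_of_plane_def)

lemma tiles_cover: "p \<in> plane G \<Longrightarrow> \<exists>X\<in>\<T>. p \<in> X"
  using tiling by (auto simp: tiling_of_plane_def)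

lemma vertex_in_tile: "v extreme_point_of X \<Longrightarrow> v \<in> X"
  by (simp add: extreme_point_of_def)

lemma vertex_in_plane: "\<lbrakk>X \<in> \<T>; v extreme_point_of X\<rbrakk> \<Longrightarrow> v \<in> plane G"
  using tile_subset_plane vertex_in_tile by blast

lemma tile_quadrilateral:
  assumes "X \<in> \<T>"
  obtains v0 v1 v2 v3 where "quadrilateral X v0 v1 v2 v3" "{v0, v1, v2, v3} \<subseteq> plane G"
    "affine_lift G v0 + affine_lift G v2 = affine_lift G v1 + affine_lift G v3"
    "wall_form G (bisector G v0 v1) (bisector G v1 v2) = 0"
proof -
  obtain v0 v1 v2 v3 where v: "{v0, v1, v2, v3} \<subseteq> plane G" "quadrilateral X v0 v1 v2 v3"
      "gdist G v0 v1 = gdist G v1 v2" "gdist G v1 v2 = gdist G v2 v3" "gdist G v2 v3 = gdist G v3 v0"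
      "gangle G v3 v0 v1 = gangle G v0 v1 v2"
    using regular[OF assms] unfolding regular_square_def by blast
  have dist: "distinct [v0, v1, v2, v3]" using v(2) by (simp add: quadrilateral_def)
  show ?thesis
  proof (cases G)
    case Euclidean
    show ?thesis
      using that v wall_equation_Euclidean[OF dist] unfolding bisector_def Euclidean by blast
  next
    case Hyperbolic
    show ?thesis
      using that v wall_equation_Hyperbolic[OF _ dist] unfolding bisector_def Hyperbolic by blast
  qed
qed

lemma tile_convex_compact:
  assumes "X \<in> \<T>" shows "convex X" "compact X" "closed X"
  using tile_quadrilateral[OF assms] quadrilateral_convex_compact by metis+

lemma tile_interior: "X \<in> \<T> \<Longrightarrow> interior X \<noteq> {}"
  using tile_quadrilateral quadrilateral_interior by metis

lemma tile_aff_dim: "X \<in> \<T> \<Longrightarrow> aff_dim X = 2"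
  using tile_quadrilateral quadrilateral_aff_dim by metis

text \<open>A diagonal is no edge: the other diagonal crosses it, and a face that contains an inner
  point of a segment contains the ends of the segment.\<close>

lemma tile_edge_cases:
  assumes X: "X \<in> \<T>" and q: "quadrilateral X v0 v1 v2 v3" "{v0, v1, v2, v3} \<subseteq> plane G"
    "affine_lift G v0 + affine_lift G v2 = affine_lift G v1 + affine_lift G v3"
    and e: "edge X v w"
  shows "{v, w} \<in> {{v0, v1}, {v1, v2}, {v2, v3}, {v3, v0}}"
proof -
  have dist: "v0 \<noteq> v2" "v1 \<noteq> v3" using q(1) by (auto simp: quadrilateral_def)
  obtain p where p: "p \<in> open_segment v0 v2" "p \<in> open_segment v1 v3"
    using diagonals_meet[OF q(2) dist q(3)] .
  have no_diagonal: "\<not> edge X a c" if "p \<in> open_segment a c" "p \<in> open_segment b d"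
    "b extreme_point_of X" "d extreme_point_of X" "b \<noteq> a" "b \<noteq> c" for a b c d
  proof
    assume "edge X a c"
    then have f: "closed_segment a c face_of X" by (simp add: edge_of_def)
    have "b \<in> closed_segment a c"
      using face_ofD[OF f that(2)] that vertex_in_tile segment_open_subset_closed by blast
    then show False
      using extreme_point_of_face[OF f, of b] that extreme_point_of_segment by blast
  qed
  have V: "vertices X = {v0, v1, v2, v3}" using quadrilateral_vertices[OF q(1)] .
  then have ext: "v0 extreme_point_of X" "v1 extreme_point_of X" "v2 extreme_point_of X" "v3 extreme_point_of X"
    by auto
  have "v \<in> {v0, v1, v2, v3}" "w \<in> {v0, v1, v2, v3}" "v \<noteq> w"
    using edge_vertices[OF e] V edge_distinct[OF e] by auto
  moreover have "\<not> edge X v0 v2" "\<not> edge X v1 v3"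
    using no_diagonal[OF p ext(2,4)] no_diagonal[OF p(2,1) ext(1,3)] q(1) by (auto simp: quadrilateral_def)
  ultimately show ?thesis
    using e by (auto simp: closed_segment_commute insert_commute)
qed

lemma square_walls_rotate:
  assumes "square_walls v0 v1 v2 v3" shows "square_walls v1 v2 v3 v0"
proof -
  have "bisector G v2 v3 = - bisector G v0 v1" "bisector G v1 v0 = - bisector G v0 v1"
    using assms bisector_swap[of G v3 v2] bisector_swap[of G v0 v1] by (simp_all add: square_walls_def)
  moreover have "wall_form G (bisector G v1 v2) (bisector G v0 v1) = 0"
    using assms wall_form_sym unfolding square_walls_def by metis
  ultimately show ?thesis
    using assms unfolding square_walls_def by (simp add: wall_form_uminus)
qed

lemma square_walls_reflect:
  assumes "square_walls v0 v1 v2 v3" shows "square_walls v3 v2 v1 v0"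
proof -
  have "bisector G v2 v1 = - bisector G v1 v2" "bisector G v3 v0 = - bisector G v1 v2"
    using assms bisector_swap[of G v0 v3] bisector_swap[of G v1 v2] by (simp_all add: square_walls_def)
  then show ?thesis
    using assms unfolding square_walls_def by (metis wall_form_uminus(2) neg_equal_0_iff_equal)
qed

text \<open>\<open>regular_square\<close> gives metric data for one unknown labelling of the
  vertices. Every other cyclic labelling has the same edges and so differs from it by rotations and
  a reflection, under which \<open>square_walls\<close> is invariant.\<close>

lemma quadrilateral_walls:
  assumes X: "X \<in> \<T>" and w: "quadrilateral X w0 w1 w2 w3"
  shows "square_walls w0 w1 w2 w3"
proof -
  obtain v0 v1 v2 v3 where v: "quadrilateral X v0 v1 v2 v3" "{v0, v1, v2, v3} \<subseteq> plane G"
    "affine_lift G v0 + affine_lift G v2 = affine_lift G v1 + affine_lift G v3"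
    "wall_form G (bisector G v0 v1) (bisector G v1 v2) = 0"
    using tile_quadrilateral[OF X] .
  have sw: "square_walls v0 v1 v2 v3"
    using v(3,4) unfolding square_walls_def bisector_def
    by (simp add: algebra_simps)
  have e: "edge X w0 w1" "edge X w3 w0" "distinct [w0, w1, w2, w3]" "distinct [v0, v1, v2, v3]"
    using w v(1) by (auto simp: quadrilateral_def)
  note c = tile_edge_cases[OF X v(1-3)]
  have V: "{w0, w1, w2, w3} = {v0, v1, v2, v3}"
    using quadrilateral_vertices w v(1) by metis
  have aux: "square_walls w0 w1 w2 w3"
    if "w0 = x0" "distinct [x0, x1, x2, x3]" "square_walls x0 x1 x2 x3"
      "{w0, w1} \<in> {{x0, x1}, {x1, x2}, {x2, x3}, {x3, x0}}"
      "{w3, w0} \<in> {{x0, x1}, {x1, x2}, {x2, x3}, {x3, x0}}"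
      "{w0, w1, w2, w3} = {x0, x1, x2, x3}" for x0 x1 x2 x3
  proof -
    have "w1 = x1 \<or> w1 = x3" "w3 = x1 \<or> w3 = x3"
      using that by (auto simp: doubleton_eq_iff)
    then have "w1 = x1 \<and> w3 = x3 \<or> w1 = x3 \<and> w3 = x1"
      using e(3) by auto
    moreover have "w2 = x2"
      using that(1,6) e(3) calculation by auto
    ultimately show ?thesis
      using that(1,3) square_walls_reflect square_walls_rotate by blast
  qed
  have "w0 \<in> {v0, v1, v2, v3}" using V by auto
  then consider "w0 = v0" | "w0 = v1" | "w0 = v2" | "w0 = v3" by auto
  then show ?thesis
  proof cases
    case 1
    show ?thesis
      using aux[OF 1 e(4) sw c[OF e(1)] c[OF e(2)] V] .
  next
    case 2
    then show ?thesis
      using aux[of v1 v2 v3 v0] e(4) sw c[OF e(1)] c[OF e(2)] V square_walls_rotate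
      by (auto simp: insert_commute)
  next
    case 3
    then show ?thesis
      using aux[of v2 v3 v0 v1] e(4) sw c[OF e(1)] c[OF e(2)] V square_walls_rotate
      by (auto simp: insert_commute)
  next
    case 4
    then show ?thesis
      using aux[of v3 v0 v1 v2] e(4) sw c[OF e(1)] c[OF e(2)] V square_walls_rotate
      by (auto simp: insert_commute)
  qed
qed

end

section \<open>Walls\<close>

context square_tiling
begin

lemma tiles_Int_face:
  assumes "X \<in> \<T>" "Y \<in> \<T>" "X \<noteq> Y"
  shows "X \<inter> Y face_of X" "X \<inter> Y face_of Y"
  using assms tiling unfolding tiling_of_plane_def by blast+

lemma vertex_of_tile:
  assumes "X \<in> \<T>" "Y \<in> \<T>" "v extreme_point_of X" "v \<in> Y"
  shows "v extreme_point_of Y"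
  using assms tiles_Int_face[of X Y] extreme_point_of_face vertex_in_tile by (metis IntI)

text \<open>A tile is the closure of its interior, so disjointness of the interiors extends to the
  boundary of \<open>Y\<close>.\<close>

lemma interior_tile_Int:
  assumes "X \<in> \<T>" "Y \<in> \<T>" "X \<noteq> Y"
  shows "interior X \<inter> Y = {}"
proof -
  have "interior X \<inter> interior Y = {}"
    using assms tiling unfolding tiling_of_plane_def by blast
  then have "interior X \<inter> closure (interior Y) = {}"
    by (simp add: open_Int_closure_eq_empty)
  then show ?thesis
    using convex_closure_interior[of Y] tile_convex_compact[OF assms(2)] tile_interior[OF assms(2)]
    by (simp add: closure_closed)
qed

lemma tiles_Int_aff_dim:
  assumes "X \<in> \<T>" "Y \<in> \<T>" "X \<noteq> Y"
  shows "aff_dim (X \<inter> Y) \<le> 1"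
proof -
  have "X \<inter> Y \<noteq> X"
    using interior_tile_Int[OF assms] tile_interior[OF assms(1)] interior_subset[of X] by blast
  then show ?thesis
    using face_of_aff_dim_lt[OF _ tiles_Int_face(1)[OF assms]] tile_convex_compact[OF assms(1)]
      tile_aff_dim[OF assms(1)] by simp
qed

lemma tiles_Int_segment:
  assumes "X \<in> \<T>" "Y \<in> \<T>" "X \<noteq> Y" "X \<inter> Y \<noteq> {}"
  obtains v w where "X \<inter> Y = closed_segment v w" "v extreme_point_of X" "w extreme_point_of X"
    "v extreme_point_of Y" "w extreme_point_of Y"
proof -
  obtain v w where *: "X \<inter> Y = closed_segment v w" "v extreme_point_of X" "w extreme_point_of X"
    using segment_face[OF tiles_Int_face(1)[OF assms(1-3)]] tile_convex_compact[OF assms(1)]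
      tiles_Int_aff_dim[OF assms(1-3)] assms(4) by metis
  then have "v \<in> Y" "w \<in> Y" by auto
  then show ?thesis
    using that * vertex_of_tile assms by blast
qed

lemma segment_Int_edge:
  assumes "X \<in> \<T>" "Y \<in> \<T>" "X \<noteq> Y" "X \<inter> Y = closed_segment v w" "v \<noteq> w"
  shows "edge X v w" "edge Y v w"
proof -
  have "aff_dim (closed_segment v w) = 1"
    using assms(5) aff_dim_2[of v w] by (simp add: segment_convex_hull aff_dim_convex_hull)
  then show "edge X v w" "edge Y v w"
    using tiles_Int_face[OF assms(1-3)] unfolding edge_of_def assms(4) by blast+
qed

lemma common_vertices_edge:
  assumes "X \<in> \<T>" "Y \<in> \<T>" "X \<noteq> Y" "v \<noteq> w"
    and "v extreme_point_of X" "w extreme_point_of X" "v \<in> Y" "w \<in> Y"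
  shows "X \<inter> Y = closed_segment v w" "edge X v w" "edge Y v w"
proof -
  have mem: "v \<in> X \<inter> Y" "w \<in> X \<inter> Y" using assms vertex_in_tile by auto
  then have "X \<inter> Y \<noteq> {}" by auto
  then obtain a b where ab: "X \<inter> Y = closed_segment a b"
    using tiles_Int_segment[OF assms(1-3)] by metis
  have "v extreme_point_of X \<inter> Y" "w extreme_point_of X \<inter> Y"
    using extreme_point_of_face[OF tiles_Int_face(1)[OF assms(1-3)]] mem assms by auto
  then show *: "X \<inter> Y = closed_segment v w"
    using assms(4) unfolding ab extreme_point_of_segment by (auto simp: closed_segment_commute[of b a])
  show "edge X v w" "edge Y v w"
    using segment_Int_edge[OF assms(1-3) * assms(4)] .
qed

lemma adjacent_common_edge:
  assumes "X \<in> \<T>" "Y \<in> \<T>" "adjacent X Y"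
  obtains v w where "X \<inter> Y = closed_segment v w" "edge X v w" "edge Y v w"
proof -
  obtain e where e: "X \<noteq> Y" "e edge_of X" "e edge_of Y"
    using assms(3) by (auto simp: adjacent_def)
  have sub: "e \<subseteq> X \<inter> Y" "aff_dim e = 1" "e face_of X"
    using e edge_of_imp_subset by (auto simp: edge_of_def)
  have "e \<noteq> {}" using sub(2) by (cases "e = {}") simp_all
  then have "X \<inter> Y \<noteq> {}" using sub(1) by auto
  then obtain v w where *: "X \<inter> Y = closed_segment v w"
    using tiles_Int_segment[OF assms(1,2) e(1)] by metis
  have "v \<noteq> w"
    using sub * aff_dim_subset[of e "{v}"] by auto
  then show ?thesis
    using that segment_Int_edge[OF assms(1,2) e(1) *] * by blast
qed

text \<open>A wall is a functional and not a line. It occurs with both signs, so that its sides can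
  be told apart.\<close>

definition wall :: "complex set \<Rightarrow> complex \<times> real \<Rightarrow> bool" where
  "wall X F \<longleftrightarrow> (\<exists>v w. edge X v w \<and> F = bisector G v w)"

lemma wall_uminus: "wall X (- F) \<longleftrightarrow> wall X F"
proof -
  have "wall X F \<Longrightarrow> wall X (- F)" for F
    unfolding wall_def using bisector_swap closed_segment_commute by metis
  from this[of F] this[of "- F"] show ?thesis by auto
qed

lemma edge_wall: "edge X v w \<Longrightarrow> wall X (bisector G v w)"
  by (auto simp: wall_def)

lemma tile_some_quadrilateral:
  assumes "X \<in> \<T>"
  obtains v0 v1 v2 v3 where "quadrilateral X v0 v1 v2 v3"
  using tile_quadrilateral[OF assms] by metis

lemma tile_edges:
  assumes "X \<in> \<T>" "quadrilateral X v0 v1 v2 v3" "edge X v w"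
  shows "{v, w} \<in> {{v0, v1}, {v1, v2}, {v2, v3}, {v3, v0}}"
proof (rule tile_edge_cases[OF assms(1,2) _ _ assms(3)])
  show "{v0, v1, v2, v3} \<subseteq> plane G"
    using quadrilateral_vertices[OF assms(2)] vertex_in_plane[OF assms(1)] by auto
  show "affine_lift G v0 + affine_lift G v2 = affine_lift G v1 + affine_lift G v3"
  proof -
    have "affine_lift G v0 - affine_lift G v1 = affine_lift G v3 - affine_lift G v2"
      using quadrilateral_walls[OF assms(1,2)] unfolding square_walls_def bisector_def by blast
    then show ?thesis by (metis add.commute diff_add_cancel diff_add_eq)
  qed
qed

lemma edge_quadrilateral:
  assumes "X \<in> \<T>" "edge X v w"
  obtains x y where "quadrilateral X v w x y"
proof -
  obtain v0 v1 v2 v3 where q: "quadrilateral X v0 v1 v2 v3"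
    using tile_some_quadrilateral[OF assms(1)] .
  have "v = v0 \<and> w = v1 \<or> v = v1 \<and> w = v0 \<or> v = v1 \<and> w = v2 \<or> v = v2 \<and> w = v1 \<or>
      v = v2 \<and> w = v3 \<or> v = v3 \<and> w = v2 \<or> v = v3 \<and> w = v0 \<or> v = v0 \<and> w = v3"
    using tile_edges[OF assms(1) q assms(2)] by (simp add: doubleton_eq_iff)
  then show ?thesis
    using that q quadrilateral_rotate quadrilateral_reflect by metis
qed

lemma quadrilateral_signs:
  assumes "X \<in> \<T>" "quadrilateral X v0 v1 v2 v3"
  shows "affine_eval (bisector G v0 v1) v0 > 0" "affine_eval (bisector G v0 v1) v1 < 0"
    "affine_eval (bisector G v0 v1) v2 < 0" "affine_eval (bisector G v0 v1) v3 > 0"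
    "affine_eval (bisector G v1 v2) v0 > 0" "affine_eval (bisector G v1 v2) v1 > 0"
    "affine_eval (bisector G v1 v2) v2 < 0" "affine_eval (bisector G v1 v2) v3 < 0"
proof -
  have pl: "v0 \<in> plane G" "v1 \<in> plane G" "v2 \<in> plane G" "v3 \<in> plane G"
    using quadrilateral_vertices[OF assms(2)] vertex_in_plane[OF assms(1)] by auto
  have d: "v0 \<noteq> v1" "v1 \<noteq> v2" "v2 \<noteq> v3" "v0 \<noteq> v3"
    using assms(2) by (auto simp: quadrilateral_def)
  have "square_walls v0 v1 v2 v3" using quadrilateral_walls[OF assms] .
  then have eq: "bisector G v0 v1 = bisector G v3 v2" "bisector G v1 v2 = bisector G v0 v3"
    by (simp_all add: square_walls_def)
  show "affine_eval (bisector G v0 v1) v0 > 0" "affine_eval (bisector G v0 v1) v1 < 0"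
    "affine_eval (bisector G v1 v2) v1 > 0" "affine_eval (bisector G v1 v2) v2 < 0"
    using bisector_pos bisector_neg pl d by auto
  show "affine_eval (bisector G v0 v1) v2 < 0" "affine_eval (bisector G v0 v1) v3 > 0"
    "affine_eval (bisector G v1 v2) v0 > 0" "affine_eval (bisector G v1 v2) v3 < 0"
    unfolding eq using bisector_pos bisector_neg pl d by auto
qed

lemma wall_quadrilateral:
  assumes "X \<in> \<T>" "wall X F"
  obtains v0 v1 v2 v3 where "quadrilateral X v0 v1 v2 v3" "F = bisector G v0 v1" "F = bisector G v3 v2"
proof -
  obtain v w where vw: "edge X v w" "F = bisector G v w" using assms(2) by (auto simp: wall_def)
  obtain x y where q: "quadrilateral X v w x y" using edge_quadrilateral[OF assms(1) vw(1)] .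
  show ?thesis
    using that[OF q vw(2)] quadrilateral_walls[OF assms(1) q] vw(2) by (simp add: square_walls_def)
qed

lemma wall_nonzero:
  assumes "X \<in> \<T>" "wall X F" "v extreme_point_of X"
  shows "affine_eval F v \<noteq> 0"
proof -
  obtain v0 v1 v2 v3 where q: "quadrilateral X v0 v1 v2 v3" "F = bisector G v0 v1"
    using wall_quadrilateral[OF assms(1,2)] by metis
  have "v \<in> {v0, v1, v2, v3}" using quadrilateral_vertices[OF q(1)] assms(3) by auto
  then show ?thesis using quadrilateral_signs[OF assms(1) q(1)] q(2) by auto
qed

lemma wall_at_vertex:
  assumes "X \<in> \<T>" "wall X F" "v extreme_point_of X" "affine_eval F v > 0"
  obtains w where "edge X v w" "F = bisector G v w"
proof -
  obtain v0 v1 v2 v3 where q: "quadrilateral X v0 v1 v2 v3" "F = bisector G v0 v1" "F = bisector G v3 v2"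
    using wall_quadrilateral[OF assms(1,2)] .
  have "v \<in> {v0, v1, v2, v3}" using quadrilateral_vertices[OF q(1)] assms(3) by auto
  then have "v = v0 \<or> v = v3"
    using quadrilateral_signs(2,3)[OF assms(1) q(1)] q(2) assms(4) by auto
  moreover have "edge X v0 v1" "edge X v3 v2"
    using q(1) by (auto simp: quadrilateral_def closed_segment_commute)
  ultimately show ?thesis using that q(2,3) by blast
qed

text \<open>The neighbor of \<open>v\<close> across a wall is determined by the wall, whatever the tile.\<close>

lemma wall_edge_at_vertex:
  assumes "X \<in> \<T>" "wall X (bisector G v w)" "v extreme_point_of X" "w \<in> plane G" "v \<noteq> w"
  shows "edge X v w"
proof -
  have v: "v \<in> plane G" using vertex_in_plane assms(1,3) .
  obtain w' where w': "edge X v w'" "bisector G v w = bisector G v w'"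
    using wall_at_vertex[OF assms(1-3) bisector_pos[OF v assms(4,5)]] .
  have "w' \<in> plane G" using edge_vertices(2)[OF w'(1)] vertex_in_plane assms(1) by blast
  then have "w = w'"
    using affine_lift_inj[of w G w'] assms(4) w'(2) by (simp add: bisector_def)
  then show ?thesis using w'(1) by simp
qed

lemma edge_sign_change_wall:
  assumes "X \<in> \<T>" "wall X F" "edge X v w" "affine_eval F v > 0" "affine_eval F w < 0"
  shows "F = bisector G v w"
proof -
  obtain v0 v1 v2 v3 where q: "quadrilateral X v0 v1 v2 v3" "F = bisector G v0 v1" "F = bisector G v3 v2"
    using wall_quadrilateral[OF assms(1,2)] .
  note s = quadrilateral_signs(1-4)[OF assms(1) q(1), folded q(2)]
  have "v = v0 \<and> w = v1 \<or> v = v3 \<and> w = v2"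
    using tile_edges[OF assms(1) q(1) assms(3)] s assms(4,5) by (auto simp: doubleton_eq_iff)
  then show ?thesis using q(2,3) by auto
qed

text \<open>The zero \<open>p\<close> is not a vertex, so the common face is an edge and
  \<open>F\<close> has opposite signs at its ends. Then \<open>F\<close> is the bisector of this
  edge up to sign, and the edge belongs to \<open>Y\<close> as well.\<close>

lemma wall_of_common_edge:
  assumes "X \<in> \<T>" "Y \<in> \<T>" "X \<noteq> Y" "wall X F" "p \<in> X" "p \<in> Y" "affine_eval F p = 0"
  shows "wall Y F"
proof -
  have "X \<inter> Y \<noteq> {}" using assms by auto
  then obtain v w where vw: "X \<inter> Y = closed_segment v w" "v extreme_point_of X" "w extreme_point_of X"
    using tiles_Int_segment[OF assms(1-3)] by metis
  have p: "p \<in> closed_segment v w" using assms(5,6) vw(1) by auto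
  then obtain t where t: "0 \<le> t" "t \<le> 1" "p = (1 - t) *\<^sub>R v + t *\<^sub>R w"
    by (auto simp: in_segment(1))
  have nz: "affine_eval F v \<noteq> 0" "affine_eval F w \<noteq> 0"
    using wall_nonzero[OF assms(1,4)] vw(2,3) by auto
  then have "v \<noteq> w" using p assms(7) by auto
  then have e: "edge X v w" "edge Y v w"
    using segment_Int_edge[OF assms(1-3) vw(1)] by auto
  have z: "(1 - t) * affine_eval F v + t * affine_eval F w = 0"
    using assms(7) t(3) affine_eval_convex by simp
  have "\<not> (affine_eval F v > 0 \<and> affine_eval F w > 0)"
  proof
    assume *: "affine_eval F v > 0 \<and> affine_eval F w > 0"
    then have "(1 - t) * affine_eval F v \<ge> 0" "t * affine_eval F w \<ge> 0" using t by auto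
    then have "(1 - t) * affine_eval F v = 0" "t * affine_eval F w = 0" using z by linarith+
    then show False using * by auto
  qed
  moreover have "\<not> (affine_eval F v < 0 \<and> affine_eval F w < 0)"
  proof
    assume *: "affine_eval F v < 0 \<and> affine_eval F w < 0"
    then have "(1 - t) * affine_eval F v \<le> 0" "t * affine_eval F w \<le> 0"
      using t by (auto simp: mult_nonneg_nonpos)
    then have "(1 - t) * affine_eval F v = 0" "t * affine_eval F w = 0" using z by linarith+
    then show False using * by auto
  qed
  ultimately consider "affine_eval F v > 0" "affine_eval F w < 0" | "affine_eval F w > 0" "affine_eval F v < 0"
    using nz by linarith
  then show ?thesis
  proof cases
    case 1
    from edge_sign_change_wall[OF assms(1,4) e(1) this] e(2) show ?thesis by (auto simp: wall_def)
  next
    case 2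
    from edge_sign_change_wall[OF assms(1,4) _ this] e edge_sym show ?thesis by (metis wall_def)
  qed
qed

section \<open>Local finiteness and the separation of tiles by walls\<close>

lemma local_finiteness:
  assumes "p \<in> plane G"
  obtains \<epsilon> where "\<epsilon> > 0" "ball p \<epsilon> \<subseteq> plane G" "\<And>X. \<lbrakk>X \<in> \<T>; X \<inter> ball p \<epsilon> \<noteq> {}\<rbrakk> \<Longrightarrow> p \<in> X"
proof -
  obtain e where e: "e > 0" "finite {X\<in>\<T>. X \<inter> ball p e \<noteq> {}}"
    using assms tiling unfolding tiling_of_plane_def by blast
  \<comment> \<open>Only finitely many closed tiles that miss \<open>p\<close> have to be cut out,
    so a neighborhood of \<open>p\<close> remains.\<close>
  define U where "U = plane G \<inter> ball p e - \<Union>{X\<in>\<T>. X \<inter> ball p e \<noteq> {} \<and> p \<notin> X}"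
  have "closed (\<Union>{X\<in>\<T>. X \<inter> ball p e \<noteq> {} \<and> p \<notin> X})"
    using e(2) tile_convex_compact by (intro closed_Union) (auto elim: rev_finite_subset)
  moreover have "open (plane G)" by (cases G) auto
  ultimately have "open U" unfolding U_def by (intro open_Diff open_Int) auto
  moreover have "p \<in> U" using assms e(1) by (auto simp: U_def)
  ultimately obtain d where d: "d > 0" "ball p d \<subseteq> U" by (meson open_contains_ball)
  show ?thesis
  proof (rule that[OF d(1)])
    show "ball p d \<subseteq> plane G" using d(2) by (auto simp: U_def)
    show "p \<in> X" if "X \<in> \<T>" "X \<inter> ball p d \<noteq> {}" for X
      using that d(2) by (auto simp: U_def)
  qed
qed

lemma closedin_Union_tiles:
  assumes "\<U> \<subseteq> \<T>" shows "closedin (top_of_set (plane G)) (\<Union>\<U>)"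
proof (rule closedin_locally_finite_Union)
  show "closedin (top_of_set (plane G)) X" if "X \<in> \<U>" for X
    using that assms tile_convex_compact tile_subset_plane by (meson closed_subset subsetD)
  show "locally_finite_in (top_of_set (plane G)) \<U>"
    unfolding locally_finite_in_def
  proof (intro conjI ballI)
    show "\<Union>\<U> \<subseteq> topspace (top_of_set (plane G))" using assms tile_subset_plane by auto
    fix p assume "p \<in> topspace (top_of_set (plane G))"
    then have p: "p \<in> plane G" by simp
    then obtain e where e: "e > 0" "finite {X\<in>\<T>. X \<inter> ball p e \<noteq> {}}"
      using tiling unfolding tiling_of_plane_def by blast
    have "{X\<in>\<U>. X \<inter> (plane G \<inter> ball p e) \<noteq> {}} \<subseteq> {X\<in>\<T>. X \<inter> ball p e \<noteq> {}}"
      using assms by auto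
    then have "finite {X\<in>\<U>. X \<inter> (plane G \<inter> ball p e) \<noteq> {}}"
      using e(2) by (rule finite_subset)
    moreover have "openin (top_of_set (plane G)) (plane G \<inter> ball p e)"
      by (simp add: openin_open_Int)
    ultimately show "\<exists>V. openin (top_of_set (plane G)) V \<and> p \<in> V \<and> finite {U \<in> \<U>. U \<inter> V \<noteq> {}}"
      using p e(1) by (intro exI[of _ "plane G \<inter> ball p e"]) auto
  qed
qed

text \<open>Otherwise \<open>\<U>\<close> and the remaining tiles would split \<open>C\<close> into
  two relatively closed sets. This is applied to a line and to a punctured disc around a
  vertex.\<close>

lemma connected_tiles:
  assumes "connected C" "C \<subseteq> plane G" "\<U> \<subseteq> \<T>" "X \<in> \<U>" "X \<inter> C \<noteq> {}"
    and sep: "\<And>X Y. \<lbrakk>X \<in> \<U>; Y \<in> \<T> - \<U>\<rbrakk> \<Longrightarrow> X \<inter> Y \<inter> C = {}"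
    and "Y \<in> \<T>" "Y \<inter> C \<noteq> {}"
  shows "Y \<in> \<U>"
proof (rule ccontr)
  assume Y: "Y \<notin> \<U>"
  have cl: "closedin (top_of_set C) (C \<inter> \<Union>\<V>)" if V: "\<V> \<subseteq> \<T>" for \<V>
  proof -
    obtain K where K: "closed K" "\<Union>\<V> = plane G \<inter> K"
      using closedin_Union_tiles[OF V] unfolding closedin_closed by blast
    have "C \<inter> \<Union>\<V> = C \<inter> K" using assms(2) K(2) by auto
    then show ?thesis using K(1) by (simp add: closedin_closed_Int)
  qed
  have "C \<subseteq> (C \<inter> \<Union>\<U>) \<union> (C \<inter> \<Union>(\<T> - \<U>))"
    using tiles_cover assms(2) by blast
  moreover have "(C \<inter> \<Union>\<U>) \<inter> (C \<inter> \<Union>(\<T> - \<U>)) = {}"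
    using sep by blast
  moreover have "C \<inter> \<Union>\<U> \<noteq> {}" "C \<inter> \<Union>(\<T> - \<U>) \<noteq> {}"
    using assms(4,5,7,8) Y by blast+
  ultimately show False
    using assms(1) cl[OF assms(3)] cl[of "\<T> - \<U>"] unfolding connected_closedin by blast
qed

text \<open>By \<open>wall_of_common_edge\<close> the property of having the wall \<open>F\<close>
  passes between tiles that meet on the line \<open>C\<close>. As \<open>C\<close> is connected,
  every tile that meets \<open>C\<close> has it.\<close>

lemma tile_sign:
  assumes "X0 \<in> \<T>" "wall X0 F" "Y \<in> \<T>" "\<not> wall Y F"
  shows "(\<forall>p\<in>Y. affine_eval F p > 0) \<or> (\<forall>p\<in>Y. affine_eval F p < 0)"
proof -
  define C where "C = {p \<in> plane G. affine_eval F p = 0}"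
  define \<U> where "\<U> = {X\<in>\<T>. wall X F}"
  have plane: "convex (plane G)" by (cases G) auto
  have "convex C"
    unfolding convex_alt
  proof (intro ballI allI impI)
    fix x y and t :: real assume *: "x \<in> C" "y \<in> C" "0 \<le> t \<and> t \<le> 1"
    then show "(1 - t) *\<^sub>R x + t *\<^sub>R y \<in> C"
      using plane unfolding convex_alt C_def by (auto simp: affine_eval_convex)
  qed
  then have conn: "connected C" by (rule convex_connected)
  have X0: "X0 \<inter> C \<noteq> {}"
  proof -
    obtain v0 v1 v2 v3 where q: "quadrilateral X0 v0 v1 v2 v3" "F = bisector G v0 v1"
      using wall_quadrilateral[OF assms(1,2)] by metis
    have "v0 \<in> X0" "v1 \<in> X0" using quadrilateral_vertices[OF q(1)] vertex_in_tile by auto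
    then obtain t where "(1 - t) *\<^sub>R v0 + t *\<^sub>R v1 \<in> X0" "affine_eval F ((1 - t) *\<^sub>R v0 + t *\<^sub>R v1) = 0"
      using affine_eval_between[OF tile_convex_compact(1)[OF assms(1)]] quadrilateral_signs(1,2)[OF assms(1) q(1)] q(2)
      by metis
    then show ?thesis using tile_subset_plane[OF assms(1)] by (auto simp: C_def)
  qed
  have "Y \<inter> C = {}"
  proof (rule ccontr)
    assume "Y \<inter> C \<noteq> {}"
    have "Y \<in> \<U>"
    proof (rule connected_tiles[OF conn _ _ _ X0 _ assms(3) \<open>Y \<inter> C \<noteq> {}\<close>])
      show "X \<inter> Z \<inter> C = {}" if "X \<in> \<U>" "Z \<in> \<T> - \<U>" for X Z
        using that wall_of_common_edge[of X Z F] by (auto simp: \<U>_def C_def)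
    qed (use assms in \<open>auto simp: C_def \<U>_def\<close>)
    then show False using assms(4) by (simp add: \<U>_def)
  qed
  then have nz: "affine_eval F p \<noteq> 0" if "p \<in> Y" for p
    using that tile_subset_plane[OF assms(3)] by (auto simp: C_def)
  show ?thesis
  proof (rule ccontr)
    assume "\<not> ?thesis"
    then obtain x y where "x \<in> Y" "y \<in> Y" "affine_eval F x > 0" "affine_eval F y < 0"
      using nz by (meson linorder_neqE_linordered_idom)
    from affine_eval_between[OF tile_convex_compact(1)[OF assms(3)] this] nz show False by metis
  qed
qed

lemma wall_if_sign_change:
  assumes "X0 \<in> \<T>" "wall X0 F" "Y \<in> \<T>" "x \<in> Y" "y \<in> Y" "affine_eval F x > 0" "affine_eval F y < 0"
  shows "wall Y F"
  using tile_sign[OF assms(1-3)] assms(4-7) by force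

lemma walls_cases:
  assumes "X \<in> \<T>" "quadrilateral X v0 v1 v2 v3" "wall X F"
  shows "F \<in> {bisector G v0 v1, - bisector G v0 v1, bisector G v1 v2, - bisector G v1 v2}"
proof -
  obtain v w where vw: "edge X v w" "F = bisector G v w" using assms(3) by (auto simp: wall_def)
  have "bisector G v0 v1 = bisector G v3 v2" "bisector G v1 v2 = bisector G v0 v3"
    using quadrilateral_walls[OF assms(1,2)] by (simp_all add: square_walls_def)
  moreover have "bisector G v1 v0 = - bisector G v0 v1" "bisector G v2 v1 = - bisector G v1 v2"
    "bisector G v2 v3 = - bisector G v3 v2" "bisector G v3 v0 = - bisector G v0 v3"
    by (rule bisector_swap)+
  ultimately show ?thesis
    using tile_edges[OF assms(1,2) vw(1)] vw(2) by (auto simp: doubleton_eq_iff)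
qed

text \<open>The signs at the four corners show that the two walls cross inside either tile, and
  lines cross only once. So the crossing point would lie on a common edge of \<open>X\<close> and
  \<open>Y\<close>.\<close>

lemma two_walls_tile_unique:
  assumes X: "X \<in> \<T>" "wall X F" "wall X H" and Y: "Y \<in> \<T>" "wall Y F" "wall Y H"
    and ne: "F \<noteq> H" "F \<noteq> - H"
  shows "X = Y"
proof (rule ccontr)
  assume "X \<noteq> Y"
  have rep: "\<exists>v0 v1 v2 v3 H'. quadrilateral Z v0 v1 v2 v3 \<and> F = bisector G v0 v1 \<and> H' = bisector G v1 v2 \<and> (H = H' \<or> H = - H')"
    if Z: "Z \<in> \<T>" "wall Z F" "wall Z H" for Z
  proof -
    obtain v0 v1 v2 v3 where q: "quadrilateral Z v0 v1 v2 v3" "F = bisector G v0 v1"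
      using wall_quadrilateral[OF Z(1,2)] by metis
    from walls_cases[OF Z(1) q(1) Z(3)] q ne show ?thesis by auto
  qed
  have zero: "\<exists>p\<in>Z. affine_eval F p = 0 \<and> affine_eval H p = 0" if Z: "Z \<in> \<T>" "wall Z F" "wall Z H" for Z
  proof -
    obtain v0 v1 v2 v3 H' where q: "quadrilateral Z v0 v1 v2 v3" "F = bisector G v0 v1" "H' = bisector G v1 v2"
      "H = H' \<or> H = - H'"
      using rep[OF Z] by blast
    have mem: "v0 \<in> Z" "v1 \<in> Z" "v2 \<in> Z" "v3 \<in> Z"
      using quadrilateral_vertices[OF q(1)] vertex_in_tile by auto
    have "\<exists>p\<in>Z. affine_eval F p = 0 \<and> affine_eval H' p = 0"
      using common_zero_if_all_quadrants[OF tile_convex_compact(1)[OF Z(1)] mem]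
        quadrilateral_signs[OF Z(1) q(1)] q(2,3) by blast
    then show ?thesis using q(4) by (auto simp: affine_eval_uminus)
  qed
  obtain p where p: "p \<in> X" "affine_eval F p = 0" "affine_eval H p = 0" using zero[OF X] by blast
  obtain p' where p': "p' \<in> Y" "affine_eval F p' = 0" "affine_eval H p' = 0" using zero[OF Y] by blast
  obtain v0 v1 v2 v3 H' where q: "quadrilateral X v0 v1 v2 v3" "F = bisector G v0 v1" "H' = bisector G v1 v2"
      "H = H' \<or> H = - H'"
    using rep[OF X] by blast
  note s = quadrilateral_signs[OF X(1) q(1), folded q(2,3)]
  have p0: "affine_eval H' p = 0" "affine_eval H' p' = 0"
    using p(3) p'(3) q(4) by (auto simp: affine_eval_uminus)
  have "p = p'"
  proof (rule ccontr)
    assume "p \<noteq> p'"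
    have "cross (fst F) (fst H') = 0"
      using two_common_zeros_parallel[OF p(2) p0(1) p'(2) p0(2) \<open>p \<noteq> p'\<close>] .
    from parallel_walls_contradiction[OF this p(2) p0(1) s(1,2,5,6)] show False .
  qed
  then have pY: "p \<in> Y" using p'(1) by simp
  then have "X \<inter> Y \<noteq> {}" using p(1) by auto
  then obtain v w where vw: "X \<inter> Y = closed_segment v w" "v extreme_point_of X" "w extreme_point_of X"
    using tiles_Int_segment[OF X(1) Y(1) \<open>X \<noteq> Y\<close>] by metis
  have "p \<in> closed_segment v w" using vw(1) p(1) pY by auto
  moreover have ends: "p \<noteq> v" "p \<noteq> w" using wall_nonzero[OF X(1,2)] vw(2,3) p(2) by auto
  ultimately obtain t where t: "0 < t" "t < 1" "p = (1 - t) *\<^sub>R v + t *\<^sub>R w"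
    by (metis closed_segment_eq_open in_segment(2) insert_iff Un_iff empty_iff)
  have "v \<noteq> w" using ends \<open>p \<in> closed_segment v w\<close> by auto
  then have e: "edge X v w" using segment_Int_edge[OF X(1) Y(1) \<open>X \<noteq> Y\<close> vw(1)] by auto
  have z: "(1 - t) * affine_eval F v + t * affine_eval F w = 0"
      "(1 - t) * affine_eval H' v + t * affine_eval H' w = 0"
    using p(2) p0(1) t(3) affine_eval_convex by simp_all
  have pos: "(1 - t) * x + t * y > 0" if "x > 0" "y > 0" for x y :: real
    using that t by (simp add: add_pos_pos)
  have neg: "(1 - t) * x + t * y < 0" if "x < 0" "y < 0" for x y :: real
    using that t by (simp add: add_neg_neg mult_pos_neg)
  \<comment> \<open>Along each edge one of the two walls keeps a strict sign.\<close>
  show False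
    using tile_edges[OF X(1) q(1) e] z s pos neg
    by (auto simp: doubleton_eq_iff) (metis less_irrefl)+
qed

end

section \<open>The star of a vertex\<close>

lemma cross_zero_parallel:
  assumes "cross d e = 0" "d \<noteq> 0"
  obtains \<beta> where "e = \<beta> *\<^sub>R d"
proof
  have "d \<bullet> d \<noteq> 0" using assms(2) by simp
  moreover have "(d \<bullet> d) * Re e = (e \<bullet> d) * Re d" "(d \<bullet> d) * Im e = (e \<bullet> d) * Im d"
    using assms(1) unfolding cross_def inner_complex_def by algebra+
  ultimately show "e = ((e \<bullet> d) / (d \<bullet> d)) *\<^sub>R d"
    by (simp add: complex_eq_iff field_simps)
qed

lemma cross_lin:
  "cross a (b + c) = cross a b + cross a c" "cross a (b - c) = cross a b - cross a c"
  "cross a (r *\<^sub>R b) = r * cross a b" "cross a a = 0" "cross (b - c) a = cross b a - cross c a"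
  by (simp_all add: cross_def algebra_simps)

lemma edge_ends_in: "edge X v w \<Longrightarrow> v \<in> X" "edge X v w \<Longrightarrow> w \<in> X"
  using edge_of_imp_subset by force+

context square_tiling
begin

section \<open>Oriented edges and the tiles on their two sides\<close>

definition left :: "complex set \<Rightarrow> complex \<Rightarrow> complex \<Rightarrow> bool" where
  "left X v w \<longleftrightarrow> edge X v w \<and> (\<forall>x\<in>X. cross (w - v) (x - v) \<ge> 0)"

lemma on_edge_line:
  assumes "X \<in> \<T>" "edge X v w" "x \<in> X" "cross (w - v) (x - v) = 0"
  shows "x \<in> closed_segment v w"
proof -
  have "w - v \<noteq> 0" using edge_distinct[OF assms(2)] by simp
  then obtain \<beta> where "x - v = \<beta> *\<^sub>R (w - v)" using cross_zero_parallel assms(4) by metis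
  then have "x = (1 - \<beta>) *\<^sub>R v + \<beta> *\<^sub>R w" by (simp add: algebra_simps)
  then have "x \<in> affine hull {v, w}" unfolding affine_hull_2 by force
  then have "x \<in> affine hull (closed_segment v w)" by (simp add: segment_convex_hull affine_hull_convex_hull)
  then show ?thesis
    using face_of_imp_eq_affine_Int[OF tile_convex_compact(1)[OF assms(1)], of "closed_segment v w"] assms(2,3)
    unfolding edge_of_def by blast
qed

text \<open>If the tile had points on both sides of the line, the segment between them would cross
  it within the edge, and the face property would put its ends on the edge.\<close>

lemma left_or_right:
  assumes "X \<in> \<T>" "edge X v w"
  shows "left X v w \<or> left X w v"
proof (rule ccontr)
  assume not: "\<not> ?thesis"
  have swap: "cross (v - w) (x - w) = - cross (w - v) (x - v)" for x
    by (simp add: cross_def algebra_simps)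
  obtain x y where xy: "x \<in> X" "y \<in> X" "cross (w - v) (x - v) < 0" "cross (w - v) (y - v) > 0"
    using not assms(2) edge_sym[of v w X] unfolding left_def swap
    by (metis closed_segment_commute neg_0_le_iff_le not_le)
  define t where "t = cross (w - v) (y - v) / (cross (w - v) (y - v) - cross (w - v) (x - v))"
  define z where "z = (1 - t) *\<^sub>R y + t *\<^sub>R x"
  have t: "0 < t" "t < 1" using xy by (simp_all add: t_def)
  have z_eq: "z - v = (1 - t) *\<^sub>R (y - v) + t *\<^sub>R (x - v)" by (simp add: z_def algebra_simps)
  have "cross (w - v) (z - v) = (1 - t) * cross (w - v) (y - v) + t * cross (w - v) (x - v)"
    unfolding z_eq by (simp only: cross_lin)
  also have "\<dots> = 0" using xy by (simp add: t_def field_simps)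
  finally have "cross (w - v) (z - v) = 0" .
  moreover have "z \<in> X"
    unfolding z_def using xy t tile_convex_compact(1)[OF assms(1)] by (intro convexD) auto
  ultimately have "z \<in> closed_segment v w" using on_edge_line assms by blast
  moreover have "z \<in> open_segment y x"
    using t xy(3,4) unfolding in_segment(2) z_def by auto
  ultimately have "x \<in> closed_segment v w"
    using face_ofD[of "closed_segment v w" X z y x] assms(2) xy by (auto simp: edge_of_def)
  then obtain s where "x = (1 - s) *\<^sub>R v + s *\<^sub>R w" by (auto simp: in_segment(1))
  then have "x - v = s *\<^sub>R (w - v)" by (simp add: algebra_simps)
  then have "cross (w - v) (x - v) = 0" by (simp add: cross_lin)
  then show False using xy by simp
qed

lemma left_interior_pos:
  assumes "X \<in> \<T>" "left X v w" "x \<in> interior X"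
  shows "cross (w - v) (x - v) > 0"
proof (rule ccontr)
  assume "\<not> ?thesis"
  then have "cross (w - v) (x - v) = 0"
    using assms interior_subset[of X] unfolding left_def by force
  then have "x \<in> closed_segment v w"
    using on_edge_line assms interior_subset[of X] unfolding left_def by blast
  moreover have e: "closed_segment v w face_of X" "aff_dim (closed_segment v w) = 1"
    using assms(2) by (auto simp: left_def edge_of_def)
  have "closed_segment v w \<noteq> X" using e(2) tile_aff_dim[OF assms(1)] by auto
  ultimately show False using face_of_disjoint_interior[OF e(1)] assms(3) by blast
qed

text \<open>Otherwise the midpoint of the edge would have interior points of one tile in the other.\<close>

lemma left_unique:
  assumes X: "X \<in> \<T>" "left X v w" and Y: "Y \<in> \<T>" "left Y v w"
  shows "X = Y"
proof (rule ccontr)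
  assume "X \<noteq> Y"
  obtain x y where xy: "x \<in> interior X" "y \<in> interior Y"
    using tile_interior X(1) Y(1) by blast
  define m where "m = (1/2) *\<^sub>R v + (1/2) *\<^sub>R w"
  define \<alpha> where "\<alpha> = cross (w - v) (x - v) / cross (w - v) (y - v)"
  have lpos: "cross (w - v) (x - v) > 0" "cross (w - v) (y - v) > 0"
    using left_interior_pos X Y xy by blast+
  then have \<alpha>: "\<alpha> > 0" by (simp add: \<alpha>_def)
  have mv: "m - v = (1/2) *\<^sub>R (w - v)" by (simp add: m_def complex_eq_iff field_simps)
  have x_eq: "x - m - \<alpha> *\<^sub>R (y - m) = (x - v) - (m - v) - \<alpha> *\<^sub>R ((y - v) - (m - v))" by simp
  have "cross (w - v) (x - m - \<alpha> *\<^sub>R (y - m)) = cross (w - v) (x - v) - \<alpha> * cross (w - v) (y - v)"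
    unfolding x_eq mv by (simp only: cross_lin(1-4) mult_zero_right diff_0_right)
  also have "\<dots> = 0" using lpos by (simp add: \<alpha>_def)
  finally have "cross (w - v) (x - m - \<alpha> *\<^sub>R (y - m)) = 0" .
  moreover have "w - v \<noteq> 0" using X(2) edge_distinct by (auto simp: left_def)
  ultimately obtain \<beta> where \<beta>: "x - m - \<alpha> *\<^sub>R (y - m) = \<beta> *\<^sub>R (w - v)"
    using cross_zero_parallel by metis
  define t where "t = 1 / (2 + 2 * \<alpha> + 4 * \<bar>\<beta>\<bar>)"
  have den: "2 + 2 * \<alpha> + 4 * \<bar>\<beta>\<bar> > 0" using \<alpha> by (simp add: add_pos_nonneg)
  have t: "0 < t" "t \<le> 1" "t * \<alpha> \<le> 1/2" "t * \<bar>\<beta>\<bar> \<le> 1/4"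
    using \<alpha> den by (simp_all add: t_def divide_simps)
  have "\<bar>t * \<beta>\<bar> \<le> 1/4"
    using t(1,4) by (simp add: abs_mult)
  then have t\<beta>: "- (1/4) \<le> t * \<beta>" "t * \<beta> \<le> 1/4"
    by linarith+
  define p where "p = m - t *\<^sub>R (m - x)"
  have mX: "m \<in> X"
    using X tile_convex_compact(1)[OF X(1)] edge_ends_in[of v w X] unfolding m_def left_def
    by (intro convexD) auto
  have "p \<in> interior X"
    unfolding p_def using mem_interior_convex_shrink[OF tile_convex_compact(1)[OF X(1)] xy(1) mX t(1,2)] .
  have "p = m + t *\<^sub>R (\<alpha> *\<^sub>R (y - m) + \<beta> *\<^sub>R (w - v))"
    unfolding p_def \<beta>[symmetric] by (simp add: algebra_simps)
  also have "\<dots> = (t * \<alpha>) *\<^sub>R y + ((1 - t * \<alpha>) / 2 - t * \<beta>) *\<^sub>R v + ((1 - t * \<alpha>) / 2 + t * \<beta>) *\<^sub>R w"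
    unfolding m_def by (simp add: complex_eq_iff field_simps)
  also have "\<dots> \<in> Y"
  proof (rule convex_hull_3_mem[OF tile_convex_compact(1)[OF Y(1)]])
    show "{y, v, w} \<subseteq> Y"
      using Y(2) edge_ends_in[of v w Y] xy(2) interior_subset[of Y] by (auto simp: left_def)
  qed (use t t\<beta> \<alpha> in \<open>auto simp: field_simps\<close>)
  finally show False
    using interior_tile_Int[OF X(1) Y(1) \<open>X \<noteq> Y\<close>] \<open>p \<in> interior X\<close> by blast
qed

lemma left_asym:
  assumes "X \<in> \<T>" "left X v w" shows "\<not> left X w v"
proof
  assume *: "left X w v"
  obtain x where x: "x \<in> interior X" using tile_interior assms(1) by blast
  have "cross (v - w) (x - w) = - cross (w - v) (x - v)"
    by (simp add: cross_def algebra_simps)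
  then show False
    using left_interior_pos[OF assms x] left_interior_pos[OF assms(1) * x] by simp
qed

text \<open>Near the midpoint of the edge there are points outside \<open>X\<close>. A tile covering
  one of them contains the midpoint by local finiteness, and then the whole edge since the
  intersection is a face.\<close>

lemma edge_two_tiles:
  assumes "X \<in> \<T>" "left X w v"
  obtains Y where "Y \<in> \<T>" "left Y v w"
proof -
  have e: "edge X v w" using assms(2) by (simp add: left_def closed_segment_commute)
  have vw: "v \<noteq> w" using edge_distinct[OF e] .
  define m where "m = (1/2) *\<^sub>R v + (1/2) *\<^sub>R w"
  have m: "m \<in> open_segment v w"
    using vw unfolding in_segment(2) m_def by (intro conjI exI[of _ "1/2"]) auto
  then have mX: "m \<in> closed_segment v w" "m \<in> X"
    using edge_of_imp_subset[OF e] by (auto simp: open_segment_def)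
  then obtain \<epsilon> where \<epsilon>: "\<epsilon> > 0" "ball m \<epsilon> \<subseteq> plane G"
    "\<And>X. \<lbrakk>X \<in> \<T>; X \<inter> ball m \<epsilon> \<noteq> {}\<rbrakk> \<Longrightarrow> m \<in> X"
    using local_finiteness tile_subset_plane[OF assms(1)] by (metis subsetD)
  have f: "closed_segment v w face_of X" "closed_segment v w \<noteq> X"
    using e tile_aff_dim[OF assms(1)] by (auto simp: edge_of_def)
  have "m \<notin> interior X" using face_of_disjoint_interior[OF f] mX by blast
  then have "\<not> ball m \<epsilon> \<subseteq> X" using \<epsilon>(1) by (meson mem_interior)
  then obtain z where z: "z \<in> ball m \<epsilon>" "z \<notin> X" by blast
  then obtain Y where Y: "Y \<in> \<T>" "z \<in> Y" using tiles_cover \<epsilon>(2) by blast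
  then have "m \<in> Y" "X \<noteq> Y" using \<epsilon>(3)[OF Y(1)] z by blast+
  then have "v \<in> X \<inter> Y" "w \<in> X \<inter> Y"
    using face_ofD[OF tiles_Int_face(1)[OF assms(1) Y(1)] m] mX edge_vertices[OF e] vertex_in_tile by auto
  then have "edge Y v w"
    using common_vertices_edge[OF assms(1) Y(1) \<open>X \<noteq> Y\<close> vw] edge_vertices[OF e] by auto
  then have "left Y v w"
    using left_or_right[OF Y(1)] left_unique[OF assms Y(1)] \<open>X \<noteq> Y\<close> by blast
  then show ?thesis using that Y(1) by blast
qed

text \<open>A walk around the tile with the tile on its left enters \<open>v0\<close> by one of its
  two edges and leaves it by the other.\<close>

lemma quadrilateral_left:
  assumes "X \<in> \<T>" "quadrilateral X v0 v1 v2 v3"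
  shows "(left X v0 v1 \<and> left X v3 v0) \<or> (left X v1 v0 \<and> left X v0 v3)"
proof -
  have e: "edge X v0 v1" "edge X v3 v0" using assms(2) by (auto simp: quadrilateral_def)
  have mem: "v1 \<in> X" "v3 \<in> X" "v3 extreme_point_of X"
    using edge_vertices[OF e(1)] edge_vertices[OF e(2)] vertex_in_tile by auto
  have "cross (v1 - v0) (v3 - v0) \<noteq> 0"
  proof
    assume "cross (v1 - v0) (v3 - v0) = 0"
    then have "v3 \<in> closed_segment v0 v1" using on_edge_line[OF assms(1) e(1)] mem by blast
    then have "v3 extreme_point_of closed_segment v0 v1"
      using extreme_point_of_face e(1) mem(3) by (auto simp: edge_of_def)
    then show False using assms(2) by (auto simp: extreme_point_of_segment quadrilateral_def)
  qed
  moreover have "cross (v3 - v0) (v1 - v0) = - cross (v1 - v0) (v3 - v0)"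
    "cross (v0 - v1) (v3 - v1) = - cross (v1 - v0) (v3 - v0)"
    "cross (v0 - v3) (v1 - v3) = cross (v1 - v0) (v3 - v0)"
    by (simp_all add: cross_def algebra_simps)
  ultimately have "\<not> (left X v0 v1 \<and> left X v0 v3)" "\<not> (left X v1 v0 \<and> left X v3 v0)"
    using mem unfolding left_def by fastforce+
  then show ?thesis
    using left_or_right[OF assms(1) e(1)] left_or_right[OF assms(1) e(2)] by blast
qed

lemma vertex_quadrilateral:
  assumes "X \<in> \<T>" "v extreme_point_of X"
  obtains x y z where "quadrilateral X v x y z"
proof -
  obtain v0 v1 v2 v3 where q: "quadrilateral X v0 v1 v2 v3"
    using tile_some_quadrilateral[OF assms(1)] .
  have "v = v0 \<or> v = v1 \<or> v = v2 \<or> v = v3" using quadrilateral_vertices[OF q] assms(2) by auto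
  then show ?thesis using that q quadrilateral_rotate by metis
qed

lemma ex1_left_from:
  assumes "X \<in> \<T>" "v extreme_point_of X"
  shows "\<exists>!w. left X v w" "\<exists>!w. left X w v"
proof -
  obtain x y z where q: "quadrilateral X v x y z" using vertex_quadrilateral[OF assms] .
  have neighbors: "w = x \<or> w = z" if "edge X v w" for w
    using tile_edges[OF assms(1) q that] q by (auto simp: doubleton_eq_iff quadrilateral_def)
  then have "w = x \<or> w = z" if "left X v w \<or> left X w v" for w
    using that neighbors[of w] unfolding left_def by (metis closed_segment_commute)
  then show "\<exists>!w. left X v w" "\<exists>!w. left X w v"
    using quadrilateral_left[OF assms(1) q] left_asym[OF assms(1)] by metis+
qed


section \<open>The cyclic order of the tiles at a vertex\<close>

definition star :: "complex \<Rightarrow> complex set set" where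
  "star v = {X\<in>\<T>. v extreme_point_of X}"

lemma star_adjacent_oriented:
  assumes "X \<in> star v" "Y \<in> star v" "adjacent X Y"
  shows "\<exists>w. left X w v \<and> left Y v w \<or> left Y w v \<and> left X v w"
proof -
  have X: "X \<in> \<T>" "v extreme_point_of X" and Y: "Y \<in> \<T>" "v extreme_point_of Y"
    using assms by (auto simp: star_def)
  obtain a b where ab: "X \<inter> Y = closed_segment a b" "edge X a b" "edge Y a b"
    using adjacent_common_edge[OF X(1) Y(1) assms(3)] .
  have "X \<noteq> Y" using assms(3) by (simp add: adjacent_def)
  have "v \<in> closed_segment a b" using ab(1) X Y vertex_in_tile by blast
  then have "v extreme_point_of closed_segment a b"
    using extreme_point_of_face ab(2) X(2) by (auto simp: edge_of_def)
  then have "v = a \<or> v = b" by (simp add: extreme_point_of_segment)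
  then obtain w where w: "edge X v w" "edge Y v w"
    using ab closed_segment_commute by metis
  have "edge X w v" "edge Y w v" using w by (simp_all add: closed_segment_commute)
  then show ?thesis
    using left_or_right[OF X(1) w(1)] left_or_right[OF Y(1) w(2)]
      left_unique[OF X(1) _ Y(1)] \<open>X \<noteq> Y\<close> by metis
qed

lemma star_common_point_adjacent:
  assumes "X \<in> star v" "Y \<in> star v" "X \<noteq> Y" "p \<in> X \<inter> Y" "p \<noteq> v"
  shows "adjacent X Y"
proof -
  have X: "X \<in> \<T>" "v extreme_point_of X" and Y: "Y \<in> \<T>" "v extreme_point_of Y"
    using assms by (auto simp: star_def)
  obtain a b where ab: "X \<inter> Y = closed_segment a b"
    using tiles_Int_segment[OF X(1) Y(1) assms(3)] assms(4) by (metis empty_iff)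
  have "a \<noteq> b"
    using ab assms(4,5) X(2) Y(2) vertex_in_tile by (metis IntI closed_segment_idem singletonD)
  then show ?thesis
    using segment_Int_edge[OF X(1) Y(1) assms(3) ab] assms(3) by (auto simp: adjacent_def)
qed

text \<open>A small punctured disc around \<open>v\<close> is connected and meets only tiles of the
  star, and two of these that meet away from \<open>v\<close> share an edge.\<close>

lemma star_connected:
  assumes "X \<in> \<U>" "\<U> \<subseteq> star v" "Y \<in> star v"
    and closed: "\<And>X Y. \<lbrakk>X \<in> \<U>; Y \<in> star v; adjacent X Y\<rbrakk> \<Longrightarrow> Y \<in> \<U>"
  shows "Y \<in> \<U>"
proof -
  have "v \<in> plane G" using assms(3) vertex_in_plane by (auto simp: star_def)
  then obtain \<epsilon> where \<epsilon>: "\<epsilon> > 0" "ball v \<epsilon> \<subseteq> plane G"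
    "\<And>X. \<lbrakk>X \<in> \<T>; X \<inter> ball v \<epsilon> \<noteq> {}\<rbrakk> \<Longrightarrow> v \<in> X"
    using local_finiteness by metis
  define C where "C = ball v \<epsilon> - {v}"
  have meets: "Z \<inter> C \<noteq> {}" if "Z \<in> star v" for Z
  proof -
    have Z: "Z \<in> \<T>" "v extreme_point_of Z" using that by (auto simp: star_def)
    obtain w where "left Z v w" using ex1_left_from(1)[OF Z] by auto
    then have "edge Z v w" by (simp add: left_def)
    then have w: "w \<in> Z" "v \<noteq> w" "v \<in> Z"
      using edge_vertices edge_distinct vertex_in_tile by blast+
    define r where "r = min 1 (\<epsilon> / (2 * dist v w))"
    have r: "0 < r" "r \<le> 1" "r * dist v w < \<epsilon>"
    proof -
      show "0 < r" "r \<le> 1" using \<epsilon>(1) w(2) by (simp_all add: r_def)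
      have "r * dist v w \<le> \<epsilon> / (2 * dist v w) * dist v w"
        by (intro mult_right_mono) (simp_all add: r_def)
      also have "\<dots> = \<epsilon> / 2" using w(2) by simp
      finally show "r * dist v w < \<epsilon>" using \<epsilon>(1) by simp
    qed
    define z where "z = (1 - r) *\<^sub>R v + r *\<^sub>R w"
    have zv: "z - v = r *\<^sub>R (w - v)" by (simp add: z_def algebra_simps)
    have "dist v z = r * dist v w"
    proof -
      have "dist v z = norm (z - v)" by (simp add: dist_norm norm_minus_commute)
      also have "\<dots> = r * norm (w - v)" unfolding zv using r(1) by simp
      finally show ?thesis by (simp add: dist_norm norm_minus_commute)
    qed
    moreover have "z \<noteq> v" using zv r(1) w(2) by auto
    moreover have "z \<in> Z"
      unfolding z_def using tile_convex_compact(1)[OF Z(1)] w r by (intro convexD) auto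
    ultimately show ?thesis using r(3) by (auto simp: C_def)
  qed
  show ?thesis
  proof (rule connected_tiles[of C])
    show "connected C" unfolding C_def by (rule connected_punctured_ball) simp
    show "C \<subseteq> plane G" using \<epsilon>(2) by (auto simp: C_def)
    show "\<U> \<subseteq> \<T>" using assms(2) by (auto simp: star_def)
    show "X \<in> \<U>" by fact
    show "X \<inter> C \<noteq> {}" "Y \<inter> C \<noteq> {}" using meets assms(1-3) by blast+
    show "Y \<in> \<T>" using assms(3) by (simp add: star_def)
    fix X' Y' assume *: "X' \<in> \<U>" "Y' \<in> \<T> - \<U>"
    show "X' \<inter> Y' \<inter> C = {}"
    proof (rule ccontr)
      assume "X' \<inter> Y' \<inter> C \<noteq> {}"
      then obtain p where p: "p \<in> X' \<inter> Y'" "p \<noteq> v" "p \<in> ball v \<epsilon>"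
        unfolding C_def by blast
      have X': "X' \<in> star v" using * assms(2) by auto
      have "v \<in> Y'" using \<epsilon>(3)[of Y'] p * by blast
      then have Y': "Y' \<in> star v"
        using vertex_of_tile[of X' Y' v] X' * by (auto simp: star_def)
      show False
        using closed[OF *(1) Y'] star_common_point_adjacent[OF X' Y' _ p(1,2)] * by blast
    qed
  qed
qed

text \<open>The rotation about \<open>v\<close> by one tile, across the edge that enters
  \<open>v\<close>. Outside the star it is the identity, as \<open>permutes\<close> demands.\<close>

definition turn :: "complex \<Rightarrow> complex set \<Rightarrow> complex set" where
  "turn v X = (if X \<in> star v then THE Y. Y \<in> \<T> \<and> (\<exists>w. left X w v \<and> left Y v w) else X)"

lemma turn_eqI:
  assumes "X \<in> star v" "Y \<in> \<T>" "left X w v" "left Y v w"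
  shows "turn v X = Y"
proof -
  have X: "X \<in> \<T>" "v extreme_point_of X" using assms(1) by (auto simp: star_def)
  have "Z = Y" if "Z \<in> \<T>" "left X w' v" "left Z v w'" for Z w'
  proof -
    have "w' = w" using ex1_left_from(2)[OF X] that(2) assms(3) by blast
    then show ?thesis using left_unique[OF that(1) _ assms(2,4)] that(3) by blast
  qed
  then have "(THE Z. Z \<in> \<T> \<and> (\<exists>w. left X w v \<and> left Z v w)) = Y"
    using assms by (intro the_equality) blast+
  then show ?thesis using assms(1) by (simp add: turn_def)
qed

lemma turnE:
  assumes "X \<in> star v"
  obtains w where "turn v X \<in> star v" "left X w v" "left (turn v X) v w"
proof -
  have X: "X \<in> \<T>" "v extreme_point_of X" using assms(1) by (auto simp: star_def)
  obtain w where w: "left X w v" using ex1_left_from(2)[OF X] by auto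
  obtain Y where Y: "Y \<in> \<T>" "left Y v w" using edge_two_tiles[OF X(1) w] .
  have "v extreme_point_of Y" using Y(2) edge_vertices by (auto simp: left_def)
  then show ?thesis using that turn_eqI[OF assms Y(1) w Y(2)] Y w by (auto simp: star_def)
qed

lemma turn_neq:
  assumes "X \<in> star v" shows "turn v X \<noteq> X"
proof
  assume "turn v X = X"
  then obtain w where "left X w v" "left X v w" using turnE[OF assms] by metis
  then show False using left_asym assms by (auto simp: star_def)
qed

lemma star_adjacent_iff:
  assumes "X \<in> star v" "Y \<in> star v"
  shows "adjacent X Y \<longleftrightarrow> Y = turn v X \<or> X = turn v Y"
proof
  assume "adjacent X Y"
  from star_adjacent_oriented[OF assms this] show "Y = turn v X \<or> X = turn v Y"
    using turn_eqI assms by (auto simp: star_def)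
next
  have *: "adjacent X (turn v X)" if X: "X \<in> star v" for X
  proof -
    obtain w where "left X w v" "left (turn v X) v w" using turnE[OF X] .
    then have "closed_segment v w edge_of X" "closed_segment v w edge_of turn v X"
      by (auto simp: left_def closed_segment_commute)
    then show ?thesis using turn_neq[OF X] by (auto simp: adjacent_def)
  qed
  assume "Y = turn v X \<or> X = turn v Y"
  then show "adjacent X Y" using * assms adjacent_sym by metis
qed

lemma turn_permutes:
  assumes "finite (star v)" shows "turn v permutes star v"
proof (rule bij_imp_permutes)
  have "inj_on (turn v) (star v)"
  proof (rule inj_onI)
    fix X Y assume *: "X \<in> star v" "Y \<in> star v" "turn v X = turn v Y"
    obtain w where w: "left X w v" "left (turn v X) v w" "turn v X \<in> star v" using turnE[OF *(1)] .
    obtain w' where w': "left Y w' v" "left (turn v Y) v w'" using turnE[OF *(2)] .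
    have "w = w'" using ex1_left_from(1)[of "turn v X" v] w w' *(3) by (auto simp: star_def)
    then show "X = Y" using left_unique[of X w v Y] w w' * by (auto simp: star_def)
  qed
  moreover have "turn v ` star v \<subseteq> star v" using turnE by blast
  ultimately show "bij_betw (turn v) (star v) (star v)"
    using assms by (simp add: bij_betw_def endo_inj_surj)
  show "turn v X = X" if "X \<notin> star v" for X using that by (simp add: turn_def)
qed

text \<open>Adjacent tiles of the star differ by one turn forwards or backwards, and the orbit of a
  permutation of a finite set is closed under both.\<close>

lemma star_orbit:
  assumes "finite (star v)" "X \<in> star v"
  shows "orbit (turn v) X = star v"
proof
  have perm: "turn v permutes star v" using turn_permutes[OF assms(1)] .
  then have perm': "permutation (turn v)" using assms(1) by (auto simp: permutation_permutes)
  show sub: "orbit (turn v) X \<subseteq> star v"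
    using permutes_orbit_subset[OF perm assms(2)] .
  have X: "X \<in> orbit (turn v) X" using permutation_self_in_orbit[OF perm'] .
  show "star v \<subseteq> orbit (turn v) X"
  proof
    fix Y assume Y: "Y \<in> star v"
    show "Y \<in> orbit (turn v) X"
    proof (rule star_connected[OF X sub Y])
      fix A B assume *: "A \<in> orbit (turn v) X" "B \<in> star v" "adjacent A B"
      then consider "B = turn v A" | "A = turn v B" using star_adjacent_iff[of A v B] sub by auto
      then show "B \<in> orbit (turn v) X"
      proof cases
        case 1
        then show ?thesis using *(1) by (simp add: orbit.step)
      next
        case 2
        have "B \<in> orbit (turn v) (turn v B)"
          using permutation_self_in_orbit[OF perm'] permutation_orbit_step[OF perm'] by simp
        then show ?thesis using *(1) 2 orbit_trans by metis
      qed
    qed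
  qed
qed

lemma star_cyclic_turn:
  assumes "card (star v) = q" "q \<ge> 1" "X \<in> star v"
  shows "bij_betw (\<lambda>k. (turn v ^^ k) X) {..<q} (star v)" "(turn v ^^ q) X = X"
proof -
  have fin: "finite (star v)" using assms by (simp add: card_ge_0_finite)
  define n where "n = funpow_dist1 (turn v) X X"
  have orb: "orbit (turn v) X = star v" using star_orbit[OF fin assms(3)] .
  then have self: "X \<in> orbit (turn v) X" using assms(3) by simp
  have inj: "inj_on (\<lambda>k. (turn v ^^ k) X) {0..<n}" unfolding n_def using inj_on_funpow_dist1[OF self] .
  have img: "star v = (\<lambda>k. (turn v ^^ k) X) ` {0..<n}"
    using orbit_conv_funpow_dist1[OF self] orb by (simp add: n_def)
  have "card (star v) = n" unfolding img using inj by (simp add: card_image)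
  then have n: "n = q" using assms(1) by simp
  show "bij_betw (\<lambda>k. (turn v ^^ k) X) {..<q} (star v)"
    using inj img n by (simp add: bij_betw_def lessThan_atLeast0)
  show "(turn v ^^ q) X = X" using funpow_dist1_prop[OF self] unfolding n_def[symmetric] n .
qed

text \<open>Adjacency makes \<open>Y\<close> either the last or the second tile of the rotation that
  starts at \<open>X\<close>; in the latter case the cycle is run backwards.\<close>

lemma star_cycle:
  assumes q: "card (star v) = q" "q \<ge> 3" and XY: "X \<in> star v" "Y \<in> star v" "adjacent X Y"
  obtains Z where "Z 0 = X" "Z (q - 1) = Y" "bij_betw Z {..<q} (star v)"
    "\<And>j k. \<lbrakk>j < k; k < q\<rbrakk> \<Longrightarrow> adjacent (Z j) (Z k) \<longleftrightarrow> k = j + 1 \<or> j = 0 \<and> k = q - 1"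
proof -
  define P where "P k = (turn v ^^ k) X" for k
  have bij: "bij_betw P {..<q} (star v)" and Pq: "P q = X"
    using star_cyclic_turn[OF q(1) _ XY(1)] q(2) unfolding P_def by simp_all
  have P0: "P 0 = X" by (simp add: P_def)
  have PSuc: "P (Suc k) = turn v (P k)" for k by (simp add: P_def)
  have mem: "P k \<in> star v" if "k \<le> q" for k
    using that bij_betwE[OF bij] Pq XY(1) by (cases "k = q") auto
  have inj: "P j = P k \<longleftrightarrow> j = k" if "j < q" "k < q" for j k
    using bij that by (auto simp: bij_betw_def inj_on_def)
  have turn_iff: "P k = turn v (P j) \<longleftrightarrow> k = j + 1 \<or> j = q - 1 \<and> k = 0" if "j < q" "k < q" for j k
  proof (cases "j = q - 1")
    case True
    then have "turn v (P j) = P 0" using PSuc[of j] q(2) Pq P0 by simp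
    then show ?thesis using inj[of k 0] that True by auto
  next
    case False
    then show ?thesis using inj[of k "Suc j"] that PSuc[of j] by auto
  qed
  have adj: "adjacent (P j) (P k) \<longleftrightarrow> k = j + 1 \<or> j = 0 \<and> k = q - 1" if "j < k" "k < q" for j k
    using star_adjacent_iff[OF mem mem, of j k] turn_iff[of j k] turn_iff[of k j] that by auto
  consider "X = turn v Y" | "Y = turn v X" using star_adjacent_iff[OF XY(1,2)] XY(3) by auto
  then show ?thesis
  proof cases
    case 1
    have "Y \<in> P ` {..<q}" using bij_betw_imp_surj_on[OF bij] XY(2) by simp
    then obtain k where k: "k < q" "P k = Y" by blast
    then have "k = q - 1" using turn_iff[of k 0] 1 P0 q(2) by simp
    then show ?thesis using that[of P] P0 k bij adj by blast
  next
    case 2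
    \<comment> \<open>The \<open>mod\<close> only matters at \<open>k = 0\<close>, where it keeps
      the index below \<open>q\<close>.\<close>
    define Z where "Z k = P ((q - k) mod q)" for k
    have Z0: "Z 0 = X" by (simp add: Z_def P0)
    have Zq: "Z (q - 1) = Y" using q(2) 2 PSuc[of 0] P0 by (simp add: Z_def)
    have ZP: "Z k = P (q - k)" if "0 < k" for k
      using that q(2) by (cases "k \<ge> q") (simp_all add: Z_def P0)
    have "bij_betw (\<lambda>k. (q - k) mod q) {..<q} {..<q}"
    proof (rule bij_betw_byWitness[where f' = "\<lambda>k. (q - k) mod q"])
      have "(q - (q - k) mod q) mod q = k" if "k < q" for k
        using that by (cases "k = 0") auto
      then show "\<forall>k\<in>{..<q}. (q - (q - k) mod q) mod q = k" "\<forall>k\<in>{..<q}. (q - (q - k) mod q) mod q = k"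
        by auto
    qed (use q(2) in auto)
    from bij_betw_trans[OF this bij] have bijZ: "bij_betw Z {..<q} (star v)"
      by (simp add: Z_def[abs_def] comp_def)
    have "adjacent (Z j) (Z k) \<longleftrightarrow> k = j + 1 \<or> j = 0 \<and> k = q - 1" if "j < k" "k < q" for j k
    proof (cases "j = 0")
      case True
      then have "adjacent (Z j) (Z k) \<longleftrightarrow> adjacent (P 0) (P (q - k))"
        using ZP[of k] that Z0 P0 by simp
      also have "\<dots> \<longleftrightarrow> q - k = 1 \<or> q - k = q - 1"
        using adj[of 0 "q - k"] that True by simp
      finally show ?thesis using that True by auto
    next
      case False
      then have "adjacent (Z j) (Z k) \<longleftrightarrow> adjacent (P (q - k)) (P (q - j))"
        using ZP[of k] ZP[of j] that adjacent_sym by simp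
      also have "\<dots> \<longleftrightarrow> q - j = q - k + 1 \<or> q - k = 0 \<and> q - j = q - 1"
        using adj[of "q - k" "q - j"] that False by simp
      finally show ?thesis using that False by auto
    qed
    then show ?thesis using that[of Z] Z0 Zq bijZ by blast
  qed
qed

end

section \<open>The strip and the second level\<close>

lemma (in square_tiling) third_tile_on_edge:
  assumes "X \<in> \<T>" "Y \<in> \<T>" "Z \<in> \<T>" "edge X v w" "edge Y v w" "edge Z v w" "X \<noteq> Y"
  shows "Z = X \<or> Z = Y"
  using assms left_or_right left_unique by metis

lemma (in square_tiling) other_tile_on_edge:
  assumes "X \<in> \<T>" "edge X v w"
  obtains Y where "Y \<in> \<T>" "Y \<noteq> X" "edge Y v w"
proof -
  consider "left X v w" | "left X w v" using left_or_right[OF assms] by blast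
  then show ?thesis
  proof cases
    case 1
    obtain Y where Y: "Y \<in> \<T>" "left Y w v" using edge_two_tiles[OF assms(1) 1] .
    then have "Y \<noteq> X" using left_asym[OF assms(1) 1] by auto
    then show ?thesis using that Y by (simp add: left_def closed_segment_commute)
  next
    case 2
    obtain Y where Y: "Y \<in> \<T>" "left Y v w" using edge_two_tiles[OF assms(1) 2] .
    then have "Y \<noteq> X" using left_asym[OF assms(1) 2] by auto
    then show ?thesis using that Y by (simp add: left_def)
  qed
qed

locale mosaic_strip = square_tiling +
  fixes q :: nat and A B :: "nat \<Rightarrow> complex" and S :: "nat \<Rightarrow> complex set"
  assumes q_ge_4: "q \<ge> 4"
    and degree: "\<lbrakk>X \<in> \<T>; v extreme_point_of X\<rbrakk> \<Longrightarrow> card {X\<in>\<T>. v extreme_point_of X} = q"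
    and strip: "square_strip \<T> A B S"
begin

lemma S_tile: "S (Suc i) \<in> \<T>"
  and S_quad: "quadrilateral (S (Suc i)) (A i) (A (Suc i)) (B (Suc i)) (B i)"
  and S_Suc_neq: "S (Suc (Suc i)) \<noteq> S (Suc i)"
  using strip unfolding square_strip_def by (auto dest: spec[of _ "Suc i"])

lemma S_vertices: "vertices (S (Suc i)) = {A i, A (Suc i), B (Suc i), B i}"
  using quadrilateral_vertices[OF S_quad] .

lemma S_edges: "edge (S (Suc i)) (A i) (A (Suc i))" "edge (S (Suc i)) (A i) (B i)"
  "edge (S (Suc i)) (A (Suc i)) (B (Suc i))"
  using S_quad[of i] by (auto simp: quadrilateral_def closed_segment_commute)

text \<open>The wall along the strip, with every \<open>A i\<close> on its positive and every
  \<open>B i\<close> on its negative side.\<close>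

definition row :: "complex \<times> real" where "row = bisector G (A 0) (B 0)"

text \<open>The wall across \<open>S (Suc i)\<close>, positive towards the start of the
  strip.\<close>

definition col :: "nat \<Rightarrow> complex \<times> real" where "col i = bisector G (A i) (A (Suc i))"

lemma row_eq: "row = bisector G (A i) (B i)"
proof (induction i)
  case (Suc i)
  then show ?case
    using quadrilateral_walls[OF S_tile S_quad, of i] by (simp add: square_walls_def)
qed (simp add: row_def)

lemma col_row_orthogonal: "wall_form G row (col i) = 0"
  using quadrilateral_walls[OF S_tile S_quad, of i] row_eq[of "Suc i"] wall_form_sym
  unfolding square_walls_def col_def by metis

lemma row_signs: "affine_eval row (A i) > 0" "affine_eval row (B i) < 0"
  using quadrilateral_signs(5,8)[OF S_tile S_quad, of i] row_eq[of "Suc i"] by simp_all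

lemma col_signs_own: "affine_eval (col i) (A i) > 0" "affine_eval (col i) (B i) > 0"
  "affine_eval (col i) (A (Suc i)) < 0" "affine_eval (col i) (B (Suc i)) < 0"
  using quadrilateral_signs(1-4)[OF S_tile S_quad, of i] by (simp_all add: col_def)

lemma S_walls: "wall (S (Suc i)) row" "wall (S (Suc i)) (col i)"
  using edge_wall[OF S_edges(1)] edge_wall[OF S_edges(2)] by (simp_all add: row_eq[of i] col_def)

lemma row_neq_col: "row \<noteq> col i" "row \<noteq> - col i"
  using row_signs(1)[of i] row_signs(1)[of "Suc i"] col_signs_own[of i]
  by (auto simp: affine_eval_uminus)

lemma S_eq_if_col_wall: "wall (S (Suc j)) (col i) \<Longrightarrow> S (Suc j) = S (Suc i)"
  using two_walls_tile_unique[OF S_tile S_walls(1) _ S_tile S_walls(1) S_walls(2)] row_neq_col by blast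

lemma AB_in_S: "A i \<in> S (Suc i)" "B i \<in> S (Suc i)" "A (Suc i) \<in> S (Suc i)" "B (Suc i) \<in> S (Suc i)"
  using S_vertices[of i] vertex_in_tile by auto

text \<open>The strip does not return to a column. If it did, \<open>S (Suc (Suc j))\<close> would
  be \<open>S (Suc i)\<close>, entered through its far edge; the tile beyond that edge is
  \<open>S (Suc (Suc i))\<close>, which would be \<open>S (Suc j)\<close>. By the induction
  hypothesis this means \<open>j = i + 1\<close>, and then \<open>A j\<close> and
  \<open>A (Suc j)\<close> would coincide on both sides of \<open>col j\<close>.\<close>

lemma col_not_wall_after:
  "\<forall>i<j. \<not> wall (S (Suc j)) (col i) \<and> (\<forall>p\<in>S (Suc j). affine_eval (col i) p < 0)"
proof (induction j)
  case (Suc j)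
  show ?case
  proof (intro allI impI)
    fix i assume i: "i < Suc j"
    have neg: "affine_eval (col i) (A (Suc j)) < 0" "affine_eval (col i) (B (Suc j)) < 0"
      using Suc.IH i col_signs_own(3,4)[of j] AB_in_S[of j] by (cases "i = j"; force)+
    have not_wall: "\<not> wall (S (Suc (Suc j))) (col i)"
    proof
      assume "wall (S (Suc (Suc j))) (col i)"
      then have eq: "S (Suc (Suc j)) = S (Suc i)" by (rule S_eq_if_col_wall)
      then have "i \<noteq> j" using S_Suc_neq by auto
      then have "i < j" using i by simp
      have "A (Suc j) \<in> vertices (S (Suc i))" "B (Suc j) \<in> vertices (S (Suc i))"
        using S_vertices[of "Suc j"] eq by auto
      then have AB: "A (Suc j) = A (Suc i)" "B (Suc j) = B (Suc i)"
        using neg row_signs(1)[of "Suc j"] row_signs(2)[of "Suc j"] row_signs[of i] row_signs[of "Suc i"]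
          col_signs_own[of i] unfolding S_vertices by force+
      have "S (Suc j) \<noteq> S (Suc i)" using S_Suc_neq[of j] eq by simp
      then have "S (Suc j) = S (Suc (Suc i))"
        using third_tile_on_edge[OF S_tile S_tile S_tile S_edges(3)[of i] S_edges(2)[of "Suc i"]
            S_edges(3)[of j, unfolded AB] S_Suc_neq[symmetric]] by blast
      then have "wall (S (Suc j)) (col (Suc i))" using S_walls(2) by simp
      then have "Suc i = j" using Suc.IH \<open>i < j\<close> by (metis Suc_lessI)
      then show False using AB(1) col_signs_own(1,3)[of j] by simp
    qed
    have "A (Suc j) \<in> S (Suc (Suc j))" using AB_in_S by blast
    then show "\<not> wall (S (Suc (Suc j))) (col i) \<and> (\<forall>p\<in>S (Suc (Suc j)). affine_eval (col i) p < 0)"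
      using tile_sign[OF S_tile S_walls(2) S_tile not_wall] neg(1) not_wall by force
  qed
qed simp

lemma col_neg_on_S: "\<lbrakk>i < j; p \<in> S (Suc j)\<rbrakk> \<Longrightarrow> affine_eval (col i) p < 0"
  using col_not_wall_after by blast

lemma S_Suc_inj: "S (Suc i) = S (Suc j) \<Longrightarrow> i = j"
  using col_not_wall_after S_walls(2) by (metis linorder_neqE_nat)

lemma col_pos_A: "j \<le> i \<Longrightarrow> affine_eval (col i) (A j) > 0"
proof (induction rule: inc_induct)
  case base
  then show ?case by (rule col_signs_own)
next
  case (step j)
  have "\<not> wall (S (Suc j)) (col i)"
    using S_eq_if_col_wall S_Suc_inj step.hyps by (metis less_irrefl)
  from tile_sign[OF S_tile S_walls(2) S_tile this] show ?case
    using step.IH AB_in_S[of j] by force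
qed

lemma col_pos_on_S: assumes "j < i" "p \<in> S (Suc j)" shows "affine_eval (col i) p > 0"
proof -
  have "\<not> wall (S (Suc j)) (col i)"
    using S_eq_if_col_wall S_Suc_inj assms(1) by (metis less_irrefl)
  from tile_sign[OF S_tile S_walls(2) S_tile this] show ?thesis
    using col_pos_A[of j i] assms AB_in_S[of j] by force
qed

lemma col_neg_A: "i < j \<Longrightarrow> affine_eval (col i) (A j) < 0"
  using col_neg_on_S[of i j "A j"] AB_in_S(1) by simp

lemma A_vertex: "A i extreme_point_of S (Suc i)" "A (Suc i) extreme_point_of S (Suc i)"
  "B i extreme_point_of S (Suc i)" "B (Suc i) extreme_point_of S (Suc i)"
  using S_vertices[of i] by auto

lemma AB_vertex_iff:
  assumes "X \<in> \<T>"
  shows "A i extreme_point_of X \<longleftrightarrow> A i \<in> X" "B i extreme_point_of X \<longleftrightarrow> B i \<in> X"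
  using vertex_of_tile[OF S_tile assms A_vertex(1)] vertex_of_tile[OF S_tile assms A_vertex(3)]
    vertex_in_tile by auto

lemma A_in_plane: "A i \<in> plane G" and B_in_plane: "B i \<in> plane G"
  using AB_in_S[of i] tile_subset_plane[OF S_tile[of i]] by auto

lemma A_inj: "A i = A j \<Longrightarrow> i = j"
  using col_pos_A[of i i] col_pos_A[of j j] col_neg_A[of i j] col_neg_A[of j i]
  by (cases i j rule: linorder_cases) auto

lemma A_neq_B: "A i \<noteq> B j"
  using row_signs(1)[of i] row_signs(2)[of j] by auto

lemma wall_col_edge_right:
  assumes "X \<in> \<T>" "wall X (col i)" "A i \<in> X" shows "A (Suc i) \<in> X"
proof -
  have "edge X (A i) (A (Suc i))"
    using assms A_in_plane A_inj[of i "Suc i"]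
    by (intro wall_edge_at_vertex) (auto simp: AB_vertex_iff col_def)
  then show ?thesis using edge_ends_in(2) by blast
qed

lemma wall_col_edge_left:
  assumes "X \<in> \<T>" "wall X (col i)" "A (Suc i) \<in> X" shows "A i \<in> X"
proof -
  have "wall X (bisector G (A (Suc i)) (A i))"
    using assms(2) bisector_swap wall_uminus by (metis col_def)
  then have "edge X (A (Suc i)) (A i)"
    using assms A_in_plane A_inj[of i "Suc i"]
    by (intro wall_edge_at_vertex) (auto simp: AB_vertex_iff)
  then show ?thesis using edge_ends_in(2) by blast
qed

text \<open>The sign change makes \<open>row\<close> a wall of the tile, and the neighbor of
  \<open>A (Suc i)\<close> across \<open>row\<close> is \<open>B (Suc i)\<close>. So the tile
  contains an edge that already has two strip squares.\<close>

lemma tile_with_A_and_B: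
  assumes "X \<in> \<T>" "A (Suc i) \<in> X" "B j \<in> X"
  shows "X = S (Suc i) \<or> X = S (Suc (Suc i))"
proof -
  have "wall X row"
    using wall_if_sign_change[OF S_tile S_walls(1) assms] row_signs by blast
  then have "edge X (A (Suc i)) (B (Suc i))"
    using assms A_in_plane B_in_plane A_neq_B row_eq[of "Suc i"]
    by (intro wall_edge_at_vertex) (auto simp: AB_vertex_iff)
  then show ?thesis
    using third_tile_on_edge[OF S_tile S_tile assms(1) S_edges(3)[of i] S_edges(2)[of "Suc i"] _
        S_Suc_neq[symmetric]] by blast
qed

text \<open>
  Both columns are perpendicular to the row, so they have no common point.
\<close>

lemma columns_disjoint:
  assumes "s \<le> t" "p \<in> plane G" "affine_eval (col s) p > 0" "affine_eval (col t) p < 0"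
  shows False
proof -
  have "s < t" using assms by (cases "s = t") auto
  have convex: "convex (plane G)" by (cases G) auto
  \<comment> \<open>The points \<open>A s\<close>, \<open>A (Suc s)\<close>,
    \<open>A (Suc t)\<close> and \<open>p\<close> realize all four sign patterns of the two
    columns.\<close>
  obtain o' where o': "o' \<in> plane G" "affine_eval (col s) o' = 0" "affine_eval (col t) o' = 0"
    using common_zero_if_all_quadrants[OF convex A_in_plane[of s] A_in_plane[of "Suc s"] A_in_plane[of "Suc t"] assms(2),
        of "col s" "col t"] col_pos_A[of s s] col_pos_A[of s t] col_pos_A[of "Suc s" t] col_neg_A[of s "Suc s"]
      col_neg_A[of s "Suc t"] col_neg_A[of t "Suc t"] assms(3,4) \<open>s < t\<close> by auto
  have "wall_form G row row > 0"
    unfolding row_def using wall_form_bisector_pos A_in_plane B_in_plane A_neq_B by blast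
  then have "cross (fst (col s)) (fst (col t)) = 0"
    using common_perpendicular_parallel[OF o'(1) _ col_row_orthogonal col_row_orthogonal o'(2,3)] by blast
  from parallel_walls_contradiction[OF this o'(2,3), of "A s" "A (Suc s)"] show False
    using col_pos_A[of s s] col_pos_A[of s t] col_pos_A[of "Suc s" t] col_neg_A[of s "Suc s"] \<open>s < t\<close> by simp
qed

lemma S_in_star: "S (Suc i) \<in> star (A (Suc i))" "S (Suc (Suc i)) \<in> star (A (Suc i))"
  using S_tile A_vertex by (auto simp: star_def)

lemma S_adjacent: "adjacent (S (Suc i)) (S (Suc (Suc i)))"
  using S_edges(3)[of i] S_edges(2)[of "Suc i"] S_Suc_neq[of i] by (auto simp: adjacent_def)

section \<open>The fan of tiles at a vertex of the strip\<close>

lemma star_cycle_at_A: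
  "\<exists>Z. Z 0 = S (Suc i) \<and> Z (q - 1) = S (Suc (Suc i)) \<and> bij_betw Z {..<q} (star (A (Suc i))) \<and>
    (\<forall>j k. j < k \<longrightarrow> k < q \<longrightarrow> (adjacent (Z j) (Z k) \<longleftrightarrow> k = j + 1 \<or> j = 0 \<and> k = q - 1))"
proof -
  have "card (star (A (Suc i))) = q"
    using degree[OF S_tile A_vertex(2)] by (simp add: star_def)
  moreover have "q \<ge> 3" using q_ge_4 by simp
  ultimately show ?thesis using star_cycle[OF _ _ S_in_star S_adjacent] by metis
qed

text \<open>
  The index is shifted: \<open>fan i\<close> runs through the tiles at \<open>A (Suc i)\<close>, from \<open>S (Suc i)\<close> away from
  the edge it shares with \<open>S (Suc (Suc i))\<close> round to the latter. The squares of the second level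
  are \<open>fan i 1, \<dots>, fan i (q - 3)\<close>, since \<open>fan i (q - 2) = fan (Suc i) 1\<close>.
\<close>

definition fan :: "nat \<Rightarrow> nat \<Rightarrow> complex set" where
  "fan i = (SOME Z. Z 0 = S (Suc i) \<and> Z (q - 1) = S (Suc (Suc i)) \<and> bij_betw Z {..<q} (star (A (Suc i))) \<and>
    (\<forall>j k. j < k \<longrightarrow> k < q \<longrightarrow> (adjacent (Z j) (Z k) \<longleftrightarrow> k = j + 1 \<or> j = 0 \<and> k = q - 1)))"

lemma fan_first: "fan i 0 = S (Suc i)"
  and fan_end: "fan i (q - 1) = S (Suc (Suc i))"
  and fan_bij: "bij_betw (fan i) {..<q} (star (A (Suc i)))"
  and fan_adjacent: "\<lbrakk>j < k; k < q\<rbrakk> \<Longrightarrow> adjacent (fan i j) (fan i k) \<longleftrightarrow> k = j + 1 \<or> j = 0 \<and> k = q - 1"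
  using someI_ex[OF star_cycle_at_A[of i], folded fan_def] by blast+

lemma fan_inj: "\<lbrakk>fan i j = fan i k; j < q; k < q\<rbrakk> \<Longrightarrow> j = k"
  using fan_bij[of i] by (auto simp: bij_betw_def inj_on_def)

lemma fan_in_star: "k < q \<Longrightarrow> fan i k \<in> star (A (Suc i))"
  using fan_bij[of i] by (auto simp: bij_betw_def)

lemma fan_tile: "k < q \<Longrightarrow> fan i k \<in> \<T>" and A_in_fan: "k < q \<Longrightarrow> A (Suc i) \<in> fan i k"
  using fan_in_star[of k i] vertex_in_tile by (auto simp: star_def)

lemma fan_cases:
  assumes "X \<in> \<T>" "A (Suc i) \<in> X" obtains k where "k < q" "X = fan i k"
proof -
  have "X \<in> star (A (Suc i))" using assms by (simp add: star_def AB_vertex_iff)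
  then have "X \<in> fan i ` {..<q}" using fan_bij[of i] by (simp add: bij_betw_def)
  then show ?thesis using that by auto
qed

lemma A_notin_S: "j \<notin> {i, Suc i} \<Longrightarrow> A j \<notin> S (Suc i)"
proof -
  assume "j \<notin> {i, Suc i}"
  then have "A j \<notin> vertices (S (Suc i))"
    unfolding S_vertices using A_inj A_neq_B by blast
  then show ?thesis using AB_vertex_iff(1)[OF S_tile] by auto
qed

text \<open>Such a tile shares an edge with \<open>fan i 0\<close>, so its index is \<open>1\<close>
  or \<open>q - 1\<close>; the latter is \<open>S (Suc (Suc i))\<close>, which does not contain
  \<open>A i\<close>.\<close>

lemma fan_one_eq:
  assumes "X \<in> \<T>" "A i \<in> X" "A (Suc i) \<in> X" "X \<noteq> S (Suc i)"
  shows "X = fan i 1"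
proof -
  obtain k where k: "k < q" "X = fan i k" using fan_cases assms(1,3) .
  have "k \<noteq> 0" using k assms(4) fan_first by auto
  have "A i \<noteq> A (Suc i)" using A_inj by fastforce
  then have "edge (S (Suc i)) (A i) (A (Suc i))" "edge X (A i) (A (Suc i))"
    using common_vertices_edge[OF S_tile assms(1) assms(4)[symmetric] _ A_vertex(1,2) assms(2,3)] by auto
  then have "adjacent (fan i 0) (fan i k)"
    using assms(4) k fan_first by (auto simp: adjacent_def)
  then have "k = 1 \<or> k = q - 1" using fan_adjacent[of 0 k i] k \<open>k \<noteq> 0\<close> by auto
  moreover have "k \<noteq> q - 1"
    using k(2) fan_end[of i] A_notin_S[of i "Suc i"] assms(2) by auto
  ultimately show ?thesis using k by simp
qed

lemma fan_last_eq:
  assumes "X \<in> \<T>" "A (Suc i) \<in> X" "A (Suc (Suc i)) \<in> X" "X \<noteq> S (Suc (Suc i))"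
  shows "X = fan i (q - 2)"
proof -
  obtain k where k: "k < q" "X = fan i k" using fan_cases assms(1,2) .
  have "k \<noteq> q - 1" using k assms(4) fan_end by auto
  then have k': "k < q - 1" using k(1) by simp
  have "A (Suc i) \<noteq> A (Suc (Suc i))" using A_inj by fastforce
  then have "edge (S (Suc (Suc i))) (A (Suc i)) (A (Suc (Suc i)))" "edge X (A (Suc i)) (A (Suc (Suc i)))"
    using common_vertices_edge[OF S_tile assms(1) assms(4)[symmetric] _ A_vertex(1,2) assms(2,3)] by auto
  then have "adjacent (fan i k) (fan i (q - 1))"
    using assms(4) k fan_end by (auto simp: adjacent_def)
  then have "q - 1 = k + 1 \<or> k = 0" using fan_adjacent[of k "q - 1" i] k' by auto
  moreover have "k \<noteq> 0"
    using k(2) fan_first[of i] A_notin_S[of "Suc (Suc i)" i] assms(3) by (intro notI) simp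
  ultimately have "k = q - 2" by linarith
  then show ?thesis using k by simp
qed

lemma A_in_fan_one: "A i \<in> fan i 1"
proof -
  obtain X where X: "X \<in> \<T>" "X \<noteq> S (Suc i)" "edge X (A i) (A (Suc i))"
    using other_tile_on_edge[OF S_tile S_edges(1)] .
  then show ?thesis using fan_one_eq edge_ends_in by metis
qed

text \<open>Both are the tile across the edge from \<open>A (Suc i)\<close> to
  \<open>A (Suc (Suc i))\<close>. The overlap leaves \<open>q - 3\<close> of the
  \<open>q - 2\<close> non-strip tiles for each fan.\<close>

lemma fan_link: "fan i (q - 2) = fan (Suc i) 1"
proof -
  obtain X where X: "X \<in> \<T>" "X \<noteq> S (Suc (Suc i))" "edge X (A (Suc i)) (A (Suc (Suc i)))"
    using other_tile_on_edge[OF S_tile S_edges(1)] .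
  then have "X = fan i (q - 2)" "X = fan (Suc i) 1"
    using fan_last_eq fan_one_eq edge_ends_in by metis+
  then show ?thesis by simp
qed

text \<open>The columns in between are walls of the tile, so it contains \<open>A i\<close>,
  \<open>A (Suc i)\<close> and \<open>A (Suc (Suc i))\<close>. Then it is both
  \<open>fan i 1\<close> and \<open>fan i (q - 2)\<close>, and these indices differ for
  \<open>q \<ge> 4\<close>.\<close>

lemma no_tile_with_distant_A:
  assumes "X \<in> \<T>" "A i \<in> X" "A j \<in> X" "i + 2 \<le> j" shows False
proof -
  have "wall X (col i)"
    using wall_if_sign_change[OF S_tile S_walls(2) assms(1-3)] col_pos_A[of i i] col_neg_A[of i j] assms(4) by simp
  then have A1: "A (Suc i) \<in> X" using wall_col_edge_right assms by blast
  have A2: "A (Suc (Suc i)) \<in> X"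
  proof (cases "j = Suc (Suc i)")
    case False
    then have "wall X (col (Suc i))"
      using wall_if_sign_change[OF S_tile S_walls(2) assms(1) A1 assms(3)] col_pos_A[of "Suc i" "Suc i"]
        col_neg_A[of "Suc i" j] assms(4) by simp
    then show ?thesis using wall_col_edge_right assms(1) A1 by blast
  qed (use assms in simp)
  have "X \<noteq> S (Suc i)" "X \<noteq> S (Suc (Suc i))"
    using A_notin_S[of "Suc (Suc i)" i] A_notin_S[of i "Suc i"] A2 assms(2) by auto
  then have "fan i 1 = fan i (q - 2)"
    using fan_one_eq[OF assms(1,2) A1] fan_last_eq[OF assms(1) A1 A2] by simp
  then show False using fan_inj[of i 1 "q - 2"] q_ge_4 by simp
qed

lemma fan_A_cases:
  assumes "1 \<le> k" "k \<le> q - 3" "A j \<in> fan i k"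
  shows "j = Suc i \<or> j = i \<and> k = 1"
proof -
  have kq: "k < q" "k \<noteq> q - 2" "k \<noteq> q - 1" "k \<noteq> 0" using assms q_ge_4 by auto
  note X = fan_tile[OF kq(1), of i] A_in_fan[OF kq(1), of i]
  have ne: "fan i k \<noteq> S (Suc i)" "fan i k \<noteq> S (Suc (Suc i))"
    using fan_inj[of i k 0] fan_inj[of i k "q - 1"] fan_first[of i] fan_end[of i] kq q_ge_4 by auto
  consider "Suc i + 2 \<le> j" | "j = Suc (Suc i)" | "j = Suc i" | "j = i" | "j + 2 \<le> Suc i" by linarith
  then show ?thesis
  proof cases
    case 1
    then show ?thesis using no_tile_with_distant_A[OF X assms(3)] by blast
  next
    case 2
    then show ?thesis using fan_last_eq[OF X _ ne(2)] assms(3) fan_inj[of i k "q - 2"] kq by auto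
  next
    case 4
    then show ?thesis using fan_one_eq[OF X(1) _ X(2) ne(1)] assms(3) fan_inj[of i k 1] kq q_ge_4 by auto
  next
    case 5
    then show ?thesis using no_tile_with_distant_A[OF X(1) assms(3) X(2)] by blast
  qed simp
qed

lemma fan_no_B:
  assumes "1 \<le> k" "k \<le> q - 3" shows "B j \<notin> fan i k"
proof
  assume "B j \<in> fan i k"
  have kq: "k < q" "k \<noteq> q - 1" "k \<noteq> 0" using assms q_ge_4 by auto
  then show False
    using tile_with_A_and_B[OF fan_tile[OF kq(1)] A_in_fan[OF kq(1)] \<open>B j \<in> fan i k\<close>]
      fan_inj[of i k 0] fan_inj[of i k "q - 1"] fan_first[of i] fan_end[of i] q_ge_4 by auto
qed

end

section \<open>Numbering of the second level and adjacency within the board\<close>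

lemma block_index_Suc_iff:
  fixes i j k l s :: nat
  assumes "i < j" "k < s" "l < s"
  shows "j * s + l = i * s + k + 1 \<longleftrightarrow> j = i + 1 \<and> k + 1 = s \<and> l = 0"
proof -
  obtain d where d: "j = Suc (i + d)" using assms(1) less_imp_Suc_add by blast
  have "j * s = i * s + s + d * s" by (simp add: d algebra_simps)
  then have "j * s + l = i * s + k + 1 \<longleftrightarrow> s + d * s + l = k + 1" by auto
  also have "\<dots> \<longleftrightarrow> d * s = 0 \<and> k + 1 = s \<and> l = 0" using assms(2) by (cases d) auto
  also have "\<dots> \<longleftrightarrow> j = i + 1 \<and> k + 1 = s \<and> l = 0" using assms(2) d by auto
  finally show ?thesis .
qed

context mosaic_strip
begin

text \<open>Each fan is a block of \<open>q - 3\<close> squares. The shift by one skips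
  \<open>fan i 0\<close>, which belongs to the strip; \<open>fan i (q - 2)\<close> opens the next
  block.\<close>

definition T :: "nat \<Rightarrow> complex set" where
  "T m = fan (m div (q - 3)) (m mod (q - 3) + 1)"

lemma T_index: "1 \<le> m mod (q - 3) + 1" "m mod (q - 3) + 1 \<le> q - 3"
  using q_ge_4 by (simp_all add: Suc_leI)

lemma fan_eq_iff:
  assumes "1 \<le> k" "k \<le> q - 3" "1 \<le> l" "l \<le> q - 3" "fan i k = fan j l"
  shows "i = j \<and> k = l"
proof -
  have q: "k < q" "l < q" using assms q_ge_4 by auto
  have "A (Suc j) \<in> fan i k" "A (Suc i) \<in> fan j l"
    using A_in_fan q assms(5) by metis+
  then have "i = j"
    using fan_A_cases[OF assms(1,2), of "Suc j" i] fan_A_cases[OF assms(3,4), of "Suc i" j] by auto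
  then show ?thesis using fan_inj assms(5) q by auto
qed

lemma T_inj': "T m = T m' \<Longrightarrow> m = m'"
  unfolding T_def using fan_eq_iff[OF T_index T_index, of "m div (q - 3)" m "m' div (q - 3)" m']
  by (metis add_right_cancel div_mult_mod_eq)

lemma S_not_fan:
  assumes "1 \<le> k" "k \<le> q - 3" shows "S (Suc j) \<noteq> fan i k"
  using fan_no_B[OF assms, of j i] AB_in_S(2)[of j] by auto

lemma T_image: "T ` {..<n * (q - 3)} = {fan i k |i k. i < n \<and> 1 \<le> k \<and> k \<le> q - 3}"
proof (intro subset_antisym subsetI)
  fix X assume "X \<in> T ` {..<n * (q - 3)}"
  then obtain m where m: "m < n * (q - 3)" "X = T m" by auto
  have "m div (q - 3) < n" using m(1) by (simp add: less_mult_imp_div_less)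
  then show "X \<in> {fan i k |i k. i < n \<and> 1 \<le> k \<and> k \<le> q - 3}"
    using m(2) T_index[of m] unfolding T_def by blast
next
  fix X assume "X \<in> {fan i k |i k. i < n \<and> 1 \<le> k \<and> k \<le> q - 3}"
  then obtain i k where ik: "X = fan i k" "i < n" "1 \<le> k" "k \<le> q - 3" by blast
  then obtain k' where k': "k = Suc k'" "k' < q - 3" by (cases k) auto
  define m where "m = i * (q - 3) + k'"
  have "m div (q - 3) = i" "m mod (q - 3) = k'" using k'(2) by (simp_all add: m_def)
  then have "T m = X" using ik(1) k'(1) by (simp add: T_def)
  moreover have "m < n * (q - 3)"
  proof -
    have "m < Suc i * (q - 3)" using k'(2) by (simp add: m_def)
    also have "\<dots> \<le> n * (q - 3)" using ik(2) by (intro mult_le_mono1) simp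
    finally show ?thesis .
  qed
  ultimately show "X \<in> T ` {..<n * (q - 3)}" by auto
qed

lemma second_level_eq: "second_level \<T> A B n = T ` {..<n * (q - 3)}"
proof (intro subset_antisym subsetI)
  fix X assume "X \<in> second_level \<T> A B n"
  then obtain i' where X: "X \<in> \<T>" "i' \<in> {1..n}" "A i' \<in> X"
    "\<And>j. j \<in> {1..n} \<Longrightarrow> B j \<notin> X" "A (n + 1) \<notin> X"
    by (auto simp: second_level_def AB_vertex_iff)
  then obtain i where i: "i' = Suc i" "i < n" by (cases i') auto
  obtain k where k: "k < q" "X = fan i k" using fan_cases X(1,3) i(1) by blast
  have "B (Suc i) \<notin> X" using X(4) i by simp
  then have k': "k \<noteq> 0" "k \<noteq> q - 1"
    using k(2) fan_first[of i] fan_end[of i] AB_in_S(4)[of i] AB_in_S(2)[of "Suc i"] by (intro notI; simp)+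
  show "X \<in> T ` {..<n * (q - 3)}"
  proof (cases "k = q - 2")
    case True
    \<comment> \<open>The tile shared with the next fan. At the last fan it is the one excluded by
      the condition on \<open>A (n + 1)\<close>.\<close>
    then have eq: "X = fan (Suc i) 1" using k(2) fan_link by simp
    then have "A (Suc (Suc i)) \<in> X" using A_in_fan[of 1 "Suc i"] q_ge_4 by simp
    then have "Suc i \<noteq> n" using X(5) by auto
    then show ?thesis unfolding T_image using eq i q_ge_4 by force
  next
    case False
    then have "1 \<le> k" "k \<le> q - 3" using k(1) k' by auto
    then show ?thesis unfolding T_image using k(2) i(2) by blast
  qed
next
  fix X assume "X \<in> T ` {..<n * (q - 3)}"
  then obtain i k where ik: "X = fan i k" "i < n" "1 \<le> k" "k \<le> q - 3" unfolding T_image by blast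
  then have "k < q" using q_ge_4 by simp
  then have X: "X \<in> \<T>" "A (Suc i) \<in> X" using fan_tile A_in_fan ik(1) by auto
  have "A (n + 1) \<notin> X" using fan_A_cases[OF ik(3,4), of "n + 1" i] ik(1,2) by auto
  then show "X \<in> second_level \<T> A B n"
    using X fan_no_B[OF ik(3,4)] ik(1,2) by (auto simp: second_level_def AB_vertex_iff intro!: bexI[of _ "Suc i"])
qed

lemma board_eq: "board \<T> A B S n = S ` {1..n} \<union> T ` {..<n * (q - 3)}"
  by (simp add: board_def second_level_eq)

lemma adjacent_common_vertex:
  assumes "X \<in> \<T>" "Y \<in> \<T>" "adjacent X Y"
  obtains v w where "v \<noteq> w" "v extreme_point_of X" "w extreme_point_of X" "v \<in> Y" "w \<in> Y"
proof -
  obtain v w where "edge X v w" "edge Y v w" using adjacent_common_edge[OF assms] by metis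
  then show ?thesis using that[of v w] edge_distinct edge_vertices edge_ends_in by blast
qed

text \<open>Squares of the strip that are not consecutive lie strictly on different sides of a
  column between them.\<close>

lemma S_adjacent_iff: "adjacent (S (Suc i)) (S (Suc j)) \<longleftrightarrow> i = Suc j \<or> j = Suc i"
proof -
  have far: "\<not> adjacent (S (Suc i)) (S (Suc j))" if "Suc i < j" for i j
  proof
    assume "adjacent (S (Suc i)) (S (Suc j))"
    then obtain v where "v \<in> S (Suc i)" "v \<in> S (Suc j)"
      using adjacent_common_vertex[OF S_tile S_tile] vertex_in_tile by metis
    then show False
      using col_pos_on_S[of i "Suc i" v] col_neg_on_S[of "Suc i" j v] that by simp
  qed
  have "\<not> adjacent (S (Suc i)) (S (Suc i))" by (simp add: adjacent_def)
  then show ?thesis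
    using far[of i j] far[of j i] S_adjacent[of i] S_adjacent[of j] adjacent_sym
    by (metis linorder_neqE_nat not_less_eq less_Suc_eq)
qed

lemma S_fan_adjacent_iff:
  assumes "1 \<le> k" "k \<le> q - 3"
  shows "adjacent (S (Suc j)) (fan i k) \<longleftrightarrow> i = j \<and> k = 1"
proof -
  have kq: "k < q" "0 < k" "k < q - 1" "k \<noteq> q - 2" using assms q_ge_4 by auto
  consider "j = i" | "j = Suc i" | "j \<noteq> i" "j \<noteq> Suc i" by blast
  then show ?thesis
  proof cases
    case 1
    then show ?thesis using fan_adjacent[of 0 k i] fan_first[of i] kq by auto
  next
    case 2
    then show ?thesis using fan_adjacent[of k "q - 1" i] fan_end[of i] kq q_ge_4 adjacent_sym by auto
  next
    case 3
    have "\<not> adjacent (S (Suc j)) (fan i k)"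
    proof
      assume "adjacent (S (Suc j)) (fan i k)"
      then obtain v w where vw: "v \<noteq> w" "v extreme_point_of S (Suc j)" "w extreme_point_of S (Suc j)"
        "v \<in> fan i k" "w \<in> fan i k"
        using adjacent_common_vertex[OF S_tile fan_tile[OF kq(1)]] by metis
      have "v \<in> {A j, A (Suc j), B (Suc j), B j}" "w \<in> {A j, A (Suc j), B (Suc j), B j}"
        using S_vertices[of j] vw(2,3) by auto
      \<comment> \<open>A common edge has two ends, and no \<open>B\<close> lies in the fan; so both
        \<open>A j\<close> and \<open>A (Suc j)\<close> do.\<close>
      then have "A j \<in> fan i k"
        using vw(1,4,5) fan_no_B[OF assms] by auto
      then show False using fan_A_cases[OF assms, of j i] 3 by auto
    qed
    then show ?thesis using 3 by auto
  qed
qed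

text \<open>A column is no wall of a tile that contains only the later of its two vertices
  \<open>A\<close>. As \<open>fan i 1\<close> contains \<open>A i\<close> too, the column before has
  to be taken for it.\<close>

lemma fan_right_of_column:
  assumes "1 \<le> k" "k \<le> q - 3" "p \<in> fan i k" "t = (if k = 1 then i - 1 else i)" "k = 1 \<longrightarrow> i > 0"
  shows "affine_eval (col t) p < 0"
proof -
  have k: "k < q" using assms q_ge_4 by simp
  note X = fan_tile[OF k, of i] A_in_fan[OF k, of i]
  have t: "t \<le> i" "if k = 1 then Suc t = i else t = i" using assms(4,5) by simp_all
  have "A t \<notin> fan i k" using fan_A_cases[OF assms(1,2), of t i] t by (cases "k = 1") auto
  moreover have "A (Suc t) \<in> fan i k" using t X(2) A_in_fan_one[of i] by (cases "k = 1") auto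
  ultimately have "\<not> wall (fan i k) (col t)" using wall_col_edge_left[OF X(1)] by blast
  from tile_sign[OF S_tile S_walls(2) X(1) this] show ?thesis
    using X(2) assms(3) col_neg_A[of t "Suc i"] t(1) by force
qed

lemma fan_left_of_column:
  assumes "1 \<le> k" "k \<le> q - 3" "p \<in> fan i k"
  shows "affine_eval (col (Suc i)) p > 0"
proof -
  have k: "k < q" using assms q_ge_4 by simp
  note X = fan_tile[OF k, of i] A_in_fan[OF k, of i]
  have "A (Suc (Suc i)) \<notin> fan i k" using fan_A_cases[OF assms(1,2), of "Suc (Suc i)" i] by auto
  then have "\<not> wall (fan i k) (col (Suc i))" using wall_col_edge_right[OF X(1)] X(2) by blast
  from tile_sign[OF S_tile S_walls(2) X(1) this] show ?thesis
    using X(2) assms(3) col_pos_A[of "Suc i" "Suc i"] by force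
qed

text \<open>Apart from \<open>j = Suc i\<close>, \<open>l = 1\<close>, where \<open>fan_link\<close>
  moves the question into one fan, the first tile lies before \<open>col (Suc i)\<close> and the
  second after a column that is not earlier; \<open>columns_disjoint\<close> keeps them
  apart.\<close>

lemma fan_adjacent_later_iff:
  assumes k: "1 \<le> k" "k \<le> q - 3" and l: "1 \<le> l" "l \<le> q - 3" and "i < j"
  shows "adjacent (fan i k) (fan j l) \<longleftrightarrow> j = Suc i \<and> k = q - 3 \<and> l = 1"
proof (cases "j = Suc i \<and> l = 1")
  case True
  then have "adjacent (fan i k) (fan j l) \<longleftrightarrow> adjacent (fan i k) (fan i (q - 2))" using fan_link by simp
  also have "\<dots> \<longleftrightarrow> k = q - 3" using fan_adjacent[of k "q - 2" i] k q_ge_4 by auto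
  finally show ?thesis using True by simp
next
  case False
  define t where "t = (if l = 1 then j - 1 else j)"
  have t: "Suc i \<le> t" "l = 1 \<longrightarrow> j > 0" using False \<open>i < j\<close> by (auto simp: t_def)
  have q: "k < q" "l < q" using k l q_ge_4 by auto
  have "\<not> adjacent (fan i k) (fan j l)"
  proof
    assume "adjacent (fan i k) (fan j l)"
    then obtain p where p: "p \<in> fan i k" "p \<in> fan j l"
      using adjacent_common_vertex[OF fan_tile[OF q(1)] fan_tile[OF q(2)]] vertex_in_tile by metis
    have "p \<in> plane G" using p(1) tile_subset_plane fan_tile q by blast
    then show False
      using columns_disjoint[OF t(1)] fan_left_of_column[OF k p(1)] fan_right_of_column[OF l p(2) t_def t(2)]
      by blast
  qed
  then show ?thesis using False by auto
qed

lemma T_adjacent_less: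
  assumes "m < m'" shows "adjacent (T m) (T m') \<longleftrightarrow> m' = m + 1"
proof -
  define i k j l where "i = m div (q - 3)" and "k = m mod (q - 3)"
    and "j = m' div (q - 3)" and "l = m' mod (q - 3)"
  have m: "m = i * (q - 3) + k" "m' = j * (q - 3) + l"
    by (simp_all only: i_def k_def j_def l_def div_mult_mod_eq)
  have bounds: "k < q - 3" "l < q - 3" using q_ge_4 by (simp_all add: k_def l_def)
  have T: "T m = fan i (k + 1)" "T m' = fan j (l + 1)" by (simp_all add: T_def i_def k_def j_def l_def)
  have "i \<le> j" unfolding i_def j_def using assms by (intro div_le_mono) simp
  show ?thesis
  proof (cases "i = j")
    case True
    then have "k < l" using m assms by simp
    then show ?thesis
      unfolding T using fan_adjacent[of "k + 1" "l + 1" i] bounds True m by auto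
  next
    case False
    then have "i < j" using \<open>i \<le> j\<close> by simp
    have "adjacent (T m) (T m') \<longleftrightarrow> j = Suc i \<and> k + 1 = q - 3 \<and> l + 1 = 1"
      unfolding T using bounds by (intro fan_adjacent_later_iff \<open>i < j\<close>) auto
    then show ?thesis
      using block_index_Suc_iff[OF \<open>i < j\<close> bounds] m by auto
  qed
qed

sublocale ladder S T "q - 3"
proof
  show "q - 3 \<ge> 1" using q_ge_4 by simp
  show "i = j" if "i \<ge> 1" "j \<ge> 1" "S i = S j" for i j
    using that S_Suc_inj[of "i - 1" "j - 1"] by simp
  show "m = m'" if "T m = T m'" for m m' using that by (rule T_inj')
  show "S i \<noteq> T m" if "i \<ge> 1" for i m
    using that S_not_fan[OF T_index, of "i - 1"] by (simp add: T_def)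
  show "adjacent (S i) (S j) \<longleftrightarrow> i = j + 1 \<or> j = i + 1" if "i \<ge> 1" "j \<ge> 1" for i j
    using that S_adjacent_iff[of "i - 1" "j - 1"] by auto
  show "adjacent (T m) (T m') \<longleftrightarrow> m = m' + 1 \<or> m' = m + 1" for m m'
  proof -
    have "\<not> adjacent (T m) (T m)" by (simp add: adjacent_def)
    then show ?thesis
      using T_adjacent_less[of m m'] T_adjacent_less[of m' m] adjacent_sym[of "T m" "T m'"]
      by (cases m m' rule: linorder_cases) auto
  qed
  show "adjacent (S i) (T m) \<longleftrightarrow> m = (i - 1) * (q - 3)" if "i \<ge> 1" for i m
  proof -
    have "adjacent (S i) (T m) \<longleftrightarrow> m div (q - 3) = i - 1 \<and> m mod (q - 3) + 1 = 1"
      using S_fan_adjacent_iff[OF T_index, of "i - 1"] that by (simp add: T_def)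
    also have "\<dots> \<longleftrightarrow> m = (i - 1) * (q - 3)"
      using q_ge_4 by auto
    finally show ?thesis .
  qed
qed

end

theorem theorem1:
  fixes q :: nat and a b :: int
    and \<T> :: "complex set set" and A B :: "nat \<Rightarrow> complex" and S :: "nat \<Rightarrow> complex set"
    and R :: "nat \<Rightarrow> int" and u :: "int \<Rightarrow> int" and \<alpha> \<beta> \<gamma> :: "nat \<Rightarrow> int"
  assumes "q \<ge> 4" and "a > 0" and "b > 0"
    and "square_mosaic q \<T>" and "square_strip \<T> A B S"
    and R: "\<And>n. R n = int (card (colored_tilings a b (board \<T> A B S n)))"
    and u: "u (-1) = 0" "u 0 = 1" "\<And>k. k \<ge> 1 \<Longrightarrow> u k = a * u (k - 1) + b * u (k - 2)"
    and \<alpha>: "\<alpha> 4 = a^2 + b" "\<alpha> 5 = a * (a^2 + 3 * b)"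
      "\<And>p. p \<ge> 4 \<Longrightarrow> \<alpha> (p + 2) = a * \<alpha> (p + 1) + b * \<alpha> p"
    and \<beta>: "\<beta> 4 = 2 * b * (a^2 + b)" "\<beta> 5 = b * (a^2 + b) * (a^2 + 2 * b)"
      "\<beta> 6 = b * (a^6 + 6 * a^4 * b + 10 * a^2 * b^2 + 2 * b^3)"
      "\<And>p. p \<ge> 4 \<Longrightarrow>
         \<beta> (p + 3) = (a^2 + b) * \<beta> (p + 2) + b * (a^2 + b) * \<beta> (p + 1) - b^3 * \<beta> p"
    and \<gamma>: "\<gamma> 4 = b^2 * (a^2 - b)" "\<gamma> 5 = - a * b^3 * (a^2 + b)"
      "\<And>p. p \<ge> 4 \<Longrightarrow> \<gamma> (p + 2) = - a * b * \<gamma> (p + 1) + b^3 * \<gamma> p"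
  shows "(\<forall>n\<ge>4. R n = \<alpha> q * R (n - 1) + \<beta> q * R (n - 2) + \<gamma> q * R (n - 3)
                       - b ^ (2 * (q - 2)) * R (n - 4))
    \<and> R 0 = 1
    \<and> R 1 = u (int q - 2)
    \<and> R 2 = (u (int q - 2))^2 + a * b * u (int q - 4) * u (int q - 3)
             + b * (u (int q - 3))^2 + b^2 * (u (int q - 4))^2
    \<and> R 3 = ((u (int q - 2))^2 + 2 * a * b * u (int q - 4) * u (int q - 3)
               + 2 * b * (u (int q - 3))^2 + 2 * b^2 * (u (int q - 4))^2) * u (int q - 2)
             + b^2 * (u (int q - 3) * u (int q - 4)
                       + (a^2 + b) * u (int q - 4) * u (int q - 5)
                       + a * (u (int q - 4))^2) * u (int q - 3)
             + a * b^3 * (u (int q - 4))^2 * u (int q - 5)"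
proof -
  define G where "G = (if q = 4 then Euclidean else Hyperbolic)"
  have mosaic: "tiling_of_plane G \<T>" "\<forall>X\<in>\<T>. regular_square G X"
    "\<forall>v. (\<exists>X\<in>\<T>. v extreme_point_of X) \<longrightarrow> card {X\<in>\<T>. v extreme_point_of X} = q"
    using assms(4) unfolding square_mosaic_def Let_def G_def by blast+
  interpret mosaic_strip G \<T> q A B S
    using mosaic assms(1,5) by unfold_locales auto
  interpret weighted_ladder S T "q - 3" a b u
    using u by unfold_locales auto
  \<comment> \<open>The ladder is indexed by \<open>s = q - 3\<close> and the claim by
    \<open>q\<close>; in particular \<open>2 * s + 2\<close> becomes the exponent
    \<open>2 * (q - 2)\<close>.\<close>
  have s: "int (q - 3) = int q - 3" "q - 3 + 3 = q" "2 * (q - 3) + 2 = 2 * (q - 2)"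
    using assms(1) by auto
  have i: "int q - 3 + 1 = int q - 2" "int q - 3 - 1 = int q - 4" "int q - 3 - 2 = int q - 5"
    by simp_all
  have RQ: "R n = board_count n" for n
    using assms(2,3) by (simp add: R board_eq card_colored_tilings board_count_def tilings_def)
  show ?thesis
    unfolding RQ
    using board_count_rec[OF \<alpha> \<beta> \<gamma>, unfolded s] counts_0 counts_1 board_count_values[unfolded s i] unfolding s i by blast
qed

end
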